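(* Let $p\in\mathbb{N}$ (so $p\geqslant1$), and let $\widehat{\gamma_p}$ be the diffraction measure of the Dirac comb $\delta_\Lambda=\sum_{x\in\Lambda}\delta_x$, where $\Lambda$ is the set of left endpoints of the tiles of a tiling of $\mathbb{R}$ generated by the noble means inflation with parameter $p$, that is, by the substitution $a\mapsto a^pb$, $b\mapsto a$ with intervals of type $a$ of length $\lambda_p=\frac12\bigl(p+\sqrt{p^2+4}\bigr)$ and intervals of type $b$ of length $1$. Set $Z_p(k)=\widehat{\gamma_p}\bigl((0,k]\bigr)$ for $k>0$. Then \[ Z_p(k)\asymp k^4\qquad\text{as } k\searrow0, \] that is, there are constants $c_1,c_2>0$ and $k_0>0$ such that $c_1k^4\leqslant Z_p(k)\leqslant c_2k^4$ for all $0<k\leqslant k_0$. In particular, $Z_p(k)=\mathcal{O}(k^4)$ as $k\searrow0$.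
   Context: The substitution acts on words over $\{a,b\}$ by concatenation; its substitution matrix is $\begin{pmatrix}p&1\\1&0\end{pmatrix}$ with Perron–Frobenius eigenvalue $\lambda_p$. A tiling generated by the inflation is a tiling of $\mathbb{R}$ by translates of intervals of type $a$ (length $\lambda_p$) and type $b$ (length $1$) such that every finite word read off from consecutive tiles occurs as a subword of the $n$-fold image of $a$ under the substitution for some $n$. The diffraction measure below exists and is the same for all such tilings. The autocorrelation of $\delta_\Lambda$ is the vague limit $\gamma_p=\lim_{R\to\infty}\frac{1}{2R}\sum_{x,y\in\Lambda\cap[-R,R]}\delta_{x-y}$. The diffraction measure $\widehat{\gamma_p}$ is the Fourier transform of $\gamma_p$ (a positive measure on $\mathbb{R}$), with the convention $\widehat{g}(k)=\int_{\mathbb{R}} e^{-2\pi i kx}g(x)\,dx$ for functions. *)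

theory Defs
  imports "HOL-Analysis.Analysis" "HOL-Library.Landau_Symbols" "HOL-Library.Sublist"
begin

section \<open>Noble means substitution and its tilings of the line\<close>

datatype letter = Type_a | Type_b

fun noble_letter :: "nat \<Rightarrow> letter \<Rightarrow> letter list" where
  "noble_letter p Type_a = replicate p Type_a @ [Type_b]"
| "noble_letter p Type_b = [Type_a]"

definition noble_subst :: "nat \<Rightarrow> letter list \<Rightarrow> letter list" where
  "noble_subst p w = concat (map (noble_letter p) w)"

definition legal_word :: "nat \<Rightarrow> letter list \<Rightarrow> bool" where
  "legal_word p w \<longleftrightarrow> (\<exists>n. sublist w ((noble_subst p ^^ n) [Type_a]))"

definition noble_mean :: "nat \<Rightarrow> real" where
  "noble_mean p = (real p + sqrt ((real p)\<^sup>2 + 4)) / 2"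

fun tile_length :: "nat \<Rightarrow> letter \<Rightarrow> real" where
  "tile_length p Type_a = noble_mean p"
| "tile_length p Type_b = 1"

text \<open>A tile is given by its type and its left endpoint.\<close>

type_synonym tile = "letter \<times> real"

fun tile_support :: "nat \<Rightarrow> tile \<Rightarrow> real set" where
  "tile_support p (c, x) = {x .. x + tile_length p c}"

definition is_tiling :: "nat \<Rightarrow> tile set \<Rightarrow> bool" where
  "is_tiling p T \<longleftrightarrow>
     (\<Union>t\<in>T. tile_support p t) = UNIV \<and>
     (\<forall>s\<in>T. \<forall>t\<in>T. s \<noteq> t \<longrightarrow>
        interior (tile_support p s) \<inter> interior (tile_support p t) = {})"

definition next_tile :: "nat \<Rightarrow> tile \<Rightarrow> tile \<Rightarrow> bool" where
  "next_tile p s t \<longleftrightarrow> snd t = snd s + tile_length p (fst s)"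

definition noble_means_tiling :: "nat \<Rightarrow> tile set \<Rightarrow> bool" where
  "noble_means_tiling p T \<longleftrightarrow>
     is_tiling p T \<and>
     (\<forall>ts. set ts \<subseteq> T \<and> successively (next_tile p) ts \<longrightarrow> legal_word p (map fst ts))"

definition left_endpoints :: "tile set \<Rightarrow> real set" where
  "left_endpoints T = snd ` T"


section \<open>Autocorrelation and diffraction of a point set\<close>

definition radon_measure :: "real measure \<Rightarrow> bool" where
  "radon_measure M \<longleftrightarrow>
     sets M = sets borel \<and> (\<forall>K. compact K \<longrightarrow> emeasure M K < \<infinity>)"

definition compactly_supported :: "(real \<Rightarrow> real) \<Rightarrow> bool" where
  "compactly_supported f \<longleftrightarrow> (\<exists>K. compact K \<and> (\<forall>x. x \<notin> K \<longrightarrow> f x = 0))"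

text \<open>
  Vague convergence, as \<open>R\<close> tends to infinity, of the measures
  \<open>1/(2R) * (\<Sum>x,y\<in>\<Lambda>\<inter>[-R,R]. \<delta>\<^bsub>x-y\<^esub>)\<close> to \<open>\<gamma>\<close>: the quotient below is the integral of the test
  function \<open>f\<close> against such a measure. The point set is meant to be locally finite
  (as are the left endpoints of a tiling with finitely many tile types),
  so that the sums are finite.
\<close>

definition is_autocorrelation :: "real set \<Rightarrow> real measure \<Rightarrow> bool" where
  "is_autocorrelation \<Lambda> \<gamma> \<longleftrightarrow>
     radon_measure \<gamma> \<and>
     (\<forall>f. continuous_on UNIV f \<and> compactly_supported f \<longrightarrow>
        ((\<lambda>R. (\<Sum>x\<in>\<Lambda> \<inter> {-R..R}. \<Sum>y\<in>\<Lambda> \<inter> {-R..R}. f (x - y)) / (2 * R))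
           \<longlongrightarrow> (LINT u|\<gamma>. f u)) at_top)"

text \<open>In the next definition, \<open>D n\<close> is the \<open>n\<close>-th derivative of \<open>g\<close>.\<close>

definition schwartz :: "(real \<Rightarrow> complex) \<Rightarrow> bool" where
  "schwartz g \<longleftrightarrow>
     (\<exists>D. D 0 = g \<and>
        (\<forall>n x. (D n has_vector_derivative D (Suc n) x) (at x)) \<and>
        (\<forall>m n. bounded (range (\<lambda>x. x ^ m *\<^sub>R D n x))))"

definition fourier :: "(real \<Rightarrow> complex) \<Rightarrow> real \<Rightarrow> complex" where
  "fourier g k = (LINT x|lborel. exp (- 2 * complex_of_real pi * \<i> * of_real k * of_real x) * g x)"

text \<open>
  Fourier transform in the sense of tempered distributions,
  \<open>\<langle>\<mu>, g\<rangle> = \<langle>\<gamma>, fourier g\<rangle>\<close> for all Schwartz functions \<open>g\<close>. The integrability clauses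
  say that both pairings are genuine (for positive measures: that they are tempered);
  without them a divergent Bochner integral would silently be \<open>0\<close>.
\<close>

definition is_fourier_transform :: "real measure \<Rightarrow> real measure \<Rightarrow> bool" where
  "is_fourier_transform \<gamma> \<mu> \<longleftrightarrow>
     radon_measure \<mu> \<and>
     (\<forall>g. schwartz g \<longrightarrow>
        integrable \<mu> g \<and> integrable \<gamma> (fourier g) \<and>
        (LINT k|\<mu>. g k) = (LINT x|\<gamma>. fourier g x))"

definition is_diffraction_measure :: "real set \<Rightarrow> real measure \<Rightarrow> bool" where
  "is_diffraction_measure \<Lambda> \<mu> \<longleftrightarrow>
     (\<exists>\<gamma>. is_autocorrelation \<Lambda> \<gamma> \<and> is_fourier_transform \<gamma> \<mu>)"

definition Z :: "real measure \<Rightarrow> real \<Rightarrow> real" where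
  "Z \<mu> k = measure \<mu> {0<..k}"

end

theory Submission
  imports Defs "HOL-Probability.Probability"
begin

text \<open>
  In the module \<open>\<int>[lam]\<close> the star conjugates of the left endpoints stay in an interval of length
  \<open>1 + 1 / lam\<close>. Hence the distance between two tiles \<open>l\<close> steps apart takes one of two values, and
  since the conjugates stay bounded, the frequencies of these two values follow from a telescoping sum,
  without any equidistribution theorem. The autocorrelation is thus a sum over \<open>l\<close> of linear
  interpolations. Two Poisson summations, one in closed form for the interpolation and one over \<open>l\<close>,
  both based on the Fejer kernel, turn the Gaussian averages of the diffraction measure into sums over
  the Fourier module; letting the Gaussians shrink shows that the diffraction measure is pure point
  and identifies its intensities as \<open>(sin (pi * t) / (pi * t'))\<^sup>2 / c\<^sup>2\<close>, where \<open>t\<close> is proportional to the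
  wave number \<open>k\<close>, \<open>t'\<close> to its conjugate, and \<open>t - t'\<close> is an integer. Near the origin the sine may be
  replaced by its argument, and then multiplication of the module by the unit \<open>1 / lam\<close>, which scales
  \<open>k\<close> by \<open>1 / lam\<close> and the conjugate by \<open>- lam\<close>, multiplies each intensity by exactly \<open>1 / lam ^ 4\<close>.
\<close>

text \<open>The autocorrelation is given only through compactly supported test functions, the
  diffraction measure only through Schwartz functions. The two meet because summability over
  \<open>l\<close> need not be estimated: it is inherited, by cutting off and monotone convergence,
  from the integrability clause in \<open>is_fourier_transform\<close>, applied to the transform of
  a Gaussian. The cosine series over \<open>l\<close> that arises for a fixed wave number does not
  converge, which is why Cesaro means appear. They turn the series into a sum of nonnegative Fejer
  kernels, so that sums and integrals are exchanged by Tonelli, and after integration against a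
  Gaussian the absolute convergence over \<open>l\<close> identifies their limit with the full sum.
  The final asymptotics need no estimate of a sum over the module either. Local finiteness of the
  diffraction measure makes the comparison sum finite at one wave number, and exact scaling carries
  this value to all smaller ones.\<close>

locale noble_means =
  fixes p :: nat
  assumes p_ge_1: "p \<ge> 1"
begin

abbreviation lam :: real where "lam \<equiv> noble_mean p"

text \<open>The frequency of the type \<open>a\<close>, the difference of the two tile lengths, and the mean tile length.\<close>

definition al :: real where "al = lam / (lam + 1)"
definition de :: real where "de = lam - 1"
definition c :: real where "c = 1 + al * de"

section \<open>Arithmetic of the noble mean\<close>

lemma lam_sq: "lam\<^sup>2 = p * lam + 1"
proof -
  have "(sqrt ((real p)\<^sup>2 + 4))\<^sup>2 = (real p)\<^sup>2 + 4"
    by simp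
  then show ?thesis
    unfolding noble_mean_def by (simp add: power2_eq_square field_simps)
qed

lemma lam_gt_1: "lam > 1"
proof -
  have "sqrt ((real p)\<^sup>2 + 4) > 1"
    by (rule real_less_rsqrt) (simp add: add_pos_nonneg add_strict_increasing2)
  moreover have "real p \<ge> 1"
    using p_ge_1 by simp
  ultimately show ?thesis
    unfolding noble_mean_def by argo
qed

lemma lam_pos: "lam > 0"
  using lam_gt_1 by simp

lemma inverse_lam: "1 / lam = lam - p"
  using lam_sq lam_pos by (simp add: field_simps power2_eq_square)

text \<open>In lowest terms a rational root of \<open>x^2 - p * x - 1\<close> has denominator 1, and
  an integer root \<open>m\<close> would satisfy \<open>m * (m - p) = 1\<close>, which forces
  \<open>p = 0\<close>.\<close>

lemma lam_irrational: "lam \<notin> \<rat>"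
proof
  assume "lam \<in> \<rat>"
  then obtain m n :: nat where n: "n \<noteq> 0" and eq: "\<bar>lam\<bar> = real m / real n" and cop: "coprime m n"
    using Rats_abs_nat_div_natE by metis
  have "(real m / real n)\<^sup>2 = p * (real m / real n) + 1"
    using lam_sq eq lam_pos by simp
  then have "real (m\<^sup>2) = real (p * m * n + n\<^sup>2)"
    using n by (simp add: field_simps power2_eq_square)
  then have *: "m\<^sup>2 = p * m * n + n\<^sup>2"
    by (simp only: of_nat_eq_iff)
  then have "n dvd m\<^sup>2"
    by (simp add: power2_eq_square)
  then have "n = 1"
    using cop by (metis coprime_common_divisor_nat coprime_power_left_iff dvd_refl)
  then have "m * (m - p) = 1"
    using * by (simp add: power2_eq_square algebra_simps)
  then show False
    using * \<open>n = 1\<close> p_ge_1 by simp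
qed

lemma lam_linear_independent:
  fixes m n :: int
  assumes "m * lam + n = 0"
  shows "m = 0" "n = 0"
proof -
  show "m = 0"
  proof (rule ccontr)
    assume "m \<noteq> 0"
    then have "lam = - of_int n / of_int m"
      using assms by (simp add: field_simps)
    then show False
      using lam_irrational by simp
  qed
  then show "n = 0"
    using assms by simp
qed

lemma al_pos: "al > 0" and de_pos: "de > 0" and c_pos: "c > 0"
proof -
  show "al > 0" "de > 0"
    using lam_gt_1 by (auto simp: al_def de_def)
  then show "c > 0"
    by (simp add: c_def add_pos_pos)
qed

lemma c_eq: "c = (lam\<^sup>2 + 1) / (lam + 1)"
  using lam_pos by (simp add: c_def al_def de_def field_simps power2_eq_square)

text \<open>Excludes ties later on: for nonzero \<open>l\<close> only the two integers next to
  \<open>l * al\<close> lie within distance 1 of it, and different indices never give the same Bragg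
  position.\<close>

lemma al_int_multiple:
  fixes l n :: int
  assumes "l * al = n"
  shows "l = 0"
proof -
  have "of_int (l - n) * lam + of_int (- n) = 0"
    using assms lam_pos by (simp add: al_def field_simps)
  from lam_linear_independent[OF this] show ?thesis
    by simp
qed

section \<open>Balance of legal words\<close>

text \<open>Minus the algebraic conjugate of \<open>lam\<close>, since the two roots of
  \<open>x^2 - p * x - 1\<close> have product -1.\<close>

definition mu :: real where "mu = 1 / lam"

lemma mu_pos: "mu > 0" and mu_lt_1: "mu < 1" and lam_mu: "lam * mu = 1" and p_mu: "p * mu = 1 - mu * mu"
  and al_mu: "al * (1 + mu) = 1"
proof -
  show "mu > 0" "mu < 1" "lam * mu = 1"
    using lam_gt_1 by (auto simp: mu_def)
  then show "p * mu = 1 - mu * mu"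
    using inverse_lam unfolding mu_def[symmetric] by algebra
  have "1 + mu = (lam + 1) / lam"
    using lam_pos by (simp add: mu_def add_divide_distrib)
  then show "al * (1 + mu) = 1"
    using lam_pos by (simp add: al_def)
qed

text \<open>The algebraic conjugate of the tile length.\<close>

fun star :: "letter \<Rightarrow> real" where
  "star Type_a = - mu"
| "star Type_b = 1"

text \<open>The windows of the model set description: they hold the conjugates of the left endpoints
  of the tiles of each type. They share one end point and together fill an interval of length
  \<open>1 + mu\<close>.\<close>

fun window :: "letter \<Rightarrow> real set" where
  "window Type_a = {-1 + mu .. mu}"
| "window Type_b = {-1 .. -1 + mu}"

text \<open>Here \<open>s\<close> is the conjugate of the left end of the word. The clause for the
  empty word retains the constraint on the right end.\<close>

fun admissible :: "real \<Rightarrow> letter list \<Rightarrow> bool" where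
  "admissible s [] \<longleftrightarrow> s \<in> {-1 .. mu}"
| "admissible s (x # w) \<longleftrightarrow> s \<in> window x \<and> admissible (s + star x) w"

lemma admissible_range: "admissible s w \<Longrightarrow> s \<in> {-1 .. mu}"
proof (cases w)
  case (Cons x v)
  then show "admissible s w \<Longrightarrow> s \<in> {-1 .. mu}"
    using mu_pos mu_lt_1 by (cases x) auto
qed simp

lemma admissible_append:
  "admissible s (v @ w) \<Longrightarrow> admissible (s + sum_list (map star v)) w"
proof (induction v arbitrary: s)
  case (Cons x v)
  then show ?case
    using Cons.IH[of "s + star x"] by (simp add: add.assoc)
qed simp

text \<open>Each letter a lowers the conjugate by \<open>mu\<close>, so a run is controlled by an
  upper bound at its start and a lower bound at its end.\<close>

lemma admissible_replicate_a:
  assumes "s - real n * mu \<ge> -1" "s \<le> mu" "admissible (s - real n * mu) w"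
  shows "admissible s (replicate n Type_a @ w)"
  using assms
proof (induction n arbitrary: s)
  case (Suc n)
  have "s - mu - real n * mu = s - real (Suc n) * mu"
    by (simp add: algebra_simps)
  moreover have "mu \<le> 1 + s"
  proof -
    have "real n * mu \<ge> 0"
      using mu_pos by simp
    then show ?thesis
      using Suc.prems(1) by (simp add: distrib_right)
  qed
  ultimately show ?case
    using Suc.prems Suc.IH[of "s - mu"] mu_pos by (simp add: algebra_simps)
qed simp

text \<open>The star map turns inflation by \<open>lam\<close> into contraction by \<open>- mu\<close>, and the windows
  solve the resulting iterated function system.\<close>

lemma admissible_noble_subst:
  "admissible s w \<Longrightarrow> admissible (- mu * s) (noble_subst p w)"
proof (induction w arbitrary: s)
  case Nil
  then have s: "-1 \<le> s" "s \<le> mu"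
    by auto
  have "mu * s \<le> mu * mu" "mu * mu \<le> mu * 1" "mu * (-1) \<le> mu * s"
    using s mu_pos mu_lt_1 by (intro mult_left_mono; simp)+
  then show ?case
    using mu_lt_1 by (simp add: noble_subst_def)
next
  case (Cons x w)
  show ?case
  proof (cases x)
    case Type_a
    have s: "-1 + mu \<le> s" "s \<le> mu"
      using Cons.prems Type_a by auto
    have sm: "mu * s \<le> mu * mu" "mu * (- 1 + mu) \<le> mu * s"
      using s mu_pos by (intro mult_left_mono; simp)+
    have IH: "admissible (- mu * (s - mu)) (noble_subst p w)"
      using Cons Type_a by auto
    \<comment> \<open>After the run of \<open>p\<close> letters a, the identity
      \<open>p * mu = 1 - mu * mu\<close> puts the conjugate into the window of b, and the step 1 of
      that b leads to \<open>- mu * (s - mu)\<close>, the contracted image of the next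
      conjugate.\<close>
    have *: "admissible (- mu * s - real p * mu) (Type_b # noble_subst p w)"
    proof -
      have "- mu * s - real p * mu + 1 = - mu * (s - mu)"
        by (simp add: p_mu algebra_simps)
      moreover have "- mu * s - real p * mu \<in> window Type_b"
        using sm by (simp add: p_mu algebra_simps)
      ultimately show ?thesis
        using IH by simp
    qed
    then have **: "- mu * s - real p * mu \<ge> -1"
      by simp
    have "- mu * s \<le> mu"
      using sm mu_pos by (simp add: algebra_simps)
        (smt (verit) mult_pos_pos)
    from admissible_replicate_a[OF ** this *] show ?thesis
      by (simp add: Type_a noble_subst_def)
  next
    case Type_b
    have s: "-1 \<le> s" "s \<le> -1 + mu"
      using Cons.prems Type_b by auto
    have sm: "mu * (-1) \<le> mu * s" "mu * s \<le> mu * (- 1 + mu)"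
      using s mu_pos by (intro mult_left_mono; simp)+
    have "- mu * (s + 1) = - mu * s + star Type_a"
      by (simp add: algebra_simps)
    moreover have "admissible (- mu * (s + 1)) (noble_subst p w)"
      using Cons Type_b by auto
    moreover have "- mu * s \<in> window Type_a"
    proof -
      have "1 * mu \<le> p * mu"
        using p_ge_1 mu_pos by (intro mult_right_mono) auto
      then show ?thesis
        using sm mu_pos by (simp add: p_mu algebra_simps)
    qed
    ultimately show ?thesis
      by (simp add: Type_b noble_subst_def)
  qed
qed

lemma admissible_noble_subst_pow: "admissible 0 ((noble_subst p ^^ n) [Type_a])"
proof (induction n)
  case 0
  then show ?case
    using mu_pos mu_lt_1 by simp
next
  case (Suc n)
  then show ?case
    using admissible_noble_subst[of 0] by simp
qed

text \<open>Turns a displacement of conjugates into a discrepancy of letter counts: because of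
  \<open>al * (1 + mu) = 1\<close>, the steps \<open>- mu\<close> and \<open>1\<close> equal
  \<open>(al - 1) * (1 + mu)\<close> and \<open>al * (1 + mu)\<close>.\<close>

lemma sum_list_star:
  "sum_list (map star w) = (length w * al - count_list w Type_a) * (1 + mu)"
proof (induction w)
  case (Cons x w)
  have "star x = (al - (if x = Type_a then 1 else 0)) * (1 + mu)"
    using al_mu by (cases x) (simp_all add: algebra_simps)
  with Cons show ?case
    by (cases x) (simp_all add: algebra_simps)
qed simp

text \<open>The conjugates of both ends of the word lie in an interval of length
  \<open>1 + mu\<close>. Dividing by \<open>1 + mu\<close> leaves the bound 1, just sharp enough to
  restrict the count to two values.\<close>

lemma legal_word_balanced:
  assumes "legal_word p w"
  shows "\<bar>length w * al - count_list w Type_a\<bar> \<le> 1"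
proof -
  obtain n u v where "(noble_subst p ^^ n) [Type_a] = u @ w @ v"
    using assms by (auto simp: legal_word_def sublist_def)
  then have "admissible 0 (u @ w @ v)"
    using admissible_noble_subst_pow[of n] by simp
  define s where "s = sum_list (map star u)"
  have 1: "admissible s (w @ v)"
    using admissible_append[OF \<open>admissible 0 (u @ w @ v)\<close>] by (simp add: s_def)
  from admissible_range[OF 1] admissible_range[OF admissible_append[OF 1]]
  have "\<bar>sum_list (map star w)\<bar> \<le> 1 + mu"
    by auto
  then have "\<bar>length w * al - count_list w Type_a\<bar> * (1 + mu) \<le> 1 * (1 + mu)"
    using mu_pos by (simp add: sum_list_star abs_mult)
  then show ?thesis
    by (rule mult_right_le_imp_le) (use mu_pos in simp)
qed

end

section \<open>Enumeration of the tiles\<close>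

context noble_means
begin

lemma tile_length_eq: "tile_length p x = 1 + de * (if x = Type_a then 1 else 0)"
  by (cases x) (auto simp: de_def)

lemma tile_length_ge_1: "tile_length p x \<ge> 1" and tile_length_le_lam: "tile_length p x \<le> lam"
  using lam_gt_1 by (cases x; simp)+

end

lemma add_int_le_of_steps:
  fixes x :: "int \<Rightarrow> real"
  assumes step: "\<And>j. x j + 1 \<le> x (j + 1)" and "i \<le> j"
  shows "x i + of_int (j - i) \<le> x j"
  using assms(2)
proof (induction j rule: int_ge_induct)
  case (step j)
  then show ?case
    using assms(1)[of j] by simp
qed simp

lemma ex_index:
  fixes x :: "int \<Rightarrow> real"
  assumes step: "\<And>j. x j + 1 \<le> x (j + 1)"
  shows "\<exists>j. x j \<le> y \<and> y < x (j + 1)"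
proof -
  define n where "n = nat \<lceil>x 0 - y\<rceil>"
  define N where "N = nat \<lceil>y - x 0\<rceil> + 1"
  have lower: "x (- int n) \<le> y"
    using add_int_le_of_steps[of x "- int n" 0, OF step] real_nat_ceiling_ge[of "x 0 - y"]
    unfolding n_def[symmetric] by simp
  have "y - x 0 < real N"
    using real_nat_ceiling_ge[of "y - x 0"] by (simp add: N_def)
  then have upper: "y < x (int N)"
    using add_int_le_of_steps[of x 0 "int N", OF step] by simp
  define J where "J = {j \<in> {- int n..int N}. x j \<le> y}"
  have "J \<subseteq> {- int n..int N}"
    by (auto simp: J_def)
  then have J: "finite J" "- int n \<in> J"
    using lower by (auto simp: J_def intro: finite_subset)
  define j where "j = Max J"
  have "j \<in> J"
    using J unfolding j_def by (intro Max_in) auto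
  then have "x j \<le> y" "j \<noteq> int N"
    using upper by (auto simp: J_def)
  moreover have "y < x (j + 1)"
  proof (rule ccontr)
    assume "\<not> y < x (j + 1)"
    then have "j + 1 \<in> J"
      using \<open>j \<in> J\<close> \<open>j \<noteq> int N\<close> by (auto simp: J_def)
    then have "j + 1 \<le> j"
      unfolding j_def using J by (intro Max_ge) auto
    then show False
      by simp
  qed
  ultimately show ?thesis
    by blast
qed

lemma interior_tile_support: "interior (tile_support p (x, s)) = {s <..< s + tile_length p x}"
  by (simp add: interior_atLeastAtMost_real)

locale noble_means_tiling_locale = noble_means +
  fixes T :: "tile set"
  assumes tiling: "noble_means_tiling p T"
begin

lemma covering: "\<exists>t\<in>T. snd t \<le> y \<and> y \<le> snd t + tile_length p (fst t)"
proof -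
  have "y \<in> (\<Union>t\<in>T. tile_support p t)"
    using tiling by (simp add: noble_means_tiling_def is_tiling_def)
  then show ?thesis
    by (force simp: tile_support.simps)
qed

lemma tiles_disjoint:
  assumes "s \<in> T" "t \<in> T" "s \<noteq> t"
  shows "snd s + tile_length p (fst s) \<le> snd t \<or> snd t + tile_length p (fst t) \<le> snd s"
proof (rule ccontr)
  assume contra: "\<not> ?thesis"
  define y where "y = (max (snd s) (snd t) + min (snd s + tile_length p (fst s)) (snd t + tile_length p (fst t))) / 2"
  have "y \<in> interior (tile_support p s) \<inter> interior (tile_support p t)"
    using contra tile_length_ge_1[of "fst s"] tile_length_ge_1[of "fst t"]
    by (cases s; cases t) (auto simp: interior_tile_support y_def max_def min_def)
  then show False
    using tiling assms by (auto simp: noble_means_tiling_def is_tiling_def)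
qed

text \<open>The covering only yields, for every \<epsilon>, a tile that begins between
  \<open>e\<close> and \<open>e + \<epsilon>\<close>. Two such beginnings less than 1 apart must
  coincide, because tiles have length at least 1; hence some tile begins exactly at
  \<open>e\<close>.\<close>

lemma ex_next_tile:
  assumes "t \<in> T"
  shows "\<exists>s\<in>T. next_tile p t s"
proof -
  define e where "e = snd t + tile_length p (fst t)"
  have *: "\<exists>s\<in>T. e \<le> snd s \<and> snd s \<le> e + \<epsilon>" if "\<epsilon> > 0" for \<epsilon>
  proof -
    obtain s where s: "s \<in> T" "snd s \<le> e + \<epsilon>" "e + \<epsilon> \<le> snd s + tile_length p (fst s)"
      using covering by blast
    then have "s \<noteq> t"
      using that by (auto simp: e_def)
    then show ?thesis
      using tiles_disjoint[OF s(1) assms] s tile_length_ge_1[of "fst t"] that by (auto simp: e_def)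
  qed
  obtain s where s: "s \<in> T" "e \<le> snd s" "snd s \<le> e + 1 / 2"
    using *[of "1 / 2"] by auto
  have "snd s = e"
  proof (rule ccontr)
    assume "snd s \<noteq> e"
    then obtain r where r: "r \<in> T" "e \<le> snd r" "snd r \<le> e + (snd s - e) / 2"
      using s *[of "(snd s - e) / 2"] by auto
    then have "snd r < snd s"
      using s \<open>snd s \<noteq> e\<close> by (simp add: field_simps)
    then show False
      using tiles_disjoint[OF s(1) r(1)] s r tile_length_ge_1[of "fst s"] tile_length_ge_1[of "fst r"] by auto
  qed
  then show ?thesis
    using s by (auto simp: next_tile_def e_def)
qed

lemma ex_previous_tile:
  assumes "t \<in> T"
  shows "\<exists>s\<in>T. next_tile p s t"
proof -
  define r where "r s = snd s + tile_length p (fst s)" for s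
  have *: "\<exists>s\<in>T. r s \<le> snd t \<and> snd t - \<epsilon> \<le> r s" if "\<epsilon> > 0" for \<epsilon>
  proof -
    obtain s where s: "s \<in> T" "snd s \<le> snd t - \<epsilon>" "snd t - \<epsilon> \<le> r s"
      using covering unfolding r_def by blast
    then have "s \<noteq> t"
      using that by auto
    then show ?thesis
      using tiles_disjoint[OF s(1) assms] s tile_length_ge_1[of "fst t"] that by (auto simp: r_def)
  qed
  obtain s where s: "s \<in> T" "r s \<le> snd t" "snd t - 1 / 2 \<le> r s"
    using *[of "1 / 2"] by auto
  have "r s = snd t"
  proof (rule ccontr)
    assume "r s \<noteq> snd t"
    then obtain u where u: "u \<in> T" "r u \<le> snd t" "snd t - (snd t - r s) / 2 \<le> r u"
      using s *[of "(snd t - r s) / 2"] by auto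
    then have "r s < r u"
      using s \<open>r s \<noteq> snd t\<close> by (simp add: field_simps)
    then show False
      using tiles_disjoint[OF s(1) u(1)] s u tile_length_ge_1[of "fst s"] tile_length_ge_1[of "fst u"]
      by (auto simp: r_def)
  qed
  then show ?thesis
    using s by (intro bexI[of _ s]) (simp_all add: next_tile_def r_def)
qed

lemma ex_enumeration: "\<exists>t :: int \<Rightarrow> tile. \<forall>j. t j \<in> T \<and> next_tile p (t j) (t (j + 1))"
proof -
  obtain t0 where t0: "t0 \<in> T"
    using covering by blast
  obtain f where f: "\<And>t. t \<in> T \<Longrightarrow> f t \<in> T \<and> next_tile p t (f t)"
    using ex_next_tile by metis
  obtain g where g: "\<And>t. t \<in> T \<Longrightarrow> g t \<in> T \<and> next_tile p (g t) t"
    using ex_previous_tile by metis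
  define t where "t j = (if j \<ge> 0 then (f ^^ nat j) t0 else (g ^^ nat (- j)) t0)" for j :: int
  have f_in: "(f ^^ n) t0 \<in> T" and g_in: "(g ^^ n) t0 \<in> T" for n
    using t0 f g by (induction n) auto
  show ?thesis
  proof (intro exI[of _ t] allI conjI)
    show "t j \<in> T" for j
      using f_in g_in by (simp add: t_def)
    show "next_tile p (t j) (t (j + 1))" for j
    proof (cases "j \<ge> 0")
      case True
      then have "nat (j + 1) = Suc (nat j)"
        by simp
      then show ?thesis
        using True f[OF f_in[of "nat j"]] by (simp add: t_def)
    next
      case False
      then have "nat (- j) = Suc (nat (- (j + 1)))"
        by simp
      then show ?thesis
        using False g[OF g_in[of "nat (- (j + 1))"]] by (auto simp: t_def)
    qed
  qed
qed

text \<open>Collects all that the autocorrelation needs to know about the tiling; the two-valued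
  distances come from the balance of legal words.\<close>

lemma ex_points:
  obtains x :: "int \<Rightarrow> real" where
    "range x = left_endpoints T"
    "\<And>j. x j + 1 \<le> x (j + 1)"
    "\<And>j. x (j + 1) \<le> x j + lam"
    "\<And>i j. \<exists>n::int. x j - x i = of_int (j - i) + n * de \<and> \<bar>of_int (j - i) * al - n\<bar> \<le> 1"
proof -
  obtain t :: "int \<Rightarrow> tile" where t: "\<forall>j. t j \<in> T \<and> next_tile p (t j) (t (j + 1))"
    using ex_enumeration by blast
  then have t_in: "t j \<in> T" and t_next: "next_tile p (t j) (t (j + 1))" for j
    by auto
  define x where "x j = snd (t j)" for j
  have step: "x (j + 1) = x j + tile_length p (fst (t j))" for j
    using t_next[of j] by (simp add: next_tile_def x_def)
  have step1: "x j + 1 \<le> x (j + 1)" for j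
    using step[of j] tile_length_ge_1 by simp
  have step2: "x (j + 1) \<le> x j + lam" for j
    using step[of j] tile_length_le_lam by simp
  define w where "w i n = map (\<lambda>k. t (i + int k)) [0..<n]" for i n
  have w_legal: "legal_word p (map fst (w i n))" for i n
  proof -
    have "successively (next_tile p) (w i n)"
      unfolding w_def successively_conv_nth
    proof (intro allI impI)
      fix k assume "Suc k < length (map (\<lambda>k. t (i + int k)) [0..<n])"
      moreover have "i + int (Suc k) = i + int k + 1"
        by simp
      ultimately show "next_tile p (map (\<lambda>k. t (i + int k)) [0..<n] ! k) (map (\<lambda>k. t (i + int k)) [0..<n] ! Suc k)"
        using t_next[of "i + int k"] by (simp add: ac_simps)
    qed
    moreover have "set (w i n) \<subseteq> T"
      using t_in by (auto simp: w_def)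
    ultimately show ?thesis
      using tiling by (auto simp: noble_means_tiling_def)
  qed
  have w_sum: "x (i + int n) - x i = n + count_list (map fst (w i n)) Type_a * de" for i n
  proof (induction n)
    case (Suc n)
    have "x (i + int (Suc n)) = x (i + int n) + tile_length p (fst (t (i + int n)))"
      using step[of "i + int n"] by (simp add: algebra_simps)
    then show ?case
      using Suc by (simp add: w_def tile_length_eq algebra_simps)
  qed (simp add: w_def)
  have diff: "\<exists>n::int. x j - x i = of_int (j - i) + n * de \<and> \<bar>of_int (j - i) * al - n\<bar> \<le> 1" if "i \<le> j" for i j
  proof -
    define l where "l = nat (j - i)"
    have j: "j = i + int l"
      using that by (simp add: l_def)
    show ?thesis
      using w_sum[of i l] legal_word_balanced[OF w_legal[of i l]]
      by (intro exI[of _ "int (count_list (map fst (w i l)) Type_a)"]) (simp add: j w_def)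
  qed
  show thesis
  proof
    show "range x = left_endpoints T"
    proof
      show "range x \<subseteq> left_endpoints T"
        using t_in by (auto simp: x_def left_endpoints_def)
      show "left_endpoints T \<subseteq> range x"
      proof
        fix y assume "y \<in> left_endpoints T"
        then obtain s where s: "s \<in> T" "y = snd s"
          by (auto simp: left_endpoints_def)
        \<comment> \<open>A tile that begins in this gap overlaps \<open>t j\<close> and so equals
          it. Hence the enumeration, although grown from one arbitrary tile, reaches every
          tile.\<close>
        obtain j where j: "x j \<le> y" "y < x (j + 1)"
          using ex_index[of x y] step1 by blast
        then have "s = t j"
          using tiles_disjoint[OF s(1) t_in[of j]] s(2) step[of j] tile_length_ge_1[of "fst s"]
          by (force simp: x_def)
        then show "y \<in> range x"
          using s by (simp add: x_def)
      qed
    qed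
    show "\<exists>n::int. x j - x i = of_int (j - i) + n * de \<and> \<bar>of_int (j - i) * al - n\<bar> \<le> 1" for i j
    proof (cases "i \<le> j")
      case False
      then obtain n :: int where "x i - x j = of_int (i - j) + n * de" "\<bar>of_int (i - j) * al - n\<bar> \<le> 1"
        using diff[of j i] by auto
      then show ?thesis
        by (intro exI[of _ "- n"]) (auto simp: algebra_simps abs_if split: if_splits)
    qed (rule diff)
  qed (use step1 step2 in auto)
qed

end

section \<open>Integrals over counting measures\<close>

text \<open>Sums over the integers are written as integrals over a counting measure, so that
  dominated convergence and Tonelli apply to them; this function serves as a majorant.\<close>

lemma integrable_count_space_inverse_square:
  "integrable (count_space UNIV) (\<lambda>q::int. 1 / (1 + (of_int q)\<^sup>2) :: real)"
proof -
  let ?f = "\<lambda>q::int. 1 / (1 + (of_int q)\<^sup>2) :: real"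
  have nat: "Infinite_Set_Sum.abs_summable_on (\<lambda>n::nat. 1 / (1 + (real n)\<^sup>2)) UNIV"
    unfolding abs_summable_on_nat_iff'
  proof (rule summable_comparison_test_ev)
    show "summable (\<lambda>n. inverse (real n ^ 2))"
      by (rule inverse_power_summable) simp
    show "\<forall>\<^sub>F n in sequentially. norm (norm (1 / (1 + (real n)\<^sup>2))) \<le> inverse ((real n)\<^sup>2)"
      using eventually_gt_at_top[of 0]
      by eventually_elim (auto simp: inverse_eq_divide intro!: divide_left_mono mult_pos_pos add_pos_nonneg)
  qed
  have "Infinite_Set_Sum.abs_summable_on ?f (range int)"
    "Infinite_Set_Sum.abs_summable_on ?f (range (\<lambda>n. - int n))"
    using nat by (intro abs_summable_on_reindex; simp)+
  then have "Infinite_Set_Sum.abs_summable_on ?f (range int \<union> range (\<lambda>n. - int n))"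
    by (rule abs_summable_on_union)
  also have "range int \<union> range (\<lambda>n. - int n) = UNIV"
    by (auto simp: image_iff) (metis int_cases2)
  finally show ?thesis
    by (simp add: abs_summable_on_def)
qed

lemma integrable_count_space_bound:
  fixes f :: "'b \<Rightarrow> 'a :: {banach, second_countable_topology}" and g :: "'b \<Rightarrow> real"
  assumes "integrable (count_space A) g" "\<And>x. x \<in> A \<Longrightarrow> norm (f x) \<le> g x"
  shows "integrable (count_space A) f"
  using assms(1) by (rule Bochner_Integration.integrable_bound) (auto simp: AE_count_space intro: order_trans[OF assms(2) abs_ge_self])

lemma integral_count_space_support:
  fixes f :: "'b \<Rightarrow> 'a :: {banach, second_countable_topology}"
  assumes "finite B" "\<And>x. x \<notin> B \<Longrightarrow> f x = 0"
  shows "(LINT x|count_space UNIV. f x) = sum f B"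
proof -
  have "{x \<in> UNIV. f x \<noteq> 0} \<subseteq> B"
    using assms(2) by auto
  then show ?thesis
    using assms(1)
    by (subst lebesgue_integral_count_space_finite_support)
       (auto intro: finite_subset intro!: sum.mono_neutral_cong_left)
qed

section \<open>The Fejer kernel\<close>

text \<open>Double-sum form: its integral against a phase is a Cesaro mean of Fourier coefficients.\<close>

definition fejer :: "nat \<Rightarrow> real \<Rightarrow> real" where
  "fejer N t = (\<Sum>i<N. \<Sum>j<N. cos (2 * pi * (real i - real j) * t)) / N"

lemma fejer_conv_norm: "fejer N t = (norm (\<Sum>j<N. cis (2 * pi * real j * t)))\<^sup>2 / N"
proof -
  let ?a = "\<lambda>j. 2 * pi * real j * t"
  have "(norm (\<Sum>j<N. cis (?a j)))\<^sup>2 = (\<Sum>j<N. cos (?a j))\<^sup>2 + (\<Sum>j<N. sin (?a j))\<^sup>2"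
    by (simp add: cmod_power2)
  also have "\<dots> = (\<Sum>i<N. \<Sum>j<N. cos (?a i - ?a j))"
    by (simp add: power2_eq_square sum_product sum.distrib[symmetric] cos_diff)
  finally show ?thesis
    by (simp add: fejer_def algebra_simps)
qed

lemma fejer_nonneg: "fejer N t \<ge> 0"
  by (simp add: fejer_conv_norm)

lemma fejer_minus: "fejer N (- t) = fejer N t"
  by (simp add: fejer_def)

lemma cis_2pi_int_add: "cis (2 * pi * (real j * of_int n) + x) = cis x"
proof -
  have "cis (2 * pi * (real j * of_int n) + x) = cis (2 * pi * of_int (int j * n)) * cis x"
    by (simp only: cis_mult of_int_mult of_int_of_nat_eq)
  then show ?thesis
    by (simp only: cis_multiple_2pi Ints_of_int) simp
qed

lemma fejer_add_int: "fejer N (t + of_int n) = fejer N t"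
proof -
  have "cis (2 * pi * real j * (t + of_int n)) = cis (2 * pi * real j * t)" for j
    using cis_2pi_int_add[of j n "2 * pi * real j * t"] by (simp add: algebra_simps)
  then show ?thesis
    by (simp add: fejer_conv_norm)
qed

lemma fejer_le: "fejer N t \<le> N"
proof -
  have "norm (\<Sum>j<N. cis (2 * pi * real j * t)) \<le> (\<Sum>j<N. 1)"
    by (intro sum_norm_le) simp
  then have "(norm (\<Sum>j<N. cis (2 * pi * real j * t)))\<^sup>2 \<le> (real N)\<^sup>2"
    by (intro power_mono) auto
  then show ?thesis
    by (cases "N = 0") (simp_all add: fejer_conv_norm divide_le_eq power2_eq_square)
qed

lemma continuous_on_fejer: "continuous_on A (fejer N)"
  unfolding fejer_def divide_inverse by (intro continuous_intros)

lemma borel_measurable_fejer [measurable]: "fejer N \<in> borel_measurable borel"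
  by (intro borel_measurable_continuous_onI continuous_on_fejer)

lemma fejer_conv_cis:
  "complex_of_real (fejer N t) = (\<Sum>i<N. \<Sum>j<N. cis (- 2 * pi * (real i - real j) * t)) / of_nat N"
proof -
  let ?z = "\<Sum>j<N. cis (2 * pi * real j * t)"
  have "complex_of_real ((norm ?z)\<^sup>2) = cnj ?z * ?z"
    using complex_norm_square[of ?z] by (simp only: mult.commute)
  also have "\<dots> = (\<Sum>i<N. \<Sum>j<N. cnj (cis (2 * pi * real i * t)) * cis (2 * pi * real j * t))"
    by (simp only: cnj_sum sum_product)
  also have "\<dots> = (\<Sum>i<N. \<Sum>j<N. cis (- 2 * pi * (real i - real j) * t))"
    by (simp add: cis_cnj cis_mult algebra_simps)
  finally show ?thesis
    by (simp add: fejer_conv_norm)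
qed

text \<open>The factor \<open>2 - 2 * cos (2 * pi * t)\<close> is the squared norm of
  \<open>cis (2 * pi * t) - 1\<close>, which collapses the geometric sum to a difference of two unit
  vectors. This controls the mass away from the integers.\<close>

lemma fejer_concentration: "fejer N t * (2 - 2 * cos (2 * pi * t)) \<le> 4 / N"
proof (cases "N = 0")
  case False
  let ?\<theta> = "2 * pi * t"
  let ?z = "\<Sum>j<N. cis (2 * pi * real j * t)"
  have pow: "cis (2 * pi * real j * t) = cis ?\<theta> ^ j" for j
  proof -
    have "2 * pi * real j * t = real j * ?\<theta>"
      by simp
    then show ?thesis
      by (simp only: Complex.DeMoivre)
  qed
  have "(cis ?\<theta> - 1) * ?z = cis ?\<theta> ^ N - 1"
    unfolding pow by (rule power_diff_1_eq[symmetric])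
  then have "norm (cis ?\<theta> - 1) * norm ?z = norm (cis ?\<theta> ^ N - 1)"
    by (metis norm_mult)
  also have "\<dots> \<le> 2"
    using norm_triangle_ineq4[of "cis ?\<theta> ^ N" 1] by (simp add: norm_power)
  finally have "(norm (cis ?\<theta> - 1) * norm ?z)\<^sup>2 \<le> 2\<^sup>2"
    by (intro power_mono) auto
  moreover have "(norm (cis ?\<theta> - 1))\<^sup>2 = 2 - 2 * cos ?\<theta>"
    using sin_cos_squared_add[of ?\<theta>] by (simp add: cmod_power2 power2_diff)
  ultimately have "(2 - 2 * cos ?\<theta>) * (norm ?z)\<^sup>2 \<le> 4"
    by (simp add: power_mult_distrib)
  then have "(2 - 2 * cos ?\<theta>) * (norm ?z)\<^sup>2 / N \<le> 4 / N"
    by (rule divide_right_mono) simp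
  then show ?thesis
    by (simp add: fejer_conv_norm mult.commute)
qed (simp add: fejer_def)

section \<open>Integration over the unit interval and convergence of Fejer means\<close>

abbreviation unit_interval :: "real measure" where
  "unit_interval \<equiv> restrict_space lborel {0..1}"

lemma finite_measure_unit_interval: "finite_measure unit_interval"
  by (rule finite_measureI) (simp add: emeasure_restrict_space space_restrict_space)

lemma integrable_unit_interval:
  fixes f :: "real \<Rightarrow> 'a :: {banach, second_countable_topology}"
  assumes "f \<in> borel_measurable borel" "\<And>y. 0 \<le> y \<Longrightarrow> y \<le> 1 \<Longrightarrow> norm (f y) \<le> B"
  shows "integrable unit_interval f"
  using assms
  by (intro finite_measure.integrable_const_bound[OF finite_measure_unit_interval, of _ B])
     (auto simp: AE_restrict_space_iff intro: measurable_restrict_space1)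

lemma integral_unit_interval_FTC:
  fixes F :: "real \<Rightarrow> 'a :: euclidean_space"
  assumes "\<And>x. 0 \<le> x \<Longrightarrow> x \<le> 1 \<Longrightarrow> (F has_vector_derivative f x) (at x within {0..1})"
    and "continuous_on {0..1} f"
  shows "(LINT x|unit_interval. f x) = F 1 - F 0"
  using integral_FTC_Icc[of 0 1 F f] assms by (simp add: integral_restrict_space)

lemma integral_unit_interval_cos:
  "(LINT y|unit_interval. cos (2 * pi * of_int l * (y - y0))) = (if l = 0 then 1 else 0)"
proof (cases "l = 0")
  case True
  then show ?thesis
    using integral_unit_interval_FTC[of "\<lambda>x. x" "\<lambda>_. 1"]
    by (simp add: has_vector_derivative_id)
next
  case False
  let ?F = "\<lambda>y. sin (2 * pi * of_int l * (y - y0)) / (2 * pi * of_int l)"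
  have "(LINT y|unit_interval. cos (2 * pi * of_int l * (y - y0))) = ?F 1 - ?F 0"
  proof (rule integral_unit_interval_FTC)
    show "(?F has_vector_derivative cos (2 * pi * of_int l * (x - y0))) (at x within {0..1})" for x
      using False by (auto intro!: derivative_eq_intros simp: has_real_derivative_iff_has_vector_derivative[symmetric])
  qed (intro continuous_intros)
  also have "sin (2 * pi * of_int l * (1 - y0)) = sin (2 * pi * of_int l * (0 - y0) + 2 * pi * of_int l)"
    by (simp add: algebra_simps)
  also have "\<dots> = sin (2 * pi * of_int l * (0 - y0))"
    unfolding sin_add using sin_int_2pin[of l] cos_int_2pin[of l] by (simp add: mult_ac)
  finally show ?thesis
    using False by simp
qed

lemma integral_fejer: "N > 0 \<Longrightarrow> (LINT y|unit_interval. fejer N (y - y0)) = 1"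
proof -
  assume N: "N > 0"
  have int: "integrable unit_interval (\<lambda>y. cos (2 * pi * (real i - real j) * (y - y0)))" for i j
    by (rule integrable_unit_interval[where B = 1]) auto
  have "(LINT y|unit_interval. cos (2 * pi * (real i - real j) * (y - y0))) = (if i = j then 1 else 0)" for i j
    using integral_unit_interval_cos[of "int i - int j" y0] by simp
  then have "(LINT y|unit_interval. fejer N (y - y0)) = (\<Sum>i<N. \<Sum>j<N. if i = j then 1 else 0) / N"
    unfolding fejer_def by (simp add: Bochner_Integration.integral_sum int Bochner_Integration.integrable_sum)
  also have "\<dots> = 1"
    using N by (simp add: sum.delta)
  finally show ?thesis .
qed

text \<open>The oscillation of \<open>f\<close> about \<open>y0\<close> is at most
  \<open>r / 2\<close> plus a multiple of the weight \<open>w (y - y0)\<close>, and by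
  \<open>fejer_concentration\<close> the kernel integrates that weight to at most
  \<open>4 / N\<close>.\<close>

lemma fejer_approximation:
  fixes f :: "real \<Rightarrow> 'a :: {banach, second_countable_topology}"
  assumes y0: "0 < y0" "y0 < 1"
    and meas: "f \<in> borel_measurable borel"
    and bound: "\<And>y. 0 \<le> y \<Longrightarrow> y \<le> 1 \<Longrightarrow> norm (f y) \<le> B"
    and cont: "isCont f y0"
  shows "(\<lambda>N. LINT y|unit_interval. fejer N (y - y0) *\<^sub>R f y) \<longlonglongrightarrow> f y0"
proof (rule LIMSEQ_I)
  fix r :: real assume "r > 0"
  define w where "w t = 2 - 2 * cos (2 * pi * t)" for t :: real
  have w_nonneg: "w t \<ge> 0" for t
    by (simp add: w_def)
  have w_le: "w t \<le> 4" for t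
    using cos_ge_minus_one[of "2 * pi * t"] unfolding w_def by linarith
  have B: "B \<ge> 0"
    using bound[of 0] norm_ge_zero[of "f 0"] by linarith
  obtain d where d: "d > 0" "\<And>y. \<bar>y - y0\<bar> < d \<Longrightarrow> norm (f y - f y0) < r / 2"
    using cont[unfolded continuous_at_eps_delta dist_norm] \<open>r > 0\<close>
    by (metis half_gt_zero real_norm_def)
  \<comment> \<open>The weight \<open>w\<close> has period 1 and is small again near distance 1.
    This choice keeps \<open>\<bar>y - y0\<bar>\<close> between \<open>d'\<close> and
    \<open>1 - d'\<close> for all \<open>y\<close> of the unit interval outside the
    \<open>d\<close>-neighbourhood.\<close>
  define d' where "d' = min d (min y0 (1 - y0))"
  have d': "0 < d'" "d' \<le> 1 / 2" "d' \<le> d" "d' \<le> y0" "d' \<le> 1 - y0"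
    using y0 d by (auto simp: d'_def min_def)
  have cos_less: "cos (2 * pi * d') < 1"
    using cos_monotone_0_pi[of 0 "2 * pi * d'"] d' by simp
  then have w_pos: "w d' > 0"
    by (simp add: w_def)
  have w_ge: "w d' \<le> w (y - y0)" if "0 \<le> y" "y \<le> 1" "\<bar>y - y0\<bar> \<ge> d" for y
  proof -
    define t where "t = \<bar>y - y0\<bar>"
    have t: "d' \<le> t" "t \<le> 1 - d'"
      using that d' by (auto simp: t_def)
    have wt: "w (y - y0) = w t"
    proof (cases "y \<ge> y0")
      case False
      then have "y - y0 = - t"
        by (simp add: t_def)
      then show ?thesis
        by (simp add: w_def)
    qed (simp add: t_def)
    show ?thesis
    proof (cases "t \<le> 1 / 2")
      case True
      then have "cos (2 * pi * t) \<le> cos (2 * pi * d')"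
        using t d' by (intro cos_monotone_0_pi_le) auto
      then show ?thesis
        unfolding wt by (simp add: w_def)
    next
      case False
      have "cos (2 * pi * t) = cos (2 * pi * (1 - t))"
        using cos_2pi_minus[of "2 * pi * t"] by (simp add: algebra_simps)
      also have "\<dots> \<le> cos (2 * pi * d')"
        using t d' False by (intro cos_monotone_0_pi_le) auto
      finally show ?thesis
        unfolding wt by (simp add: w_def)
    qed
  qed
  \<comment> \<open>Chosen so that \<open>K * w d'\<close> is \<open>2 * B\<close>, the trivial
    bound for the oscillation.\<close>
  define K where "K = 2 * B / w d'"
  have K: "K \<ge> 0"
    using B w_pos by (simp add: K_def)
  have main: "norm (f y - f y0) \<le> r / 2 + K * w (y - y0)" if "0 \<le> y" "y \<le> 1" for y
  proof (cases "\<bar>y - y0\<bar> < d")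
    case True
    then show ?thesis
      using d(2)[OF True] mult_nonneg_nonneg[OF K w_nonneg[of "y - y0"]] by linarith
  next
    case False
    have "norm (f y - f y0) \<le> B + B"
      using bound[OF that] bound[of y0] y0 norm_triangle_ineq4[of "f y" "f y0"] by linarith
    also have "\<dots> = K * w d'"
      using w_pos by (simp add: K_def)
    also have "\<dots> \<le> K * w (y - y0)"
      using w_ge[OF that] False K by (intro mult_left_mono) auto
    finally show ?thesis
      using \<open>r > 0\<close> by simp
  qed
  have F_int: "integrable unit_interval (\<lambda>y. fejer N (y - y0))" for N
    by (rule integrable_unit_interval[where B = N]) (auto simp: fejer_nonneg fejer_le)
  have F_f_int: "integrable unit_interval (\<lambda>y. fejer N (y - y0) *\<^sub>R f y)" for N
    using meas bound
    by (intro integrable_unit_interval[where B = "N * B"])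
       (auto simp: fejer_nonneg fejer_le intro!: mult_mono)
  have w_meas [measurable]: "w \<in> borel_measurable borel"
    unfolding w_def by measurable
  have F_w_int: "integrable unit_interval (\<lambda>y. fejer N (y - y0) * w (y - y0))" for N
    by (rule integrable_unit_interval[where B = "N * 4"])
       (auto simp: fejer_nonneg fejer_le abs_mult w_nonneg w_le intro!: mult_mono)
  obtain N0 :: nat where N0: "K * 4 / N0 < r / 2" "N0 > 0"
  proof -
    obtain N0 :: nat where "K * 4 / (r / 2) < N0" "N0 > 0"
      using reals_Archimedean2[of "max (K * 4 / (r / 2)) 0"] by auto
    then show ?thesis
      using \<open>r > 0\<close> that[of N0] by (simp add: field_simps)
  qed
  show "\<exists>no. \<forall>n\<ge>no. norm ((LINT y|unit_interval. fejer n (y - y0) *\<^sub>R f y) - f y0) < r"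
  proof (intro exI[of _ N0] allI impI)
    fix n assume "n \<ge> N0"
    then have n: "n > 0"
      using N0 by simp
    have "(LINT y|unit_interval. fejer n (y - y0) *\<^sub>R f y) - f y0 =
        (LINT y|unit_interval. fejer n (y - y0) *\<^sub>R (f y - f y0))"
      using integral_fejer[OF n, of y0] F_int F_f_int
      by (simp add: scaleR_diff_right)
    also have "norm \<dots> \<le> (LINT y|unit_interval. fejer n (y - y0) * (r / 2 + K * w (y - y0)))"
    proof (rule Bochner_Integration.integral_norm_bound_integral)
      show "integrable unit_interval (\<lambda>y. fejer n (y - y0) *\<^sub>R (f y - f y0))"
        using F_int F_f_int by (simp add: scaleR_diff_right)
      show "integrable unit_interval (\<lambda>y. fejer n (y - y0) * (r / 2 + K * w (y - y0)))"
        using F_int F_w_int by (simp add: distrib_left mult.left_commute[of _ K])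
      show "norm (fejer n (y - y0) *\<^sub>R (f y - f y0)) \<le> fejer n (y - y0) * (r / 2 + K * w (y - y0))"
        if "y \<in> space unit_interval" for y
        using that main[of y] by (auto simp: fejer_nonneg space_restrict_space intro!: mult_left_mono)
    qed
    also have "\<dots> = r / 2 + K * (LINT y|unit_interval. fejer n (y - y0) * w (y - y0))"
      using integral_fejer[OF n, of y0] F_int F_w_int
      by (simp add: distrib_left mult.left_commute[of _ K])
    also have "\<dots> \<le> r / 2 + K * (LINT y|unit_interval. 4 / n)"
      using K F_w_int fejer_concentration finite_measure_unit_interval
      by (intro add_left_mono mult_left_mono integral_mono) (auto simp: w_def intro: finite_measure.integrable_const)
    also have "(LINT y|unit_interval. 4 / n) = 4 / n"
      by (simp add: measure_restrict_space space_restrict_space)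
    also have "K * (4 / n) \<le> K * (4 / N0)"
      using \<open>n \<ge> N0\<close> N0 K by (intro mult_left_mono divide_left_mono) auto
    also have "r / 2 + K * (4 / N0) < r"
      using N0 by simp
    finally show "norm ((LINT y|unit_interval. fejer n (y - y0) *\<^sub>R f y) - f y0) < r"
      by simp
  qed
qed

text \<open>The weight counts the pairs with difference \<open>l\<close>. Passing from
  \<open>N\<close> to \<open>N + 1\<close> adds a row and a column of pairs, which realise each
  difference from \<open>- N\<close> to \<open>N\<close> exactly once; the two ends of the range
  carry weight 0.\<close>

lemma sum_differences:
  fixes H :: "int \<Rightarrow> 'a :: real_vector"
  shows "(\<Sum>i<N. \<Sum>j<N. H (int i - int j)) = (\<Sum>l\<in>{- int N..int N}. (real N - \<bar>of_int l\<bar>) *\<^sub>R H l)"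
proof (induction N)
  case (Suc N)
  have set_eq: "{- int (Suc N)..int (Suc N)} = insert (- int (Suc N)) (insert (int (Suc N)) {- int N..int N})"
    by auto
  have "(\<Sum>i<Suc N. \<Sum>j<Suc N. H (int i - int j)) =
      (\<Sum>i<N. \<Sum>j<N. H (int i - int j)) + (\<Sum>i<N. H (int i - int N)) + (\<Sum>j<Suc N. H (int N - int j))"
    by (simp add: sum.distrib)
  also have "(\<Sum>i<N. H (int i - int N)) = (\<Sum>l\<in>{- int N..-1}. H l)"
    by (rule sum.reindex_bij_witness[of _ "\<lambda>l. nat (l + int N)" "\<lambda>i. int i - int N"]) auto
  also have "(\<Sum>j<Suc N. H (int N - int j)) = (\<Sum>l\<in>{0..int N}. H l)"
    by (rule sum.reindex_bij_witness[of _ "\<lambda>l. nat (int N - l)" "\<lambda>j. int N - int j"]) auto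
  also have "(\<Sum>i<N. \<Sum>j<N. H (int i - int j)) + (\<Sum>l\<in>{- int N..-1}. H l) + (\<Sum>l\<in>{0..int N}. H l) =
      (\<Sum>i<N. \<Sum>j<N. H (int i - int j)) + (\<Sum>l\<in>{- int N..int N}. H l)"
  proof -
    have "{- int N..int N} = {- int N..-1} \<union> {0..int N}"
      by auto
    then show ?thesis
      by (simp add: sum.union_disjoint add.assoc)
  qed
  also have "\<dots> = (\<Sum>l\<in>{- int N..int N}. (real (Suc N) - \<bar>of_int l\<bar>) *\<^sub>R H l)"
    unfolding Suc.IH by (simp add: sum.distrib[symmetric] algebra_simps)
  also have "\<dots> = (\<Sum>l\<in>{- int (Suc N)..int (Suc N)}. (real (Suc N) - \<bar>of_int l\<bar>) *\<^sub>R H l)"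
    unfolding set_eq by simp
  finally show ?case .
qed simp

text \<open>Dominated convergence: divided by \<open>N\<close>, the weights of
  \<open>sum_differences\<close> stay between 0 and 1 and tend to 1 for each fixed
  \<open>l\<close>.\<close>

lemma cesaro_differences:
  fixes H :: "int \<Rightarrow> 'a :: {banach, second_countable_topology}"
  assumes H: "integrable (count_space UNIV) H"
  shows "(\<lambda>N. (\<Sum>i<N. \<Sum>j<N. H (int i - int j)) /\<^sub>R real N) \<longlonglongrightarrow> (LINT l|count_space UNIV. H l)"
proof -
  define W where "W N l = max 0 (1 - \<bar>of_int l\<bar> / real N)" for N and l :: int
  have eq: "(\<Sum>i<N. \<Sum>j<N. H (int i - int j)) /\<^sub>R real N = (LINT l|count_space UNIV. W N l *\<^sub>R H l)" if "N > 0" for N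
  proof -
    have "(LINT l|count_space UNIV. W N l *\<^sub>R H l) = (\<Sum>l\<in>{- int N..int N}. W N l *\<^sub>R H l)"
    proof (rule integral_count_space_support)
      show "W N l *\<^sub>R H l = 0" if "l \<notin> {- int N..int N}" for l
      proof -
        have "\<bar>real_of_int l\<bar> / real N \<ge> 1"
          using that \<open>N > 0\<close> by (auto simp: le_divide_eq)
        then have "W N l = 0"
          by (simp add: W_def)
        then show ?thesis
          by simp
      qed
    qed simp
    also have "\<dots> = (\<Sum>l\<in>{- int N..int N}. (real N - \<bar>of_int l\<bar>) *\<^sub>R H l) /\<^sub>R real N"
      unfolding scaleR_sum_right
    proof (rule sum.cong)
      fix l assume "l \<in> {- int N..int N}"
      then have "W N l = inverse (real N) * (real N - \<bar>of_int l\<bar>)"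
        using \<open>N > 0\<close> by (auto simp: W_def max_def field_simps)
      then show "W N l *\<^sub>R H l = (real N - \<bar>of_int l\<bar>) *\<^sub>R H l /\<^sub>R real N"
        by simp
    qed simp
    finally show ?thesis
      by (simp add: sum_differences)
  qed
  have "(\<lambda>N. LINT l|count_space UNIV. W N l *\<^sub>R H l) \<longlonglongrightarrow> (LINT l|count_space UNIV. H l)"
  proof (rule integral_dominated_convergence[where w = "\<lambda>l. norm (H l)"])
    show "AE l in count_space UNIV. (\<lambda>N. W N l *\<^sub>R H l) \<longlonglongrightarrow> H l"
    proof (rule AE_I2)
      fix l :: int
      have "(\<lambda>N. max 0 (1 - \<bar>of_int l\<bar> / real N)) \<longlonglongrightarrow> max 0 (1 - 0)"
        by (intro tendsto_intros lim_const_over_n)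
      then have "(\<lambda>N. W N l *\<^sub>R H l) \<longlonglongrightarrow> 1 *\<^sub>R H l"
        unfolding W_def by (intro tendsto_intros) simp
      then show "(\<lambda>N. W N l *\<^sub>R H l) \<longlonglongrightarrow> H l"
        by simp
    qed
    show "AE l in count_space UNIV. norm (W N l *\<^sub>R H l) \<le> norm (H l)" for N
      by (intro AE_I2) (auto simp: W_def intro!: mult_left_le_one_le)
  qed (use H in auto)
  then show ?thesis
    by (rule Lim_transform_eventually)
       (rule eventually_mono[OF eventually_gt_at_top[of 0]], simp add: eq)
qed

section \<open>The Fourier series of a modulated linear function\<close>

definition sinc2 :: "real \<Rightarrow> real" where
  "sinc2 t = (sinc (pi * t))\<^sup>2"

lemma sinc2_nonneg: "sinc2 t \<ge> 0"
  by (simp add: sinc2_def)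

lemma sinc2_0 [simp]: "sinc2 0 = 1"
  by (simp add: sinc2_def)

lemma sinc2_eq: "t \<noteq> 0 \<Longrightarrow> sinc2 t = (sin (pi * t))\<^sup>2 / (pi * t)\<^sup>2"
  by (simp add: sinc2_def power_divide)

lemma continuous_on_sinc2: "continuous_on A sinc2"
proof (rule continuous_at_imp_continuous_on, rule ballI)
  fix t
  have "isCont (\<lambda>t. (sinc (pi * t))\<^sup>2) t"
    by (intro isCont_power isCont_o2[OF _ isCont_sinc] continuous_intros)
  then show "isCont sinc2 t"
    by (simp add: sinc2_def[abs_def])
qed

lemma borel_measurable_sinc2 [measurable]: "sinc2 \<in> borel_measurable borel"
  by (intro borel_measurable_continuous_onI continuous_on_sinc2)

lemma sinc2_bound: "sinc2 t \<le> 2 / (1 + t\<^sup>2)"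
proof (cases "\<bar>t\<bar> \<le> 1")
  case True
  have "\<bar>sinc (pi * t)\<bar> \<le> 1"
    by (cases "t = 0") (auto simp:  abs_mult divide_le_eq intro: order_trans[OF abs_sin_x_le_abs_x])
  then have "sinc2 t \<le> 1"
    unfolding sinc2_def by (simp only: abs_square_le_1)
  also have "1 \<le> 2 / (1 + t\<^sup>2)"
    using True by (simp add: le_divide_eq add_pos_nonneg abs_square_le_1)
  finally show ?thesis .
next
  case False
  then have t: "t\<^sup>2 > 1"
    using one_less_power[of "\<bar>t\<bar>" 2] by simp
  have "sinc2 t = (sin (pi * t))\<^sup>2 / (pi\<^sup>2 * t\<^sup>2)"
    using False by (auto simp: sinc2_eq power_mult_distrib)
  also have "\<dots> \<le> 1 / (1 * t\<^sup>2)"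
  proof (intro frac_le mult_right_mono)
    show "(sin (pi * t))\<^sup>2 \<le> 1"
      by (simp only: abs_square_le_1 abs_sin_le_one)
    show "1 \<le> pi\<^sup>2"
      using pi_ge_two by (intro one_le_power) simp
  qed (use t in auto)
  also have "\<dots> \<le> 2 / (1 + t\<^sup>2)"
  proof -
    have "0 < t\<^sup>2"
      using t by linarith
    with t show ?thesis
      by (simp add: divide_simps)
  qed
  finally show ?thesis .
qed

text \<open>Linear interpolation between 1 and \<open>cis (- 2 * pi * s)\<close>, multiplied by the
  phase that gives it the value 1 at both ends. Its periodic extension is therefore continuous, and
  its Fourier coefficients are summable.\<close>

definition modulated_line :: "real \<Rightarrow> real \<Rightarrow> complex" where
  "modulated_line s y = cis (2 * pi * s * y) * (of_real (1 - y) + of_real y * cis (- 2 * pi * s))"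

text \<open>The summands with \<open>1 - y\<close> and \<open>y\<close> are the two halves of the
  tent function on [-1, 1], folded into the unit interval, and \<open>sinc2\<close> is the Fourier
  transform of the tent. Integration by parts gives
  \<open>(exp E + exp (- E) - 2) / E\<^sup>2\<close>.\<close>

lemma modulated_line_coefficient:
  "(LINT y|unit_interval. cis (- 2 * pi * of_int q * y) * modulated_line s y) = of_real (sinc2 (s - of_int q))"
proof -
  define t where "t = s - of_int q"
  define E where "E = 2 * pi * \<i> * t"
  have cis_s: "cis (- 2 * pi * s) = exp (- E)"
  proof -
    have "- 2 * pi * s = - 2 * pi * t + 2 * pi * of_int (- q)"
      by (simp add: t_def algebra_simps)
    then have "cis (- 2 * pi * s) = cis (- 2 * pi * t) * cis (2 * pi * of_int (- q))"
      by (simp only: cis_mult)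
    also have "\<dots> = exp (- E)"
      by (simp only: cis_multiple_2pi Ints_of_int) (simp add: E_def cis_conv_exp mult_ac)
    finally show ?thesis .
  qed
  have integrand: "cis (- 2 * pi * of_int q * y) * modulated_line s y =
      exp (E * y) * (of_real (1 - y) + of_real y * exp (- E))" for y
    unfolding modulated_line_def cis_s mult.assoc[symmetric] cis_mult
    by (simp add: E_def t_def cis_conv_exp algebra_simps)
  show ?thesis
  proof (cases "t = 0")
    case True
    then have "(LINT y|unit_interval. cis (- 2 * pi * of_int q * y) * modulated_line s y) = (LINT y|unit_interval. (1::complex))"
      unfolding integrand by (simp add: E_def)
    also have "\<dots> = 1"
      by (simp add: measure_restrict_space space_restrict_space)
    finally show ?thesis
      using True by (simp add: t_def)
  next
    case False
    then have E: "E \<noteq> 0"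
      by (simp add: E_def)
    define K where "K = 1 / E"
    have EK: "E * K = 1"
      using E by (simp add: K_def)
    let ?L = "\<lambda>y. of_real (1 - y) * K + K\<^sup>2 + exp (- E) * (of_real y * K - K\<^sup>2)"
    let ?F = "\<lambda>y. exp (E * of_real y) * ?L y"
    have "(LINT y|unit_interval. cis (- 2 * pi * of_int q * y) * modulated_line s y) = ?F 1 - ?F 0"
      unfolding integrand
    proof (rule integral_unit_interval_FTC)
      show "(?F has_vector_derivative exp (E * x) * (of_real (1 - x) + of_real x * exp (- E))) (at x within {0..1})" for x
      proof -
        have "((\<lambda>y. exp (E * of_real y)) has_vector_derivative E * exp (E * x)) (at x within {0..1})"
          by (auto intro!: derivative_eq_intros has_vector_derivative_real_field)
        moreover have "(?L has_vector_derivative (exp (- E) - 1) * K) (at x within {0..1})"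
          by (auto intro!: derivative_eq_intros simp: algebra_simps)
        ultimately have "(?F has_vector_derivative exp (E * x) * ((exp (- E) - 1) * K) + E * exp (E * x) * ?L x) (at x within {0..1})"
          by (rule has_vector_derivative_mult)
        also have "exp (E * x) * ((exp (- E) - 1) * K) + E * exp (E * x) * ?L x =
            exp (E * x) * (of_real (1 - x) + of_real x * exp (- E))"
          using EK by algebra
        finally show ?thesis .
      qed
    qed (intro continuous_intros)
    also have "\<dots> = (exp E + exp (- E) - 2) * K\<^sup>2"
    proof -
      have "exp E * exp (- E) = 1"
        by (simp add: exp_minus)
      then show ?thesis
        by simp algebra
    qed
    also have "\<dots> = (exp E + exp (- E) - 2) / E\<^sup>2"
      by (simp add: K_def power_divide)
    also have "exp E + exp (- E) = 2 * of_real (cos (2 * pi * t))"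
    proof -
      have "exp E = cis (2 * pi * t)" "exp (- E) = cis (- (2 * pi * t))"
        by (simp_all add: E_def cis_conv_exp mult_ac)
      then show ?thesis
        by (simp add: complex_eq_iff)
    qed
    also have "cos (2 * pi * t) = 1 - 2 * (sin (pi * t))\<^sup>2"
      using cos_double_sin[of "pi * t"] by (simp add: mult_ac)
    also have "(2 * complex_of_real (1 - 2 * (sin (pi * t))\<^sup>2) - 2) / E\<^sup>2 = of_real (sinc2 t)"
      using False by (simp add: E_def sinc2_eq power_mult_distrib field_simps)
    finally show ?thesis
      by (simp add: t_def)
  qed
qed

text \<open>A case of Peetre's inequality: decay in \<open>s - a\<close> becomes decay in
  \<open>a\<close> at the price of a factor that depends on \<open>s\<close> only.\<close>

lemma one_plus_square_shift: "1 + (a::real)\<^sup>2 \<le> 2 * (1 + s\<^sup>2) * (1 + (s - a)\<^sup>2)"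
proof -
  have "2 * (1 + s\<^sup>2) * (1 + (s - a)\<^sup>2) - (1 + a\<^sup>2) = 1 + (2 * s - a)\<^sup>2 + 2 * (s * (s - a))\<^sup>2"
    by (simp add: power2_eq_square algebra_simps)
  moreover have "\<dots> \<ge> 0"
    by (intro add_nonneg_nonneg) auto
  ultimately show ?thesis
    by linarith
qed

lemma inverse_square_shift: "1 / (1 + (s - a)\<^sup>2) \<le> 2 * (1 + s\<^sup>2) * (1 / (1 + (a::real)\<^sup>2))"
  using one_plus_square_shift[of a s] by (simp add: divide_simps add_pos_nonneg)

lemma integrable_sinc2: "integrable (count_space UNIV) (\<lambda>q::int. sinc2 (s - of_int q))"
proof (rule integrable_count_space_bound)
  show "integrable (count_space UNIV) (\<lambda>q::int. 2 * (2 * (1 + s\<^sup>2) * (1 / (1 + (of_int q)\<^sup>2))) :: real)"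
    by (intro integrable_mult_right integrable_count_space_inverse_square)
  show "norm (sinc2 (s - of_int q)) \<le> 2 * (2 * (1 + s\<^sup>2) * (1 / (1 + (of_int q)\<^sup>2)))" for q :: int
  proof -
    have "sinc2 (s - of_int q) \<le> 2 * (1 / (1 + (s - of_int q)\<^sup>2))"
      using sinc2_bound[of "s - of_int q"] by simp
    then show ?thesis
      using inverse_square_shift[of s "of_int q"]
      unfolding real_norm_def abs_of_nonneg[OF sinc2_nonneg] by linarith
  qed
qed

lemma continuous_on_modulated_line: "continuous_on A (modulated_line s)"
  unfolding modulated_line_def by (intro continuous_intros)

lemma norm_modulated_line_le:
  assumes "0 \<le> y" "y \<le> 1"
  shows "norm (modulated_line s y) \<le> 1"
proof -
  have "norm (modulated_line s y) = norm (of_real (1 - y) + of_real y * cis (- 2 * pi * s))"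
    by (simp add: modulated_line_def norm_mult)
  also have "\<dots> \<le> norm (of_real (1 - y) :: complex) + norm (of_real y * cis (- 2 * pi * s))"
    by (rule norm_triangle_ineq)
  also have "\<dots> = 1"
    using assms by (simp add: norm_mult del: of_real_diff)
  finally show ?thesis .
qed

text \<open>One double sum has two limits: as a Fejer mean of the function it tends to the value at
  \<open>y\<close>, as a Cesaro mean of an absolutely summable series it tends to the sum of that
  series.\<close>

lemma modulated_line_series_interior:
  assumes "0 < y" "y < 1"
  shows "modulated_line s y = (LINT q|count_space UNIV. cis (2 * pi * of_int q * y) * of_real (sinc2 (s - of_int q)))"
proof -
  define H where "H q = cis (2 * pi * of_int q * y) * of_real (sinc2 (s - of_int q))" for q :: int
  have H: "integrable (count_space UNIV) H"
    by (rule integrable_count_space_bound[OF integrable_sinc2[of s]]) (simp add: H_def norm_mult sinc2_nonneg)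
  have "(LINT x|unit_interval. fejer N (x - y) *\<^sub>R modulated_line s x) =
      (\<Sum>i<N. \<Sum>j<N. H (int i - int j)) /\<^sub>R real N" for N
  proof -
    have coef: "(LINT x|unit_interval. cis (- 2 * pi * (real i - real j) * (x - y)) * modulated_line s x) = H (int i - int j)" for i j
    proof -
      have "cis (- 2 * pi * (real i - real j) * (x - y)) * modulated_line s x =
         cis (2 * pi * of_int (int i - int j) * y) * (cis (- 2 * pi * of_int (int i - int j) * x) * modulated_line s x)" for x
        unfolding mult.assoc[symmetric] cis_mult by (simp add: algebra_simps)
      then have "(LINT x|unit_interval. cis (- 2 * pi * (real i - real j) * (x - y)) * modulated_line s x) =
          cis (2 * pi * of_int (int i - int j) * y) *
            (LINT x|unit_interval. cis (- 2 * pi * of_int (int i - int j) * x) * modulated_line s x)"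
        by (simp only: integral_mult_right_zero)
      then show ?thesis
        by (simp only: modulated_line_coefficient H_def)
    qed
    have int: "integrable unit_interval (\<lambda>x. cis (- 2 * pi * (real i - real j) * (x - y)) * modulated_line s x)" for i j
      by (rule integrable_unit_interval[where B = 1])
         (auto intro!: borel_measurable_continuous_onI continuous_intros continuous_on_modulated_line
            simp: norm_mult norm_modulated_line_le)
    have "(LINT x|unit_interval. fejer N (x - y) *\<^sub>R modulated_line s x) =
      (LINT x|unit_interval. (\<Sum>i<N. \<Sum>j<N. cis (- 2 * pi * (real i - real j) * (x - y)) * modulated_line s x) / of_nat N)"
      by (simp add: scaleR_conv_of_real fejer_conv_cis sum_distrib_right)
    also have "\<dots> = (\<Sum>i<N. \<Sum>j<N. H (int i - int j)) / of_nat N"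
      using int coef by (simp add: Bochner_Integration.integral_sum Bochner_Integration.integrable_sum)
    finally show ?thesis
      by (simp add: scaleR_conv_of_real divide_inverse mult.commute)
  qed
  moreover have "(\<lambda>N. LINT x|unit_interval. fejer N (x - y) *\<^sub>R modulated_line s x) \<longlonglongrightarrow> modulated_line s y"
    using assms continuous_on_modulated_line[of UNIV s] norm_modulated_line_le
    by (intro fejer_approximation[where B = 1])
       (auto simp: continuous_on_eq_continuous_at intro!: borel_measurable_continuous_onI)
  ultimately have "(\<lambda>N. (\<Sum>i<N. \<Sum>j<N. H (int i - int j)) /\<^sub>R real N) \<longlonglongrightarrow> modulated_line s y"
    by simp
  from LIMSEQ_unique[OF this cesaro_differences[OF H]] show ?thesis
    by (simp add: H_def)
qed

text \<open>The point 0, reached for \<open>l = 0\<close>, is a boundary point for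
  \<open>fejer_approximation\<close>; there both sides are continuous from the right, the series by
  dominated convergence.\<close>

lemma modulated_line_series:
  assumes "0 \<le> y" "y < 1"
  shows "modulated_line s y = (LINT q|count_space UNIV. cis (2 * pi * of_int q * y) * of_real (sinc2 (s - of_int q)))"
proof (cases "y = 0")
  case True
  define Y where "Y n = 1 / real (n + 2)" for n
  have Y: "Y \<longlonglongrightarrow> 0"
    unfolding Y_def using LIMSEQ_ignore_initial_segment[OF lim_1_over_n, of 2] by simp
  have Y01: "0 < Y n" "Y n < 1" for n
    by (auto simp: Y_def)
  let ?S = "\<lambda>y. LINT q|count_space UNIV. cis (2 * pi * of_int q * y) * complex_of_real (sinc2 (s - of_int q))"
  have "isCont (modulated_line s) 0"
    using continuous_on_modulated_line[of UNIV s] by (simp add: continuous_on_eq_continuous_at)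
  from isCont_tendsto_compose[OF this Y] have "(\<lambda>n. modulated_line s (Y n)) \<longlonglongrightarrow> modulated_line s 0" .
  moreover have "(\<lambda>n. ?S (Y n)) \<longlonglongrightarrow> ?S 0"
  proof (rule integral_dominated_convergence[where w = "\<lambda>q. sinc2 (s - of_int q)"])
    show "AE q::int in count_space UNIV. (\<lambda>n. cis (2 * pi * of_int q * Y n) * complex_of_real (sinc2 (s - of_int q)))
        \<longlonglongrightarrow> cis (2 * pi * of_int q * 0) * complex_of_real (sinc2 (s - of_int q))"
    proof (rule AE_I2)
      fix q :: int
      have "continuous_on UNIV (\<lambda>y. cis (2 * pi * of_int q * y) * complex_of_real (sinc2 (s - of_int q)))"
        by (intro continuous_intros)
      then have "isCont (\<lambda>y. cis (2 * pi * of_int q * y) * complex_of_real (sinc2 (s - of_int q))) 0"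
        by (simp add: continuous_on_eq_continuous_at)
      from isCont_tendsto_compose[OF this Y]
      show "(\<lambda>n. cis (2 * pi * of_int q * Y n) * complex_of_real (sinc2 (s - of_int q)))
        \<longlonglongrightarrow> cis (2 * pi * of_int q * 0) * complex_of_real (sinc2 (s - of_int q))" .
    qed
  qed (use integrable_sinc2[of s] in \<open>auto simp: norm_mult sinc2_nonneg\<close>)
  ultimately show ?thesis
    using LIMSEQ_unique modulated_line_series_interior[OF Y01] True by auto
next
  case False
  then show ?thesis
    using assms by (intro modulated_line_series_interior) auto
qed

section \<open>The autocorrelation\<close>

text \<open>An index interval and its translate by \<open>l\<close> differ by at most
  \<open>\<bar>l\<bar>\<close> indices on either side, and everything else cancels. This is the
  telescoping that takes the place of equidistribution.\<close>

lemma abs_sum_shift_interval_le: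
  fixes g :: "int \<Rightarrow> real"
  assumes g: "\<And>k. \<bar>g k\<bar> \<le> 1"
  shows "\<bar>\<Sum>j\<in>{u..v}. g (j + l) - g j\<bar> \<le> 2 * \<bar>of_int l\<bar>"
proof -
  let ?A = "{u..v}" and ?B = "{u + l..v + l}"
  have bound: "\<bar>sum g (C - D)\<bar> \<le> \<bar>of_int l\<bar>"
    if "C - D \<subseteq> E" "finite E" "card E \<le> nat \<bar>l\<bar>" for C D E :: "int set"
  proof -
    have "\<bar>sum g (C - D)\<bar> \<le> (\<Sum>k\<in>C - D. 1)"
      by (rule order_trans[OF sum_abs]) (intro sum_mono g)
    also have "\<dots> \<le> of_nat (card E)"
      using card_mono[OF that(2,1)] by simp
    also have "\<dots> \<le> \<bar>of_int l\<bar>"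
      using that(3) by linarith
    finally show ?thesis .
  qed
  have 1: "\<bar>sum g (?B - ?A)\<bar> \<le> \<bar>of_int l\<bar>"
    by (rule bound[of _ _ "if l \<ge> 0 then {v + 1..v + l} else {u + l..u - 1}"]) auto
  have 2: "\<bar>sum g (?A - ?B)\<bar> \<le> \<bar>of_int l\<bar>"
    by (rule bound[of _ _ "if l \<ge> 0 then {u..u + l - 1} else {v + l + 1..v}"]) auto
  have "(\<Sum>j\<in>?A. g (j + l)) = sum g ?B"
    by (rule sum.reindex_bij_witness[of _ "\<lambda>k. k - l" "\<lambda>k. k + l"]) auto
  then have "(\<Sum>j\<in>?A. g (j + l) - g j) = sum g ?B - sum g ?A"
    by (simp add: sum_subtractf)
  also have "sum g ?B = sum g (?B - ?A) + sum g (?A \<inter> ?B)"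
    by (subst sum.Int_Diff[of _ _ ?A]) (auto simp: Int_commute)
  also have "sum g ?A = sum g (?A - ?B) + sum g (?A \<inter> ?B)"
    by (subst sum.Int_Diff[of _ _ ?B]) auto
  finally show ?thesis
    using 1 2 by linarith
qed

section \<open>Weighted averages over the two possible distances\<close>

context noble_means
begin

text \<open>The difference of two points \<open>l\<close> steps apart is \<open>l + n * de\<close> with \<open>n\<close> one of the two integers
  next to \<open>l * al\<close>; \<open>interp f l\<close> is the average of \<open>f\<close> over these two values, weighted by
  their frequencies.\<close>

definition interp :: "(real \<Rightarrow> real) \<Rightarrow> int \<Rightarrow> real" where
  "interp f l = (1 - frac (l * al)) * f (l + \<lfloor>l * al\<rfloor> * de) + frac (l * al) * f (l + (\<lfloor>l * al\<rfloor> + 1) * de)"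

lemma interp_mono: "(\<And>x. f x \<le> g x) \<Longrightarrow> interp f l \<le> interp g l"
  unfolding interp_def using frac_ge_0 frac_lt_1 less_imp_le
  by (intro add_mono mult_left_mono) (auto simp: less_imp_le)

lemma interp_diff: "interp (\<lambda>x. f x - g x) l = interp f l - interp g l"
  by (simp add: interp_def algebra_simps)

text \<open>The affine function of \<open>n\<close> that agrees with \<open>f\<close> at both
  admissible values has the value \<open>interp f l\<close> at \<open>l * al\<close>, so the error
  is its slope times the discrepancy. For \<open>l = 0\<close> the bound alone would also admit
  \<open>n = -1\<close>.\<close>

lemma interp_eq_value:
  assumes "\<bar>of_int l * al - of_int n\<bar> \<le> 1" "l = 0 \<Longrightarrow> n = 0"
  shows "f (of_int l + of_int n * de) =
    interp f l + (f (l + \<lfloor>l * al\<rfloor> * de) - f (l + (\<lfloor>l * al\<rfloor> + 1) * de)) * (of_int l * al - of_int n)"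
proof -
  define m where "m = \<lfloor>l * al\<rfloor>"
  have fr: "frac (l * al) = l * al - m"
    by (simp add: frac_def m_def)
  have "n = m \<or> n = m + 1"
  proof (cases "l = 0")
    case False
    then have "frac (l * al) \<noteq> 0"
      using al_int_multiple[of l "\<lfloor>l * al\<rfloor>"] by (auto simp: frac_def)
    then have "frac (l * al) > 0"
      using frac_ge_0[of "l * al"] by linarith
    moreover have "frac (l * al) < 1"
      by (rule frac_lt_1)
    ultimately have "of_int n < (of_int m :: real) + 2" "of_int n > (of_int m :: real) - 1"
      using assms(1) by (auto simp: fr)
    then have "n < m + 2" "n > m - 1"
      by linarith+
    then show ?thesis
      by linarith
  qed (simp add: assms(2) m_def)
  then show ?thesis
  proof
    assume "n = m"
    then show ?thesis
      unfolding interp_def m_def[symmetric] fr by (simp add: algebra_simps)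
  next
    assume n: "n = m + 1"
    show ?thesis
      unfolding interp_def m_def[symmetric] fr by (simp add: n algebra_simps)
  qed
qed

text \<open>Neither of the two integers next to \<open>l * al\<close> has the sign opposite to
  \<open>l\<close>, so both distances are at least \<open>\<bar>l\<bar>\<close> in absolute
  value.\<close>

lemma interp_support:
  assumes "\<And>x. \<bar>x\<bar> > B \<Longrightarrow> f x = 0" "\<bar>of_int l\<bar> > B"
  shows "interp f l = 0"
proof -
  have "\<bar>of_int l\<bar> \<le> \<bar>of_int l + of_int n * de\<bar>" if "n = \<lfloor>l * al\<rfloor> \<or> n = \<lfloor>l * al\<rfloor> + 1" for n
  proof (cases "l \<ge> 0")
    case True
    then have "n \<ge> 0"
      using that al_pos by auto
    then have "of_int n * de \<ge> 0"
      using de_pos by simp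
    then show ?thesis
      using True by simp
  next
    case False
    then have "l * al < 0"
      using al_pos by (simp add: mult_neg_pos)
    then have "n \<le> 0"
      using that by (auto simp: floor_less_iff intro: int_one_le_iff_zero_less) linarith+
    then have "of_int n * de \<le> 0"
      using de_pos by (simp add: mult_nonpos_nonneg)
    then show ?thesis
      using False by simp
  qed
  then have "f (of_int l + of_int n * de) = 0" if "n = \<lfloor>l * al\<rfloor> \<or> n = \<lfloor>l * al\<rfloor> + 1" for n
    using that assms(2) by (intro assms(1)) force
  from this[of "\<lfloor>l * al\<rfloor>"] this[of "\<lfloor>l * al\<rfloor> + 1"] show ?thesis
    by (simp add: interp_def)
qed

end

section \<open>Limits of pair sums\<close>

context noble_means_tiling_locale
begin

text \<open>Pairs are grouped by their number of steps \<open>l\<close>. Each contributes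
  \<open>interp f l\<close> and a multiple of an increment of the bounded sequence \<open>Y\<close>.
  About \<open>2 * R / c\<close> pairs occur for each \<open>l\<close>, while the increments
  telescope, so the total error is bounded independently of \<open>R\<close>.\<close>

lemma pair_sum_asymptotics:
  assumes f: "\<And>x. \<bar>x\<bar> > B \<Longrightarrow> f x = (0 :: real)" and M: "B \<le> real M"
  shows "((\<lambda>R. (\<Sum>x\<in>left_endpoints T \<inter> {-R..R}. \<Sum>y\<in>left_endpoints T \<inter> {-R..R}. f (x - y)) / (2 * R))
           \<longlongrightarrow> (\<Sum>l\<in>{- int M..int M}. interp f l) / c) at_top"
proof -
  obtain x :: "int \<Rightarrow> real" where range: "range x = left_endpoints T"
    and step1: "\<And>j. x j + 1 \<le> x (j + 1)" and step2: "\<And>j. x (j + 1) \<le> x j + lam"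
    and diff: "\<And>i j. \<exists>n::int. x j - x i = of_int (j - i) + n * de \<and> \<bar>of_int (j - i) * al - n\<bar> \<le> 1"
    using ex_points by metis
  note up = add_int_le_of_steps[of x, OF step1]
  have less_iff: "x i < x j \<longleftrightarrow> i < j" for i j
  proof
    show "i < j" if "x i < x j"
      using that up[of j i] by (force simp: not_less)
    show "x i < x j" if "i < j"
      using that up[of i j] by simp
  qed
  have le_iff: "x i \<le> x j \<longleftrightarrow> i \<le> j" for i j
    using less_iff[of j i] by (simp flip: not_less)
  have inj: "inj x"
    by (metis less_iff injI linorder_neqE order_less_irrefl)
  have dist_ge: "\<bar>of_int (i - j)\<bar> \<le> \<bar>x i - x j\<bar>" for i j
    using up[of i j] up[of j i] by (cases "i \<le> j") auto
  \<comment> \<open>Up to the factor \<open>1 + mu\<close> and an additive constant this is the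
    conjugate of \<open>x j\<close>: its increments are the discrepancies \<open>l * al - n\<close>.
    It measures the deviation of \<open>x j\<close> from the progression with step
    \<open>c\<close>.\<close>
  define Y where "Y j = (c * of_int j - x j) / de" for j
  have Y_diff: "Y j - Y i = of_int (j - i) * al - n" if "x j - x i = of_int (j - i) + of_int n * de" for i j n
  proof -
    have "Y j - Y i = (c * of_int (j - i) - (x j - x i)) / de"
      unfolding Y_def diff_divide_distrib[symmetric] by (simp add: algebra_simps)
    also have "\<dots> = of_int (j - i) * al - n"
      unfolding that c_def using de_pos by (simp add: field_simps)
    finally show ?thesis .
  qed
  have Y_bound: "\<bar>Y j - Y i\<bar> \<le> 1" for i j
  proof -
    obtain n :: int where "x j - x i = of_int (j - i) + of_int n * de" "\<bar>of_int (j - i) * al - n\<bar> \<le> 1"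
      using diff[of j i] by auto
    then show ?thesis
      using Y_diff[of j i n] by simp
  qed
  have x_diff: "x j - x i = c * of_int (j - i) - de * (Y j - Y i)" for i j
    using de_pos by (simp add: Y_def field_simps)
  define S where "S l = f (l + \<lfloor>l * al\<rfloor> * de) - f (l + (\<lfloor>l * al\<rfloor> + 1) * de)" for l :: int
  have f_eq: "f (x (j + l) - x j) = interp f l + S l * (Y (j + l) - Y j)" for j l
  proof -
    obtain n :: int where n: "x (j + l) - x j = of_int l + n * de" "\<bar>of_int l * al - n\<bar> \<le> 1"
      using diff[of "j + l" j] by auto
    have "l = 0 \<Longrightarrow> n = 0"
      using n de_pos by simp
    then show ?thesis
      using interp_eq_value[OF n(2), of f] Y_diff[of "j + l" j n] n(1) by (simp add: S_def)
  qed
  \<comment> \<open>Bounds \<open>c\<close> times the number of points in the window minus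
    \<open>2 * R\<close>: at most \<open>lam\<close> is lost at each end, \<open>de\<close> comes
    from \<open>Y\<close>, and \<open>c\<close> from the number of points being one more than
    \<open>b - a\<close>.\<close>
  define C where "C = 2 * lam + de + c"
  define K where "K = (\<Sum>l\<in>{- int M..int M}. \<bar>interp f l\<bar> * (\<bar>of_int l\<bar> + C / c) + \<bar>S l\<bar> * (2 * \<bar>of_int l\<bar>))"
  have main: "\<bar>(\<Sum>u\<in>left_endpoints T \<inter> {-R..R}. \<Sum>v\<in>left_endpoints T \<inter> {-R..R}. f (u - v)) -
      2 * R * ((\<Sum>l\<in>{- int M..int M}. interp f l) / c)\<bar> \<le> K" if R: "R \<ge> lam" for R
  proof -
    let ?\<Lambda> = "left_endpoints T \<inter> {-R..R}"
    obtain b where b: "x b \<le> R" "R < x (b + 1)"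
      using ex_index[of x R, OF step1] by blast
    obtain a' where a': "x a' \<le> - R" "- R < x (a' + 1)"
      using ex_index[of x "- R", OF step1] by blast
    \<comment> \<open>\<open>ex_index\<close> yields the last point not beyond \<open>- R\<close>,
      whereas the first point inside the closed window is needed; they agree only if
      \<open>- R\<close> itself is a point.\<close>
    define a where "a = (if x a' = - R then a' else a' + 1)"
    have a: "- R \<le> x a" "x a \<le> - R + lam"
      using a' step2[of a'] lam_pos by (auto simp: a_def)
    have a_less: "x j < - R" if "j < a" for j
      using that a' le_iff[of j a'] less_iff[of j a'] by (auto simp: a_def split: if_splits)
    have J: "- R \<le> x j \<and> x j \<le> R \<longleftrightarrow> j \<in> {a..b}" for j
      using a_less[of j] a b le_iff[of a j] le_iff[of j b] le_iff[of "b + 1" j]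
      by (auto simp: not_less)
    have "a \<le> b"
      using J[of a] a R lam_pos by auto
    have \<Lambda>: "?\<Lambda> = x ` {a..b}"
      using J range by force
    have count: "\<bar>of_nat (card {a..b}) - 2 * R / c\<bar> \<le> C / c"
    proof -
      have "\<bar>de * (Y b - Y a)\<bar> \<le> de"
        using Y_bound[of b a] de_pos by (simp add: abs_mult)
      moreover have "x b > R - lam"
        using b step2[of b] by simp
      moreover have "c * real (card {a..b}) = c * of_int (b - a) + c"
        using \<open>a \<le> b\<close> by (simp add: algebra_simps)
      ultimately have "\<bar>c * real (card {a..b}) - 2 * R\<bar> \<le> C"
        using x_diff[of b a] a b c_pos unfolding C_def by linarith
      then have "\<bar>c * real (card {a..b}) - 2 * R\<bar> / c \<le> C / c"
        using c_pos by (intro divide_right_mono) auto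
      also have "\<bar>c * real (card {a..b}) - 2 * R\<bar> / c = \<bar>(c * real (card {a..b}) - 2 * R) / c\<bar>"
        using c_pos by simp
      also have "(c * real (card {a..b}) - 2 * R) / c = real (card {a..b}) - 2 * R / c"
        using c_pos by (simp add: diff_divide_distrib)
      finally show ?thesis .
    qed
    \<comment> \<open>The indices \<open>j\<close> for which both \<open>j\<close> and
      \<open>j + l\<close> lie between \<open>a\<close> and \<open>b\<close>.\<close>
    define I where "I l = {max a (a - l)..min b (b - l)}" for l
    have card_I: "\<bar>real (card (I l)) - real (card {a..b})\<bar> \<le> \<bar>of_int l\<bar>" for l
    proof -
      have "\<bar>int (card (I l)) - int (card {a..b})\<bar> \<le> \<bar>l\<bar>"
        using \<open>a \<le> b\<close> by (auto simp: I_def max_def min_def)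
      then show ?thesis
        by linarith
    qed
    have "(\<Sum>u\<in>?\<Lambda>. \<Sum>v\<in>?\<Lambda>. f (u - v)) = (\<Sum>i\<in>{a..b}. \<Sum>j\<in>{a..b}. f (x i - x j))"
      unfolding \<Lambda> by (simp add: sum.reindex inj_on_subset[OF inj])
    also have "\<dots> = (\<Sum>(i, j)\<in>{a..b} \<times> {a..b}. f (x i - x j))"
      by (simp add: sum.cartesian_product)
    also have "\<dots> = (\<Sum>(l, j)\<in>Sigma {- int M..int M} I. f (x (j + l) - x j))"
    proof (rule sum.reindex_bij_witness_not_neutral
        [where S' = "{(i, j) \<in> {a..b} \<times> {a..b}. \<bar>i - j\<bar> > int M}" and T' = "{}"
          and i = "\<lambda>(l, j). (j + l, j)" and j = "\<lambda>(i, j). (i - j, j)"])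
      show "finite {(i, j) \<in> {a..b} \<times> {a..b}. \<bar>i - j\<bar> > int M}"
        by (rule finite_subset[of _ "{a..b} \<times> {a..b}"]) auto
      show "(case k of (i, j) \<Rightarrow> f (x i - x j)) = 0" if k_in: "k \<in> {(i, j) \<in> {a..b} \<times> {a..b}. \<bar>i - j\<bar> > int M}" for k
      proof -
        obtain i j where k: "k = (i, j)" "\<bar>i - j\<bar> > int M"
          using k_in by (cases k) auto
        then have "\<bar>of_int (i - j)\<bar> > real M"
          by linarith
        then have "\<bar>x i - x j\<bar> > B"
          using dist_ge[of i j] M by linarith
        then show ?thesis
          using f k by simp
      qed
    qed (auto simp: I_def)
    also have "\<dots> = (\<Sum>l\<in>{- int M..int M}. \<Sum>j\<in>I l. f (x (j + l) - x j))"
      by (subst sum.Sigma) (auto simp: I_def)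
    finally have eq: "(\<Sum>u\<in>?\<Lambda>. \<Sum>v\<in>?\<Lambda>. f (u - v)) - 2 * R * ((\<Sum>l\<in>{- int M..int M}. interp f l) / c) =
        (\<Sum>l\<in>{- int M..int M}. (\<Sum>j\<in>I l. f (x (j + l) - x j)) - 2 * R / c * interp f l)"
      by (simp add: sum_subtractf sum_distrib_left sum_divide_distrib)
    show ?thesis
      unfolding eq K_def
    proof (rule order_trans[OF sum_abs sum_mono])
      fix l assume "l \<in> {- int M..int M}"
      have Y_sum: "\<bar>\<Sum>j\<in>I l. Y (j + l) - Y j\<bar> \<le> 2 * \<bar>of_int l\<bar>"
        using abs_sum_shift_interval_le[of "\<lambda>k. Y k - Y 0" l "max a (a - l)" "min b (b - l)"] Y_bound
        by (simp add: I_def)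
      have "(\<Sum>j\<in>I l. f (x (j + l) - x j)) - 2 * R / c * interp f l =
          interp f l * (real (card (I l)) - 2 * R / c) + S l * (\<Sum>j\<in>I l. Y (j + l) - Y j)"
        unfolding f_eq sum.distrib sum_distrib_left[symmetric] by (simp add: algebra_simps)
      also have "\<bar>\<dots>\<bar> \<le> \<bar>interp f l\<bar> * \<bar>real (card (I l)) - 2 * R / c\<bar> + \<bar>S l\<bar> * \<bar>\<Sum>j\<in>I l. Y (j + l) - Y j\<bar>"
        unfolding abs_mult[symmetric] by (rule abs_triangle_ineq)
      also have "\<dots> \<le> \<bar>interp f l\<bar> * (\<bar>of_int l\<bar> + C / c) + \<bar>S l\<bar> * (2 * \<bar>of_int l\<bar>)"
        using card_I[of l] count Y_sum by (intro add_mono mult_left_mono) linarith+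
      finally show "\<bar>(\<Sum>j\<in>I l. f (x (j + l) - x j)) - 2 * R / c * interp f l\<bar> \<le> \<dots>" .
    qed
  qed
  have "((\<lambda>R. (\<Sum>x\<in>left_endpoints T \<inter> {-R..R}. \<Sum>y\<in>left_endpoints T \<inter> {-R..R}. f (x - y)) / (2 * R)
      - (\<Sum>l\<in>{- int M..int M}. interp f l) / c) \<longlongrightarrow> 0) at_top"
  proof (rule Lim_null_comparison)
    show "\<forall>\<^sub>F R in at_top. norm ((\<Sum>x\<in>left_endpoints T \<inter> {-R..R}. \<Sum>y\<in>left_endpoints T \<inter> {-R..R}. f (x - y)) / (2 * R)
      - (\<Sum>l\<in>{- int M..int M}. interp f l) / c) \<le> K / (2 * R)"
      using eventually_ge_at_top[of lam]
    proof eventually_elim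
      case (elim R)
      then have R: "R > 0"
        using lam_pos by simp
      let ?F = "\<Sum>x\<in>left_endpoints T \<inter> {-R..R}. \<Sum>y\<in>left_endpoints T \<inter> {-R..R}. f (x - y)"
      have "?F / (2 * R) - (\<Sum>l\<in>{- int M..int M}. interp f l) / c =
          (?F - 2 * R * ((\<Sum>l\<in>{- int M..int M}. interp f l) / c)) / (2 * R)"
        using R by (simp add: diff_divide_distrib)
      also have "\<bar>\<dots>\<bar> \<le> K / (2 * R)"
        using main[OF elim] R by (simp add: divide_right_mono)
      finally show ?case
        by simp
    qed
    have "filterlim (\<lambda>R::real. 2 * R) at_top at_top"
      by (rule filterlim_tendsto_pos_mult_at_top[OF tendsto_const]) (auto intro: filterlim_ident)
    then show "((\<lambda>R. K / (2 * R)) \<longlongrightarrow> 0) at_top"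
      by (intro tendsto_divide_0[OF tendsto_const] filterlim_at_top_imp_at_infinity)
  qed
  then show ?thesis
    by (rule LIM_zero_cancel)
qed

lemma interp_compact_support:
  assumes \<gamma>: "is_autocorrelation (left_endpoints T) \<gamma>"
    and cont: "continuous_on UNIV f" and supp: "\<And>x. \<bar>x\<bar> > B \<Longrightarrow> f x = 0"
  shows "integrable (count_space UNIV) (interp f)"
    and "(LINT l|count_space UNIV. interp f l) = c * (LINT u|\<gamma>. f u)"
proof -
  define M where "M = nat \<lceil>B\<rceil>"
  have M: "B \<le> real M"
    using real_nat_ceiling_ge[of B] by (simp add: M_def)
  have zero: "interp f l = 0" if "l \<notin> {- int M..int M}" for l
  proof (rule interp_support[OF supp])
    have "\<bar>l\<bar> > int M"
      using that by auto
    then show "\<bar>of_int l\<bar> > B"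
      using M by linarith
  qed
  have "Infinite_Set_Sum.abs_summable_on (interp f) {- int M..int M} \<longleftrightarrow> Infinite_Set_Sum.abs_summable_on (interp f) UNIV"
    using zero by (intro abs_summable_on_cong_neutral) auto
  then show "integrable (count_space UNIV) (interp f)"
    by (simp add: abs_summable_on_def integrable_count_space)
  have "compactly_supported f"
    unfolding compactly_supported_def using supp
    by (intro exI[of _ "{-B..B}"]) (auto simp: abs_le_iff not_le[symmetric] intro: ccontr)
  then have "((\<lambda>R. (\<Sum>x\<in>left_endpoints T \<inter> {-R..R}. \<Sum>y\<in>left_endpoints T \<inter> {-R..R}. f (x - y)) / (2 * R))
           \<longlongrightarrow> (LINT u|\<gamma>. f u)) at_top"
    using \<gamma> cont by (auto simp: is_autocorrelation_def)
  with pair_sum_asymptotics[of B f M, OF supp M] have "(LINT u|\<gamma>. f u) = (\<Sum>l\<in>{- int M..int M}. interp f l) / c"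
    by (intro tendsto_unique[of at_top]) auto
  then show "(LINT l|count_space UNIV. interp f l) = c * (LINT u|\<gamma>. f u)"
    using integral_count_space_support[of "{- int M..int M}" "interp f"] zero c_pos by simp
qed

text \<open>The Fourier transform of a test function need not have compact support. Trapezoidal
  cutoffs bridge the gap: they increase to 1, so the sums converge monotonically, and the integrals
  against the autocorrelation are dominated by \<open>f\<close>.\<close>

lemma interp_nonneg_integrable:
  assumes \<gamma>: "is_autocorrelation (left_endpoints T) \<gamma>"
    and cont: "continuous_on UNIV f" and nonneg: "\<And>x. f x \<ge> 0" and int: "integrable \<gamma> f"
  shows "has_bochner_integral (count_space UNIV) (interp f) (c * (LINT u|\<gamma>. f u))"
proof -
  define cut where "cut n x = max 0 (min 1 (real n + 1 - \<bar>x\<bar>))" for n and x :: real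
  have cut01: "0 \<le> cut n x" "cut n x \<le> 1" for n x
    by (auto simp: cut_def)
  have cut_mono: "cut m x \<le> cut n x" if "m \<le> n" for m n x
    using that by (auto simp: cut_def)
  have cut_1: "\<forall>\<^sub>F n in sequentially. cut n x = 1" for x
    using eventually_ge_at_top[of "nat \<lceil>\<bar>x\<bar>\<rceil>"]
  proof eventually_elim
    case (elim n)
    then have "\<bar>x\<bar> \<le> real n"
      using real_nat_ceiling_ge[of "\<bar>x\<bar>"] by linarith
    then show ?case
      by (simp add: cut_def)
  qed
  define F where "F n x = cut n x * f x" for n x
  have F_cont: "continuous_on UNIV (F n)" for n
    unfolding F_def cut_def by (intro continuous_intros cont)
  have F_supp: "F n x = 0" if "\<bar>x\<bar> > real n + 1" for n x
    using that by (simp add: F_def cut_def)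
  have F_lim: "(\<lambda>n. F n x) \<longlonglongrightarrow> f x" for x
    by (rule tendsto_eventually, use cut_1[of x] in \<open>auto simp: F_def elim!: eventually_mono\<close>)
  have sets: "sets \<gamma> = sets borel"
    using \<gamma> by (simp add: is_autocorrelation_def radon_measure_def)
  show ?thesis
  proof (rule has_bochner_integral_monotone_convergence)
    show "integrable (count_space UNIV) (interp (F n))" for n
      by (rule interp_compact_support(1)[OF \<gamma> F_cont F_supp])
    show "AE l in count_space UNIV. mono (\<lambda>n. interp (F n) l)"
      by (intro AE_I2 monoI interp_mono) (auto simp: F_def intro!: mult_right_mono cut_mono nonneg)
    show "AE l in count_space UNIV. (\<lambda>n. interp (F n) l) \<longlonglongrightarrow> interp f l"
      unfolding interp_def by (intro AE_I2 tendsto_intros F_lim)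
    have "(\<lambda>n. LINT u|\<gamma>. F n u) \<longlonglongrightarrow> (LINT u|\<gamma>. f u)"
    proof (rule integral_dominated_convergence[where w = f])
      show "F n \<in> borel_measurable \<gamma>" for n
        using borel_measurable_continuous_onI[OF F_cont[of n]] by (simp add: measurable_cong_sets[OF sets refl])
      show "AE x in \<gamma>. norm (F n x) \<le> f x" for n
        using cut01 nonneg by (intro AE_I2) (auto simp: F_def abs_mult intro!: mult_left_le_one_le)
    qed (use int F_lim in auto)
    then have "(\<lambda>n. c * (LINT u|\<gamma>. F n u)) \<longlonglongrightarrow> c * (LINT u|\<gamma>. f u)"
      by (rule tendsto_mult_left)
    then show "(\<lambda>n. LINT l|count_space UNIV. interp (F n) l) \<longlonglongrightarrow> c * (LINT u|\<gamma>. f u)"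
      by (simp add: interp_compact_support(2)[OF \<gamma> F_cont F_supp])
  qed simp
qed

lemma interp_integrable:
  assumes \<gamma>: "is_autocorrelation (left_endpoints T) \<gamma>"
    and cont: "continuous_on UNIV f" and int: "integrable \<gamma> f"
  shows "has_bochner_integral (count_space UNIV) (interp f) (c * (LINT u|\<gamma>. f u))"
proof -
  let ?p = "\<lambda>x. max (f x) 0" and ?m = "\<lambda>x. max (- f x) 0"
  have cont': "continuous_on UNIV ?p" "continuous_on UNIV ?m"
    by (intro continuous_intros cont)+
  have int': "integrable \<gamma> ?p" "integrable \<gamma> ?m"
    using int by auto
  have f: "f = (\<lambda>x. ?p x - ?m x)"
    by (auto simp: max_def)
  have "has_bochner_integral (count_space UNIV) (\<lambda>l. interp ?p l - interp ?m l)
      (c * (LINT u|\<gamma>. ?p u) - c * (LINT u|\<gamma>. ?m u))"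
    by (intro has_bochner_integral_diff interp_nonneg_integrable[OF \<gamma>] cont' int') auto
  also have "(\<lambda>l. interp ?p l - interp ?m l) = interp f"
    unfolding interp_diff[symmetric] f[symmetric] ..
  also have "c * (LINT u|\<gamma>. ?p u) - c * (LINT u|\<gamma>. ?m u) = c * (LINT u|\<gamma>. f u)"
    unfolding right_diff_distrib[symmetric] Bochner_Integration.integral_diff[OF int', symmetric] f[symmetric] ..
  finally show ?thesis .
qed

end

section \<open>Gaussians\<close>

definition gauss :: "real \<Rightarrow> real \<Rightarrow> real \<Rightarrow> real" where
  "gauss a b x = exp (- a * (x - b)\<^sup>2)"

lemma gauss_pos: "gauss a b x > 0"
  by (simp add: gauss_def)

lemma continuous_on_gauss: "continuous_on A (gauss a b)"
  unfolding gauss_def[abs_def] by (intro continuous_intros)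

lemma borel_measurable_gauss [measurable]: "gauss a b \<in> borel_measurable borel"
  by (intro borel_measurable_continuous_onI continuous_on_gauss)

lemma gauss_has_derivative: "(gauss a b has_real_derivative - 2 * a * (x - b) * gauss a b x) (at x)"
  unfolding gauss_def[abs_def] by (auto intro!: derivative_eq_intros)

lemma integrable_gauss:
  assumes "a > 0"
  shows "integrable lborel (gauss a b)"
proof -
  define \<sigma> where "\<sigma> = sqrt (1 / (2 * a))"
  have "\<sigma>\<^sup>2 = 1 / (2 * a)"
    using assms by (simp add: \<sigma>_def)
  then have "gauss a b = (\<lambda>x. sqrt (2 * pi * \<sigma>\<^sup>2) * normal_density b \<sigma> x)"
    using assms by (intro ext) (simp add: normal_density_def gauss_def)
  moreover have "integrable lborel (normal_density b \<sigma>)"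
    using assms by (intro integrable_normal_density) (simp add: \<sigma>_def)
  ultimately show ?thesis
    by simp
qed

lemma power_gauss_bounded:
  assumes a: "a > 0"
  shows "\<exists>C. \<forall>x. \<bar>x ^ n * gauss a b x\<bar> \<le> C"
proof (cases "n = 0")
  case True
  then show ?thesis
    using a by (intro exI[of _ 1]) (simp add: gauss_def)
next
  case n: False
  \<comment> \<open>Half of the decay rate pays for moving the centre to 0, as
    \<open>x^2 <= 2 * (x - b)^2 + 2 * b^2\<close>; the other half, \<open>t\<close>, has to beat the
    power.\<close>
  define t where "t = a / 2"
  have t: "t > 0"
    using a by (simp add: t_def)
  have "\<bar>x ^ n * gauss a b x\<bar> \<le> exp (a * b\<^sup>2) * (1 + (n / t) ^ n)" for x
  proof -
    have "x\<^sup>2 \<le> 2 * (x - b)\<^sup>2 + 2 * b\<^sup>2"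
      using zero_le_power2[of "x - 2 * b"] by (simp add: power2_eq_square algebra_simps)
    then have "a * x\<^sup>2 \<le> a * (2 * (x - b)\<^sup>2 + 2 * b\<^sup>2)"
      using a by (intro mult_left_mono) auto
    then have g: "gauss a b x \<le> exp (a * b\<^sup>2) * exp (- t * x\<^sup>2)"
      by (simp add: gauss_def exp_add[symmetric] t_def algebra_simps)
    have "(t * x\<^sup>2 / n) ^ n \<le> (1 + t * x\<^sup>2 / n) ^ n"
      using t by (intro power_mono) auto
    also have "\<dots> \<le> exp (t * x\<^sup>2)"
    proof (rule exp_ge_one_plus_x_over_n_power_n)
      have "0 \<le> t * x\<^sup>2"
        using t by simp
      then show "- real n \<le> t * x\<^sup>2"
        by linarith
    qed (use n in simp)
    finally have "(t / n) ^ n * (x\<^sup>2) ^ n \<le> exp (t * x\<^sup>2)"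
      by (simp add: power_mult_distrib power_divide)
    then have "(n / t) ^ n * ((t / n) ^ n * (x\<^sup>2) ^ n) \<le> (n / t) ^ n * exp (t * x\<^sup>2)"
      using t by (intro mult_left_mono) auto
    moreover have "(n / t) ^ n * (t / n) ^ n = 1"
      using t n by (simp flip: power_mult_distrib)
    ultimately have x2n: "(x\<^sup>2) ^ n \<le> (n / t) ^ n * exp (t * x\<^sup>2)"
      by (simp add: mult.assoc[symmetric])
    have "\<bar>x ^ n\<bar> \<le> 1 + (x\<^sup>2) ^ n"
    proof -
      have "(x\<^sup>2) ^ n = \<bar>x ^ n\<bar>\<^sup>2"
        by (simp add: power_mult[symmetric] mult.commute)
      moreover have "y \<le> 1 + y\<^sup>2" for y :: real
        using zero_le_power2[of "y - 1 / 2"] by (simp add: power2_eq_square algebra_simps)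
      ultimately show ?thesis
        by metis
    qed
    also have "\<dots> \<le> exp (t * x\<^sup>2) + (n / t) ^ n * exp (t * x\<^sup>2)"
      using x2n t by (intro add_mono) auto
    finally have "\<bar>x ^ n\<bar> * gauss a b x \<le> ((1 + (n / t) ^ n) * exp (t * x\<^sup>2)) * (exp (a * b\<^sup>2) * exp (- t * x\<^sup>2))"
      using g t by (intro mult_mono) (auto simp: distrib_right less_imp_le[OF gauss_pos])
    also have "\<dots> = exp (a * b\<^sup>2) * (1 + (n / t) ^ n) * (exp (t * x\<^sup>2) * exp (- t * x\<^sup>2))"
      by (simp add: mult_ac)
    also have "exp (t * x\<^sup>2) * exp (- t * x\<^sup>2) = 1"
      by (simp flip: exp_add)
    finally show ?thesis
      by (simp add: abs_mult less_imp_le[OF gauss_pos])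
  qed
  then show ?thesis
    by blast
qed

lemma poly_gauss_bounded:
  assumes "a > 0"
  shows "\<exists>C. \<forall>x. \<bar>x ^ n * (poly P x * gauss a b x)\<bar> \<le> C"
proof (induction P arbitrary: n)
  case (pCons c P)
  obtain C1 where C1: "\<And>x. \<bar>x ^ n * gauss a b x\<bar> \<le> C1"
    using power_gauss_bounded[OF assms] by blast
  obtain C2 where C2: "\<And>x. \<bar>x ^ Suc n * (poly P x * gauss a b x)\<bar> \<le> C2"
    using pCons.IH by blast
  have "\<bar>x ^ n * (poly (pCons c P) x * gauss a b x)\<bar> \<le> \<bar>c\<bar> * C1 + C2" for x
  proof -
    have "x ^ n * (poly (pCons c P) x * gauss a b x) = c * (x ^ n * gauss a b x) + x ^ Suc n * (poly P x * gauss a b x)"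
      by (simp add: algebra_simps)
    also have "\<bar>\<dots>\<bar> \<le> \<bar>c\<bar> * \<bar>x ^ n * gauss a b x\<bar> + \<bar>x ^ Suc n * (poly P x * gauss a b x)\<bar>"
      by (rule order_trans[OF abs_triangle_ineq]) (simp add: abs_mult)
    also have "\<dots> \<le> \<bar>c\<bar> * C1 + C2"
      by (intro add_mono mult_left_mono C1 C2) simp
    finally show ?thesis .
  qed
  then show ?case
    by blast
qed (auto intro: exI[of _ 0])

lemma schwartz_gauss:
  assumes "a > 0"
  shows "schwartz (\<lambda>x. complex_of_real (gauss a b x))"
proof -
  \<comment> \<open>The derivatives are Hermite-like polynomials times the Gaussian, and this is the
    recursion that the product rule imposes on the polynomials.\<close>
  define P where "P = rec_nat 1 (\<lambda>_ p. pderiv p - smult (2 * a) ([:- b, 1:] * p))"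
  have P_Suc: "P (Suc n) = pderiv (P n) - smult (2 * a) ([:- b, 1:] * P n)" and P_0: "P 0 = 1" for n
    by (simp_all add: P_def)
  define D where "D n x = complex_of_real (poly (P n) x * gauss a b x)" for n x
  show ?thesis
    unfolding schwartz_def
  proof (intro exI[of _ D] conjI allI)
    show "D 0 = (\<lambda>x. complex_of_real (gauss a b x))"
      by (simp add: D_def P_0 fun_eq_iff)
    show "(D n has_vector_derivative D (Suc n) x) (at x)" for n x
      unfolding D_def
    proof (rule has_vector_derivative_of_real)
      have "((\<lambda>x. poly (P n) x * gauss a b x) has_real_derivative
          poly (pderiv (P n)) x * gauss a b x + (- 2 * a * (x - b) * gauss a b x) * poly (P n) x) (at x)"
        by (rule DERIV_mult[OF poly_DERIV gauss_has_derivative])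
      also have "poly (pderiv (P n)) x * gauss a b x + (- 2 * a * (x - b) * gauss a b x) * poly (P n) x =
          poly (P (Suc n)) x * gauss a b x"
        by (simp add: P_Suc algebra_simps)
      finally show "((\<lambda>x. poly (P n) x * gauss a b x) has_real_derivative poly (P (Suc n)) x * gauss a b x) (at x)" .
    qed
    show "bounded (range (\<lambda>x. x ^ m *\<^sub>R D n x))" for m n
    proof -
      obtain C where "\<And>x. \<bar>x ^ m * (poly (P n) x * gauss a b x)\<bar> \<le> C"
        using poly_gauss_bounded[OF assms] by blast
      then show ?thesis
        by (auto simp: bounded_iff D_def norm_mult abs_mult intro!: exI[of _ C])
    qed
  qed
qed

text \<open>The square is what \<open>bragg_bound\<close> consumes: one factor compensates Peetre's
  inequality, the other gives summability in \<open>r\<close>.\<close>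

lemma gauss_le_inverse_power4:
  assumes "a > 0"
  shows "\<exists>C>0. \<forall>x. gauss a b x \<le> C / (1 + x\<^sup>2)\<^sup>2"
proof -
  obtain C0 C2 C4 where C: "\<And>x. \<bar>x ^ 0 * gauss a b x\<bar> \<le> C0" "\<And>x. \<bar>x ^ 2 * gauss a b x\<bar> \<le> C2" "\<And>x. \<bar>x ^ 4 * gauss a b x\<bar> \<le> C4"
    using power_gauss_bounded[OF assms] by metis
  define C where "C = C0 + 2 * C2 + C4"
  have *: "(1 + x\<^sup>2)\<^sup>2 * gauss a b x \<le> C" for x
  proof -
    have "(1 + x\<^sup>2)\<^sup>2 * gauss a b x = x ^ 0 * gauss a b x + 2 * (x ^ 2 * gauss a b x) + x ^ 4 * gauss a b x"
      by (simp add: power2_eq_square power4_eq_xxxx algebra_simps)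
    then show ?thesis
      using C[of x] unfolding C_def by linarith
  qed
  have "0 < (1 + 0\<^sup>2)\<^sup>2 * gauss a b 0"
    by (simp add: gauss_pos)
  then have "C > 0"
    using *[of 0] by linarith
  moreover have "gauss a b x \<le> C / (1 + x\<^sup>2)\<^sup>2" for x
  proof -
    have "0 < (1 + x\<^sup>2)\<^sup>2"
      by (intro zero_less_power add_pos_nonneg) auto
    from pos_le_divide_eq[OF this] show ?thesis
      using *[of x] by (simp add: mult.commute)
  qed
  ultimately show ?thesis
    by blast
qed

lemma continuous_on_fourier:
  assumes g: "integrable lborel g"
  shows "continuous_on UNIV (fourier g)"
proof (rule continuous_on_sequentiallyI)
  fix u :: "nat \<Rightarrow> real" and k assume u: "u \<longlonglongrightarrow> k"
  have [measurable]: "g \<in> borel_measurable borel"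
    using g by (simp add: borel_measurable_integrable flip: measurable_lborel2)
  show "(\<lambda>n. fourier g (u n)) \<longlonglongrightarrow> fourier g k"
    unfolding fourier_def
  proof (rule integral_dominated_convergence[where w = "\<lambda>x. norm (g x)"])
    show "AE x in lborel. (\<lambda>n. exp (- 2 * complex_of_real pi * \<i> * of_real (u n) * of_real x) * g x)
        \<longlonglongrightarrow> exp (- 2 * complex_of_real pi * \<i> * of_real k * of_real x) * g x"
      by (intro AE_I2 tendsto_intros u)
  qed (use g in \<open>auto simp: norm_mult\<close>)
qed

lemma Re_fourier_of_real:
  assumes g: "integrable lborel g"
  shows "Re (fourier (\<lambda>x. complex_of_real (g x)) k) = (LINT x|lborel. g x * cos (2 * pi * x * k))"
proof -
  have [measurable]: "g \<in> borel_measurable borel"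
    using g by (simp add: borel_measurable_integrable flip: measurable_lborel2)
  have "integrable lborel (\<lambda>x. complex_of_real (g x))"
    using g by simp
  then have "integrable lborel (\<lambda>x. exp (- 2 * complex_of_real pi * \<i> * of_real k * of_real x) * complex_of_real (g x))"
    by (rule Bochner_Integration.integrable_bound) (auto simp: norm_mult)
  then have "Re (fourier (\<lambda>x. complex_of_real (g x)) k) =
      (LINT x|lborel. Re (exp (- 2 * complex_of_real pi * \<i> * of_real k * of_real x) * complex_of_real (g x)))"
    unfolding fourier_def by (rule integral_Re[symmetric])
  also have "\<dots> = (LINT x|lborel. g x * cos (2 * pi * x * k))"
    by (simp add: Re_exp mult_ac)
  finally show ?thesis .
qed

section \<open>Poisson summation\<close>

text \<open>The pieces are centred at the integers, where the Fejer kernel concentrates, so that the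
  relevant point is \<open>v = 1 / 2\<close>, in the interior of the unit interval, as
  \<open>fejer_approximation\<close> demands.\<close>

lemma nn_integral_unfold_real_line:
  assumes [measurable]: "w \<in> borel_measurable borel"
  shows "(\<integral>\<^sup>+u. w u \<partial>lborel) = (\<integral>\<^sup>+r. \<integral>\<^sup>+v. w (of_int r + v - 1 / 2) \<partial>unit_interval \<partial>count_space UNIV)"
proof -
  define I where "I r = {of_int r - 1 / 2 ..< of_int r + 1 / 2 :: real}" for r :: int
  have [measurable]: "I r \<in> sets borel" for r
    by (simp add: I_def)
  have part: "u \<in> I r \<longleftrightarrow> r = \<lfloor>u + 1 / 2\<rfloor>" for u r
    unfolding I_def by (auto simp: floor_eq_iff intro!: floor_unique[symmetric]) linarith+
  have one: "(\<integral>\<^sup>+r. w u * indicator (I r) u \<partial>count_space UNIV) = w u" for u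
  proof -
    have "(\<integral>\<^sup>+r. w u * indicator (I r) u \<partial>count_space UNIV) =
        (\<integral>\<^sup>+r. w u * indicator {\<lfloor>u + 1 / 2\<rfloor>} r \<partial>count_space UNIV)"
      by (intro nn_integral_cong) (auto simp: indicator_def part)
    also have "\<dots> = w u"
      by (subst nn_integral_cmult_indicator) auto
    finally show ?thesis .
  qed
  have "(\<integral>\<^sup>+u. w u \<partial>lborel) = (\<integral>\<^sup>+u. \<integral>\<^sup>+r. w u * indicator (I r) u \<partial>count_space UNIV \<partial>lborel)"
    by (simp add: one)
  also have "\<dots> = (\<integral>\<^sup>+r. \<integral>\<^sup>+u. w u * indicator (I r) u \<partial>lborel \<partial>count_space UNIV)"
    by (rule nn_integral_count_space_nn_integral) auto
  also have "\<dots> = (\<integral>\<^sup>+r. \<integral>\<^sup>+v. w (of_int r + v - 1 / 2) \<partial>unit_interval \<partial>count_space UNIV)"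
  proof (rule nn_integral_cong)
    fix r :: int
    have "(\<integral>\<^sup>+u. w u * indicator (I r) u \<partial>lborel) =
        (\<integral>\<^sup>+v. w (of_int r - 1 / 2 + 1 * v) * indicator (I r) (of_int r - 1 / 2 + 1 * v) \<partial>lborel)"
      by (subst nn_integral_real_affine[where t = "of_int r - 1 / 2" and c = 1]) auto
    also have "\<dots> = (\<integral>\<^sup>+v. w (of_int r + v - 1 / 2) * indicator {0..1} v \<partial>lborel)"
    proof (rule nn_integral_cong_AE)
      \<comment> \<open>The half-open piece and the closed unit interval differ only at this
        point.\<close>
      have "AE v in lborel. v \<noteq> (1::real)"
        by (rule AE_lborel_singleton)
      then show "AE v in lborel. w (of_int r - 1 / 2 + 1 * v) * indicator (I r) (of_int r - 1 / 2 + 1 * v) =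
          w (of_int r + v - 1 / 2) * indicator {0..1} v"
        by eventually_elim (auto simp: I_def indicator_def algebra_simps)
    qed
    also have "\<dots> = (\<integral>\<^sup>+v. w (of_int r + v - 1 / 2) \<partial>unit_interval)"
      by (simp add: nn_integral_restrict_space)
    finally show "(\<integral>\<^sup>+u. w u * indicator (I r) u \<partial>lborel) = \<dots>" .
  qed
  finally show ?thesis .
qed

section \<open>The two Poisson summations\<close>

context noble_means
begin

text \<open>The average of the cosine over the two distances is the real part of a phase times
  \<open>modulated_line (k * de)\<close> at \<open>frac (l * al)\<close>. In its Fourier series
  \<open>l\<close> survives only in the angle \<open>l * (q * al - k * c)\<close>, which prepares
  the summation over \<open>l\<close>.\<close>

lemma interp_cos:
  "has_bochner_integral (count_space UNIV)
     (\<lambda>q::int. sinc2 (k * de - of_int q) * cos (2 * pi * of_int l * (of_int q * al - k * c)))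
     (interp (\<lambda>x. cos (2 * pi * k * x)) l)"
proof -
  define m where "m = \<lfloor>l * al\<rfloor>"
  define \<phi> where "\<phi> = frac (l * al)"
  have \<phi>: "\<phi> = l * al - m"
    by (simp add: \<phi>_def m_def frac_def)
  have phase1: "- (2 * pi * k * (l * c)) + 2 * pi * (k * de) * \<phi> = - (2 * pi * k * (l + m * de))"
    unfolding \<phi> c_def by (simp add: algebra_simps)
  have phase2: "- (2 * pi * k * (l + m * de)) + - 2 * pi * (k * de) = - (2 * pi * k * (l + (m + 1) * de))"
    by (simp add: algebra_simps)
  have "cis (- (2 * pi * k * (l * c))) * modulated_line (k * de) \<phi> =
      (cis (- (2 * pi * k * (l * c))) * cis (2 * pi * (k * de) * \<phi>)) *
        (of_real (1 - \<phi>) + of_real \<phi> * cis (- 2 * pi * (k * de)))"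
    by (simp only: modulated_line_def mult_ac)
  also have "cis (- (2 * pi * k * (l * c))) * cis (2 * pi * (k * de) * \<phi>) = cis (- (2 * pi * k * (l + m * de)))"
    unfolding cis_mult phase1 ..
  also have "cis (- (2 * pi * k * (l + m * de))) * (of_real (1 - \<phi>) + of_real \<phi> * cis (- 2 * pi * (k * de))) = of_real (1 - \<phi>) * cis (- (2 * pi * k * (l + m * de))) +
      of_real \<phi> * (cis (- (2 * pi * k * (l + m * de))) * cis (- 2 * pi * (k * de)))"
    by (simp add: algebra_simps)
  also have "cis (- (2 * pi * k * (l + m * de))) * cis (- 2 * pi * (k * de)) = cis (- (2 * pi * k * (l + (m + 1) * de)))"
    unfolding cis_mult phase2 ..
  finally have "Re (cis (- (2 * pi * k * (l * c))) * modulated_line (k * de) \<phi>) =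
      (1 - \<phi>) * cos (2 * pi * k * (l + m * de)) + \<phi> * cos (2 * pi * k * (l + (m + 1) * de))"
    by simp
  then have interp: "interp (\<lambda>x. cos (2 * pi * k * x)) l = Re (cis (- (2 * pi * k * (l * c))) * modulated_line (k * de) \<phi>)"
    by (simp add: interp_def m_def \<phi>_def)
  define H where "H q = cis (- (2 * pi * k * (l * c))) * (cis (2 * pi * of_int q * \<phi>) * complex_of_real (sinc2 (k * de - of_int q)))" for q :: int
  have "integrable (count_space UNIV) H"
    by (rule integrable_count_space_bound[OF integrable_sinc2[of "k * de"]])
       (simp add: H_def norm_mult sinc2_nonneg)
  moreover have "(LINT q|count_space UNIV. H q) = cis (- (2 * pi * k * (l * c))) * modulated_line (k * de) \<phi>"
    unfolding H_def \<phi>_def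
    by (subst modulated_line_series) (auto simp: frac_lt_1)
  ultimately have "has_bochner_integral (count_space UNIV) H (cis (- (2 * pi * k * (l * c))) * modulated_line (k * de) \<phi>)"
    by (simp add: has_bochner_integral_iff)
  from has_bochner_integral_bounded_linear[OF bounded_linear_Re this]
  have "has_bochner_integral (count_space UNIV) (\<lambda>q. Re (H q)) (interp (\<lambda>x. cos (2 * pi * k * x)) l)"
    by (simp add: interp)
  moreover have "Re (H q) = sinc2 (k * de - of_int q) * cos (2 * pi * of_int l * (of_int q * al - k * c))" for q
  proof -
    have "Re (H q) = sinc2 (k * de - of_int q) * cos (- (2 * pi * k * (l * c)) + 2 * pi * of_int q * \<phi>)"
      by (simp add: H_def mult.assoc[symmetric] cis_mult)
    also have "- (2 * pi * k * (l * c)) + 2 * pi * of_int q * \<phi> =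
        2 * pi * of_int l * (of_int q * al - k * c) + 2 * pi * of_int (- q * m)"
      by (simp add: \<phi> algebra_simps)
    also have "cos \<dots> = cos (2 * pi * of_int l * (of_int q * al - k * c))"
      unfolding cos_add using cos_int_2pin[of "- q * m"] sin_int_2pin[of "- q * m"] by (simp add: mult_ac)
    finally show ?thesis .
  qed
  ultimately show ?thesis
    by simp
qed

text \<open>Averaging over \<open>l\<close> replaces oscillating cosines by a kernel of constant
  sign, which makes Tonelli available for the integral over \<open>k\<close>.\<close>

lemma cesaro_interp_cos:
  "has_bochner_integral (count_space UNIV)
     (\<lambda>q::int. sinc2 (k * de - of_int q) * fejer N (of_int q * al - k * c))
     ((\<Sum>i<N. \<Sum>j<N. interp (\<lambda>x. cos (2 * pi * k * x)) (int i - int j)) / N)"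
proof -
  have "has_bochner_integral (count_space UNIV)
     (\<lambda>q::int. (\<Sum>i<N. \<Sum>j<N. sinc2 (k * de - of_int q) * cos (2 * pi * of_int (int i - int j) * (of_int q * al - k * c))) / N)
     ((\<Sum>i<N. \<Sum>j<N. interp (\<lambda>x. cos (2 * pi * k * x)) (int i - int j)) / N)"
    by (intro has_bochner_integral_divide_zero has_bochner_integral_sum interp_cos)
  moreover have "(\<Sum>i<N. \<Sum>j<N. sinc2 (k * de - of_int q) * cos (2 * pi * of_int (int i - int j) * (of_int q * al - k * c))) / N =
      sinc2 (k * de - of_int q) * fejer N (of_int q * al - k * c)" for q :: int
    by (simp add: fejer_def sum_distrib_left)
  ultimately show ?thesis
    by (simp only:)
qed

text \<open>The Bragg positions, at which \<open>q * al - k * c\<close> is an integer. Taking the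
  fractional part keeps \<open>c * k\<close> within distance 1 of \<open>r\<close>, so that
  \<open>q\<close> and \<open>r\<close> can be summed independently.\<close>

definition kappa :: "int \<times> int \<Rightarrow> real" where
  "kappa = (\<lambda>(q, r). (frac (q * al) + r) / c)"

text \<open>The summand attached to the index \<open>(q, r)\<close>, with the second index extended to real values.\<close>

definition bragg :: "real \<Rightarrow> real \<Rightarrow> int \<Rightarrow> real \<Rightarrow> real" where
  "bragg a b q u = gauss a b ((frac (q * al) + u) / c) * sinc2 ((frac (q * al) + u) / c * de - q)"

lemma bragg_nonneg: "bragg a b q u \<ge> 0"
  by (simp add: bragg_def sinc2_nonneg less_imp_le[OF gauss_pos])

lemma borel_measurable_bragg [measurable]: "bragg a b q \<in> borel_measurable borel"
  unfolding bragg_def[abs_def] by measurable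

lemma continuous_on_bragg: "continuous_on A (bragg a b q)"
proof -
  have "continuous_on UNIV (\<lambda>u. gauss a b ((frac (q * al) + u) / c) * sinc2 ((frac (q * al) + u) / c * de - q))"
    using c_pos by (intro continuous_on_mult continuous_on_compose2[OF continuous_on_gauss[of UNIV]]
      continuous_on_compose2[OF continuous_on_sinc2[of UNIV]] continuous_intros) auto
  then show ?thesis
    unfolding bragg_def[abs_def] using continuous_on_subset by blast
qed

text \<open>Peetre's inequality turns the decay of \<open>sinc2\<close> in \<open>k * de - q\<close>
  into decay in \<open>q\<close> and loses a factor \<open>1 + k^2\<close>. The Gaussian restores it
  and provides another such factor, comparable to \<open>1 + r^2\<close> because
  \<open>c * k\<close> stays close to \<open>r\<close>.\<close>

lemma bragg_bound:
  assumes "a > 0"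
  shows "\<exists>C. \<forall>q r v. 0 \<le> v \<longrightarrow> v \<le> 1 \<longrightarrow>
    bragg a b q (of_int r + v - 1 / 2) \<le> C * (1 / (1 + (of_int q)\<^sup>2) * (1 / (1 + (of_int r)\<^sup>2)))"
proof -
  obtain C1 where C1: "C1 > 0" "\<And>x. gauss a b x \<le> C1 / (1 + x\<^sup>2)\<^sup>2"
    using gauss_le_inverse_power4[OF assms] by blast
  define D where "D = 1 + de\<^sup>2"
  \<comment> \<open>From \<open>r = c * k + e\<close> with \<open>e\<close> at most 3/2 in absolute
    value one gets \<open>1 + r^2 <= 11 / 2 + 2 * c^2 * k^2\<close>.\<close>
  define E where "E = 2 * c\<^sup>2 + 6"
  have D: "D > 0" and E: "E > 0"
    by (auto simp: D_def E_def intro: add_pos_nonneg add_nonneg_pos)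
  have "bragg a b q (of_int r + v - 1 / 2) \<le> C1 * 4 * D * E * (1 / (1 + (of_int q)\<^sup>2) * (1 / (1 + (of_int r)\<^sup>2)))"
    if v: "0 \<le> v" "v \<le> 1" for q r v
  proof -
    define \<phi> where "\<phi> = frac (q * al)"
    define k where "k = (\<phi> + (of_int r + v - 1 / 2)) / c"
    have \<phi>: "0 \<le> \<phi>" "\<phi> < 1"
      by (auto simp: \<phi>_def frac_lt_1)
    define Q where "Q = 1 + (real_of_int q)\<^sup>2"
    define R where "R = 1 + (real_of_int r)\<^sup>2"
    define X where "X = 1 + k\<^sup>2"
    have pos: "Q > 0" "R > 0" "X > 0"
      by (auto simp: Q_def R_def X_def intro: add_pos_nonneg)
    have "sinc2 (k * de - q) \<le> 2 * (1 / (1 + (k * de - q)\<^sup>2))"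
      using sinc2_bound[of "k * de - q"] by simp
    also have "\<dots> \<le> 2 * (2 * (1 + (k * de)\<^sup>2) * (1 / Q))"
      unfolding Q_def by (intro mult_left_mono inverse_square_shift) auto
    also have "\<dots> \<le> 2 * (2 * (D * X) * (1 / Q))"
      using pos by (intro mult_left_mono mult_right_mono) (auto simp: D_def X_def power_mult_distrib algebra_simps)
    finally have s: "sinc2 (k * de - q) \<le> 4 * D * X * (1 / Q)"
      by simp
    have rX: "R \<le> E * X"
    proof -
      define e where "e = 1 / 2 - \<phi> - v"
      have "\<bar>e\<bar> \<le> 3 / 2"
        using \<phi> v unfolding e_def by linarith
      then have "\<bar>e\<bar>\<^sup>2 \<le> (3 / 2)\<^sup>2"
        by (rule power_mono) simp
      moreover have "of_int r = c * k + e"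
        using c_pos by (simp add: k_def e_def)
      moreover have "(c * k + e)\<^sup>2 \<le> 2 * (c * k)\<^sup>2 + 2 * e\<^sup>2"
        using zero_le_power2[of "c * k - e"] by (simp add: power2_eq_square algebra_simps)
      ultimately have "R \<le> 1 + 2 * c\<^sup>2 * k\<^sup>2 + 9 / 2"
        by (simp add: R_def power_mult_distrib power2_abs power_divide)
      also have "\<dots> \<le> E * X"
        by (simp add: E_def X_def algebra_simps)
      finally show ?thesis .
    qed
    have "bragg a b q (of_int r + v - 1 / 2) = gauss a b k * sinc2 (k * de - q)"
      by (simp add: bragg_def k_def \<phi>_def)
    also have "\<dots> \<le> (C1 / X\<^sup>2) * (4 * D * X * (1 / Q))"
      using s C1(2)[of k] C1(1) pos by (intro mult_mono) (auto simp: X_def sinc2_nonneg)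
    also have "\<dots> = C1 * 4 * D * (1 / Q) * (1 / X)"
      using pos by (simp add: power2_eq_square mult_ac)
    also have "\<dots> \<le> C1 * 4 * D * (1 / Q) * (E * (1 / R))"
      using pos D C1(1) rX by (intro mult_left_mono) (auto simp: divide_simps mult.commute)
    finally show ?thesis
      by (simp add: Q_def R_def mult_ac)
  qed
  then show ?thesis
    by blast
qed

lemma integrable_inverse_square_product:
  "integrable (count_space UNIV) (\<lambda>(q::int, r::int). 1 / (1 + (of_int q)\<^sup>2) * (1 / (1 + (of_int r)\<^sup>2)) :: real)"
proof (rule integrableI_nonneg)
  let ?f = "\<lambda>q::int. 1 / (1 + (of_int q)\<^sup>2) :: real"
  have fin: "(\<integral>\<^sup>+q. ennreal (?f q) \<partial>count_space UNIV) = ennreal (LINT q|count_space UNIV. ?f q)"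
    by (intro nn_integral_eq_integral integrable_count_space_inverse_square) auto
  have "(\<integral>\<^sup>+x. ennreal (case x of (q, r) \<Rightarrow> ?f q * ?f r) \<partial>count_space UNIV) =
      (\<integral>\<^sup>+q. \<integral>\<^sup>+r. ennreal (?f q) * ennreal (?f r) \<partial>count_space UNIV \<partial>count_space UNIV)"
    by (subst nn_integral_fst_count_space[symmetric]) (simp add: ennreal_mult[symmetric])
  also have "\<dots> = (\<integral>\<^sup>+q. ennreal (?f q) \<partial>count_space UNIV) * (\<integral>\<^sup>+r. ennreal (?f r) \<partial>count_space UNIV)"
    by (simp add: nn_integral_cmult nn_integral_multc)
  also have "\<dots> < \<infinity>"
    unfolding fin by (simp add: ennreal_mult_less_top)
  finally show "(\<integral>\<^sup>+x. ennreal (case x of (q, r) \<Rightarrow> ?f q * ?f r) \<partial>count_space UNIV) < \<infinity>" .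
qed auto

lemma integrable_bragg:
  assumes "a > 0" "0 \<le> v" "v \<le> 1"
  shows "integrable (count_space UNIV) (\<lambda>(q, r). bragg a b q (of_int r + v - 1 / 2))"
proof -
  obtain C where C: "\<forall>q r v. 0 \<le> v \<longrightarrow> v \<le> 1 \<longrightarrow>
      bragg a b q (of_int r + v - 1 / 2) \<le> C * (1 / (1 + (of_int q)\<^sup>2) * (1 / (1 + (of_int r)\<^sup>2)))"
    using bragg_bound[OF assms(1)] by blast
  show ?thesis
  proof (rule integrable_count_space_bound[OF integrable_mult_right[OF integrable_inverse_square_product]])
    show "norm (case x of (q, r) \<Rightarrow> bragg a b q (of_int r + v - 1 / 2)) \<le>
        C * (case x of (q, r) \<Rightarrow> 1 / (1 + (of_int q)\<^sup>2) * (1 / (1 + (of_int r)\<^sup>2)))" for x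
      using C assms(2,3) by (cases x) (simp only: prod.case real_norm_def abs_of_nonneg[OF bragg_nonneg])
  qed
qed

text \<open>The sum over the Fourier module translated by \<open>(v - 1 / 2) / c\<close>; the value
  at \<open>1 / 2\<close> belongs to the module itself.\<close>

definition bragg_sum :: "real \<Rightarrow> real \<Rightarrow> real \<Rightarrow> real" where
  "bragg_sum a b v = (LINT (q, r)|count_space UNIV. bragg a b q (of_int r + v - 1 / 2))"

lemma bragg_sum_nonneg: "bragg_sum a b v \<ge> 0"
  unfolding bragg_sum_def by (rule integral_nonneg_AE) (auto simp: bragg_nonneg)

lemma continuous_on_bragg_sum:
  assumes "a > 0"
  shows "continuous_on {0..1} (bragg_sum a b)"
proof (rule continuous_on_sequentiallyI)
  fix u :: "nat \<Rightarrow> real" and v assume u01: "\<forall>n. u n \<in> {0..1}" and u: "u \<longlonglongrightarrow> v"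
  obtain C where C: "\<forall>q r v. 0 \<le> v \<longrightarrow> v \<le> 1 \<longrightarrow>
      bragg a b q (of_int r + v - 1 / 2) \<le> C * (1 / (1 + (of_int q)\<^sup>2) * (1 / (1 + (of_int r)\<^sup>2)))"
    using bragg_bound[OF assms(1)] by blast
  show "(\<lambda>n. bragg_sum a b (u n)) \<longlonglongrightarrow> bragg_sum a b v"
    unfolding bragg_sum_def
  proof (rule integral_dominated_convergence)
    show "integrable (count_space UNIV) (\<lambda>x. C * (case x of (q::int, r::int) \<Rightarrow> 1 / (1 + (of_int q)\<^sup>2) * (1 / (1 + (of_int r)\<^sup>2))))"
      by (rule integrable_mult_right[OF integrable_inverse_square_product])
    show "AE x in count_space UNIV. norm (case x of (q, r) \<Rightarrow> bragg a b q (of_int r + u n - 1 / 2)) \<le>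
        C * (case x of (q, r) \<Rightarrow> 1 / (1 + (of_int q)\<^sup>2) * (1 / (1 + (of_int r)\<^sup>2)))" for n
    proof (rule AE_I2)
      fix x :: "int \<times> int"
      show "norm (case x of (q, r) \<Rightarrow> bragg a b q (of_int r + u n - 1 / 2)) \<le>
        C * (case x of (q, r) \<Rightarrow> 1 / (1 + (of_int q)\<^sup>2) * (1 / (1 + (of_int r)\<^sup>2)))"
        using C u01 by (cases x) (auto simp: bragg_nonneg)
    qed
    show "AE x in count_space UNIV. (\<lambda>n. case x of (q, r) \<Rightarrow> bragg a b q (of_int r + u n - 1 / 2))
        \<longlonglongrightarrow> (case x of (q, r) \<Rightarrow> bragg a b q (of_int r + v - 1 / 2))"
    proof (rule AE_I2)
      fix x :: "int \<times> int"
      obtain q r where x: "x = (q, r)"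
        by (cases x)
      have "isCont (bragg a b q) (of_int r + v - 1 / 2)"
        using continuous_on_bragg[of UNIV a b q] by (simp add: continuous_on_eq_continuous_at)
      then have "(\<lambda>n. bragg a b q (of_int r + u n - 1 / 2)) \<longlonglongrightarrow> bragg a b q (of_int r + v - 1 / 2)"
        by (rule isCont_tendsto_compose) (intro tendsto_intros u)
      then show "(\<lambda>n. case x of (q, r) \<Rightarrow> bragg a b q (of_int r + u n - 1 / 2))
        \<longlonglongrightarrow> (case x of (q, r) \<Rightarrow> bragg a b q (of_int r + v - 1 / 2))"
        by (simp add: x)
    qed
  qed auto
qed

lemma abs_interp_cos_le: "\<bar>interp (\<lambda>x. cos (2 * pi * k * x)) l\<bar> \<le> 1"
proof -
  let ?\<phi> = "frac (l * al)"
  have \<phi>: "0 \<le> ?\<phi>" "?\<phi> < 1"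
    by (auto simp: frac_lt_1)
  have "\<bar>t * cos x\<bar> \<le> t" if "t \<ge> 0" for t x :: real
    using mult_left_mono[of "\<bar>cos x\<bar>" 1 t] that by (simp add: abs_mult)
  then have "\<bar>interp (\<lambda>x. cos (2 * pi * k * x)) l\<bar> \<le> (1 - ?\<phi>) + ?\<phi>"
    unfolding interp_def using \<phi> by (intro order_trans[OF abs_triangle_ineq] add_mono) auto
  then show ?thesis
    by simp
qed

lemma borel_measurable_interp_cos [measurable]:
  "(\<lambda>k. interp (\<lambda>x. cos (2 * pi * k * x)) l) \<in> borel_measurable borel"
  unfolding interp_def by measurable

text \<open>For each \<open>q\<close> the line is rescaled so that the kernel depends on
  \<open>u\<close> alone and is then cut at half-integers. By periodicity the kernel is the same on
  every piece, so it factors out of the double sum over \<open>q\<close> and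
  \<open>r\<close>.\<close>

lemma integral_gauss_cesaro:
  assumes a: "a > 0" and N: "N > 0"
  shows "(LINT k|lborel. gauss a b k * ((\<Sum>i<N. \<Sum>j<N. interp (\<lambda>x. cos (2 * pi * k * x)) (int i - int j)) / N)) =
    1 / c * (LINT v|unit_interval. fejer N (v - 1 / 2) * bragg_sum a b v)"
proof -
  define B where "B k = (\<Sum>i<N. \<Sum>j<N. interp (\<lambda>x. cos (2 * pi * k * x)) (int i - int j)) / N" for k
  have [measurable]: "B \<in> borel_measurable borel"
    unfolding B_def by measurable
  have B: "has_bochner_integral (count_space UNIV) (\<lambda>q::int. sinc2 (k * de - of_int q) * fejer N (of_int q * al - k * c)) (B k)" for k
    unfolding B_def by (rule cesaro_interp_cos)
  have B_nonneg: "B k \<ge> 0" for k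
    unfolding has_bochner_integral_integral_eq[OF B[of k], symmetric]
    by (rule integral_nonneg_AE) (auto simp: sinc2_nonneg fejer_nonneg)
  have S_meas: "bragg_sum a b \<in> borel_measurable unit_interval"
    using borel_measurable_continuous_on_restrict[OF continuous_on_bragg_sum[OF a]]
    by (simp add: measurable_def sets_restrict_space space_restrict_space)
  define P where "P q k = gauss a b k * (sinc2 (k * de - of_int q) * fejer N (of_int q * al - k * c))" for q :: int and k
  have P_meas [measurable]: "P q \<in> borel_measurable borel" for q
    unfolding P_def by measurable
  have step1: "ennreal (gauss a b k * B k) = (\<integral>\<^sup>+q. ennreal (P q k) \<partial>count_space UNIV)" for k
  proof -
    have "has_bochner_integral (count_space UNIV) (\<lambda>q. P q k) (gauss a b k * B k)"
      unfolding P_def by (rule has_bochner_integral_mult_right[OF B])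
    moreover have "AE q in count_space UNIV. 0 \<le> P q k"
      by (auto simp: P_def sinc2_nonneg fejer_nonneg less_imp_le[OF gauss_pos])
    ultimately show ?thesis
      by (simp add: has_bochner_integral_iff nn_integral_eq_integral)
  qed
  have step2: "(\<integral>\<^sup>+k. ennreal (P q k) \<partial>lborel) =
      ennreal (1 / c) * (\<integral>\<^sup>+r. \<integral>\<^sup>+v. ennreal (bragg a b q (of_int r + v - 1 / 2) * fejer N (v - 1 / 2)) \<partial>unit_interval \<partial>count_space UNIV)" for q
  proof -
    define \<phi> where "\<phi> = frac (q * al)"
    \<comment> \<open>The substitution \<open>k = (frac (q * al) + u) / c\<close> turns the angle
      into \<open>- u\<close> plus an integer; its Jacobian is the factor
      \<open>1 / c\<close>.\<close>
    have P_affine: "P q (\<phi> / c + 1 / c * u) = bragg a b q u * fejer N u" for u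
    proof -
      have "\<phi> / c + 1 / c * u = (\<phi> + u) / c"
        by (simp add: add_divide_distrib)
      moreover have "of_int q * al - (\<phi> + u) / c * c = - u + of_int \<lfloor>q * al\<rfloor>"
        using c_pos by (simp add: \<phi>_def frac_def)
      ultimately show ?thesis
        by (simp only: P_def bragg_def \<phi>_def[symmetric] fejer_add_int fejer_minus mult.assoc)
    qed
    have fejer_shift: "fejer N (of_int r + v - 1 / 2) = fejer N (v - 1 / 2)" for r :: int and v
      using fejer_add_int[of N "v - 1 / 2" r] by (simp add: algebra_simps)
    have "(\<integral>\<^sup>+k. ennreal (P q k) \<partial>lborel) = ennreal \<bar>1 / c\<bar> * (\<integral>\<^sup>+u. ennreal (bragg a b q u * fejer N u) \<partial>lborel)"
      unfolding P_affine[symmetric] using c_pos by (intro nn_integral_real_affine) auto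
    also have "(\<integral>\<^sup>+u. ennreal (bragg a b q u * fejer N u) \<partial>lborel) =
        (\<integral>\<^sup>+r. \<integral>\<^sup>+v. ennreal (bragg a b q (of_int r + v - 1 / 2) * fejer N (of_int r + v - 1 / 2)) \<partial>unit_interval \<partial>count_space UNIV)"
      by (rule nn_integral_unfold_real_line) measurable
    finally show ?thesis
      using c_pos by (simp add: fejer_shift)
  qed
  define X where "X x v = ennreal ((case x of (q, r) \<Rightarrow> bragg a b q (of_int r + v - 1 / 2)) * fejer N (v - 1 / 2))" for x :: "int \<times> int" and v
  have X_meas: "X x \<in> borel_measurable unit_interval" for x
  proof (rule measurable_restrict_space1)
    show "X x \<in> borel_measurable lborel"
      unfolding X_def by (cases x) (simp, measurable)
  qed
  have step3: "(\<integral>\<^sup>+x. X x v \<partial>count_space UNIV) = ennreal (fejer N (v - 1 / 2) * bragg_sum a b v)"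
    if "0 \<le> v" "v \<le> 1" for v
  proof -
    have hbi: "has_bochner_integral (count_space UNIV) (\<lambda>x. (case x of (q, r) \<Rightarrow> bragg a b q (of_int r + v - 1 / 2)) * fejer N (v - 1 / 2))
        (bragg_sum a b v * fejer N (v - 1 / 2))"
      unfolding bragg_sum_def
      by (intro has_bochner_integral_mult_left has_bochner_integral_integrable integrable_bragg a that)
    have nonneg: "AE x in count_space UNIV. 0 \<le> (case x of (q, r) \<Rightarrow> bragg a b q (of_int r + v - 1 / 2)) * fejer N (v - 1 / 2)"
      by (auto simp: bragg_nonneg fejer_nonneg)
    show ?thesis
      using nn_integral_eq_integral[OF has_bochner_integral_iff[THEN iffD1, THEN conjunct1, OF hbi] nonneg]
      unfolding X_def has_bochner_integral_integral_eq[OF hbi] by (simp add: mult.commute)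
  qed
  have "(\<integral>\<^sup>+k. ennreal (gauss a b k * B k) \<partial>lborel) = (\<integral>\<^sup>+q. \<integral>\<^sup>+k. ennreal (P q k) \<partial>lborel \<partial>count_space UNIV)"
    unfolding step1 by (rule nn_integral_count_space_nn_integral) auto
  also have "\<dots> = ennreal (1 / c) * (\<integral>\<^sup>+q. \<integral>\<^sup>+r. \<integral>\<^sup>+v. X (q, r) v \<partial>unit_interval \<partial>count_space UNIV \<partial>count_space UNIV)"
    unfolding step2 X_def by (simp add: nn_integral_cmult)
  also have "(\<integral>\<^sup>+q. \<integral>\<^sup>+r. \<integral>\<^sup>+v. X (q, r) v \<partial>unit_interval \<partial>count_space UNIV \<partial>count_space UNIV) =
      (\<integral>\<^sup>+x. \<integral>\<^sup>+v. X x v \<partial>unit_interval \<partial>count_space UNIV)"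
    by (rule nn_integral_fst_count_space)
  also have "\<dots> = (\<integral>\<^sup>+v. \<integral>\<^sup>+x. X x v \<partial>count_space UNIV \<partial>unit_interval)"
    by (rule nn_integral_count_space_nn_integral[symmetric]) (use X_meas in auto)
  also have "\<dots> = (\<integral>\<^sup>+v. ennreal (fejer N (v - 1 / 2) * bragg_sum a b v) \<partial>unit_interval)"
    by (rule nn_integral_cong) (simp add: space_restrict_space step3)
  finally have main: "(\<integral>\<^sup>+k. ennreal (gauss a b k * B k) \<partial>lborel) =
      ennreal (1 / c) * (\<integral>\<^sup>+v. ennreal (fejer N (v - 1 / 2) * bragg_sum a b v) \<partial>unit_interval)" .
  have "(LINT k|lborel. gauss a b k * B k) = enn2real (\<integral>\<^sup>+k. ennreal (gauss a b k * B k) \<partial>lborel)"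
    by (rule integral_eq_nn_integral) (auto simp: B_nonneg less_imp_le[OF gauss_pos])
  also have "\<dots> = 1 / c * enn2real (\<integral>\<^sup>+v. ennreal (fejer N (v - 1 / 2) * bragg_sum a b v) \<partial>unit_interval)"
    using c_pos by (simp add: main enn2real_mult)
  also have "enn2real (\<integral>\<^sup>+v. ennreal (fejer N (v - 1 / 2) * bragg_sum a b v) \<partial>unit_interval) =
      (LINT v|unit_interval. fejer N (v - 1 / 2) * bragg_sum a b v)"
  proof (rule integral_eq_nn_integral[symmetric])
    have "(\<lambda>v. fejer N (v - 1 / 2)) \<in> borel_measurable unit_interval"
      by (rule measurable_restrict_space1) measurable
    then show "(\<lambda>v. fejer N (v - 1 / 2) * bragg_sum a b v) \<in> borel_measurable unit_interval"
      using S_meas by (rule borel_measurable_times)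
  qed (simp add: fejer_nonneg bragg_sum_nonneg)
  finally show ?thesis
    unfolding B_def .
qed

lemma integral_gauss_cesaro_limit:
  assumes a: "a > 0"
  shows "(\<lambda>N. LINT k|lborel. gauss a b k * ((\<Sum>i<N. \<Sum>j<N. interp (\<lambda>x. cos (2 * pi * k * x)) (int i - int j)) / N))
    \<longlonglongrightarrow> 1 / c * bragg_sum a b (1 / 2)"
proof -
  \<comment> \<open>\<open>bragg_sum\<close> is controlled on the unit interval only; clamping the
    argument extends it continuously to the whole line.\<close>
  define f where "f v = bragg_sum a b (max 0 (min 1 v))" for v
  have f_eq: "f v = bragg_sum a b v" if "0 \<le> v" "v \<le> 1" for v
    using that by (simp add: f_def)
  have f_cont: "continuous_on UNIV f"
    unfolding f_def
    by (rule continuous_on_compose2[OF continuous_on_bragg_sum[OF a]]) (auto intro!: continuous_intros)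
  have "bounded (f ` {0..1})"
    using f_cont by (intro compact_imp_bounded compact_continuous_image) (auto intro: continuous_on_subset)
  then obtain K where "\<forall>y\<in>f ` {0..1}. norm y \<le> K"
    unfolding bounded_iff by blast
  then have K: "norm (f v) \<le> K" if "0 \<le> v" "v \<le> 1" for v
    using that by auto
  have "(\<lambda>N. LINT v|unit_interval. fejer N (v - 1 / 2) *\<^sub>R f v) \<longlonglongrightarrow> f (1 / 2)"
    using f_cont K by (intro fejer_approximation[where B = K])
      (auto simp: continuous_on_eq_continuous_at intro!: borel_measurable_continuous_onI)
  moreover have "(LINT v|unit_interval. fejer N (v - 1 / 2) *\<^sub>R f v) = (LINT v|unit_interval. fejer N (v - 1 / 2) * bragg_sum a b v)" for N
    by (rule Bochner_Integration.integral_cong) (auto simp: space_restrict_space f_eq)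
  ultimately have "(\<lambda>N. 1 / c * (LINT v|unit_interval. fejer N (v - 1 / 2) * bragg_sum a b v)) \<longlonglongrightarrow> 1 / c * bragg_sum a b (1 / 2)"
    by (intro tendsto_mult_left) (simp add: f_eq)
  then show ?thesis
    by (rule Lim_transform_eventually)
       (rule eventually_mono[OF eventually_gt_at_top[of 0]], rule integral_gauss_cesaro[OF a, symmetric])
qed

end

section \<open>The intensities\<close>

context noble_means
begin

text \<open>The intensity of the Bragg peak at \<open>kappa x\<close>. At the origin it is
  \<open>1 / c\<^sup>2\<close>, the square of the point density.\<close>

definition weight :: "int \<times> int \<Rightarrow> real" where
  "weight x = sinc2 (kappa x * de - of_int (fst x)) / c\<^sup>2"

lemma weight_nonneg: "weight x \<ge> 0"
  by (simp add: weight_def sinc2_nonneg)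

lemma bragg_kappa: "(case x of (q, r) \<Rightarrow> bragg a b q (of_int r + 1 / 2 - 1 / 2)) = c\<^sup>2 * (gauss a b (kappa x) * weight x)"
  using c_pos by (cases x) (simp add: bragg_def kappa_def weight_def)

lemma integrable_gauss_weight:
  assumes "a > 0"
  shows "integrable (count_space UNIV) (\<lambda>x. gauss a b (kappa x) * weight x)"
  using integrable_bragg[OF assms, of "1 / 2" b] c_pos unfolding bragg_kappa by simp

lemma bragg_sum_kappa: "bragg_sum a b (1 / 2) = c\<^sup>2 * (LINT x|count_space UNIV. gauss a b (kappa x) * weight x)"
  unfolding bragg_sum_def bragg_kappa by simp

text \<open>Guarantees that an atom of the diffraction measure carries a single weight instead of a
  sum of several.\<close>

lemma inj_kappa: "inj kappa"
proof (rule injI)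
  fix x y assume eq: "kappa x = kappa y"
  obtain q r q' r' where x: "x = (q, r)" and y: "y = (q', r')"
    by (cases x; cases y) auto
  have "frac (q * al) + r = frac (q' * al) + r'"
    using eq c_pos by (simp add: x y kappa_def)
  then have "of_int (q - q') * al = of_int (r' - r + \<lfloor>q * al\<rfloor> - \<lfloor>q' * al\<rfloor>)"
    by (simp add: frac_def algebra_simps)
  then have "q = q'"
    using al_int_multiple by fastforce
  then show "x = y"
    using \<open>frac (q * al) + r = frac (q' * al) + r'\<close> by (simp add: x y)
qed

end

section \<open>The diffraction measure on Gaussians and its atoms\<close>

context noble_means_tiling_locale
begin

text \<open>The Cesaro means of \<open>interp F\<close>, with \<open>F\<close> the transform of the
  Gaussian, have two limits: \<open>c\<close> times the integral against the diffraction measure, by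
  absolute summability, and the sum over the module divided by \<open>c\<close>, by Poisson
  summation.\<close>

lemma integral_gauss_diffraction:
  assumes \<gamma>: "is_autocorrelation (left_endpoints T) \<gamma>" and \<mu>: "is_fourier_transform \<gamma> \<mu>"
    and a: "a > 0"
  shows "integrable \<mu> (gauss a b)"
    and "(LINT k|\<mu>. gauss a b k) = (LINT x|count_space UNIV. gauss a b (kappa x) * weight x)"
proof -
  let ?g = "\<lambda>x. complex_of_real (gauss a b x)"
  have g: "integrable \<mu> ?g" "integrable \<gamma> (fourier ?g)" "(LINT k|\<mu>. ?g k) = (LINT x|\<gamma>. fourier ?g x)"
    using \<mu> schwartz_gauss[OF a, of b] unfolding is_fourier_transform_def by blast+
  show "integrable \<mu> (gauss a b)"
    using integrable_Re[OF g(1)] by simp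
  \<comment> \<open>The autocorrelation is tested on real functions. Passing to the real part loses
    nothing, because the integral of the Gaussian against the diffraction measure is real.\<close>
  define F where "F x = Re (fourier ?g x)" for x
  have F_eq: "F x = (LINT k|lborel. gauss a b k * cos (2 * pi * k * x))" for x
    unfolding F_def by (rule Re_fourier_of_real[OF integrable_gauss[OF a]])
  have F_cont: "continuous_on UNIV F"
    unfolding F_def using integrable_gauss[OF a]
    by (intro continuous_intros continuous_on_fourier) simp
  have F_int: "integrable \<gamma> F"
    unfolding F_def by (rule integrable_Re[OF g(2)])
  have "(LINT u|\<gamma>. F u) = Re (LINT k|\<mu>. ?g k)"
    unfolding F_def g(3) by (rule integral_Re[OF g(2)])
  also have "\<dots> = (LINT k|\<mu>. gauss a b k)"
    by (simp flip: integral_Re[OF g(1)])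
  finally have hbi: "has_bochner_integral (count_space UNIV) (interp F) (c * (LINT k|\<mu>. gauss a b k))"
    using interp_integrable[OF \<gamma> F_cont F_int] by simp
  have cos_int: "integrable lborel (\<lambda>k. gauss a b k * cos (2 * pi * k * x))" for x
    using integrable_gauss[OF a, of b]
    by (rule Bochner_Integration.integrable_bound) (auto simp: abs_mult intro!: mult_left_le)
  have interp_F: "interp F l = (LINT k|lborel. gauss a b k * interp (\<lambda>x. cos (2 * pi * k * x)) l)" for l
  proof -
    let ?u = "l + \<lfloor>l * al\<rfloor> * de" and ?v = "l + (\<lfloor>l * al\<rfloor> + 1) * de" and ?\<phi> = "frac (l * al)"
    have "gauss a b k * interp (\<lambda>x. cos (2 * pi * k * x)) l =
        (1 - ?\<phi>) * (gauss a b k * cos (2 * pi * k * ?u)) + ?\<phi> * (gauss a b k * cos (2 * pi * k * ?v))" for k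
      unfolding interp_def by (simp only: distrib_left mult.left_commute)
    then show ?thesis
      by (simp only: Bochner_Integration.integral_add[OF integrable_mult_right[OF cos_int] integrable_mult_right[OF cos_int]]
          integral_mult_right_zero interp_def F_eq)
  qed
  have interp_int: "integrable lborel (\<lambda>k. gauss a b k * interp (\<lambda>x. cos (2 * pi * k * x)) l)" for l
    using integrable_gauss[OF a, of b]
    by (rule Bochner_Integration.integrable_bound) (auto simp: abs_mult abs_interp_cos_le intro!: mult_left_le)
  have "(\<Sum>i<N. \<Sum>j<N. interp F (int i - int j)) /\<^sub>R real N =
    (LINT k|lborel. gauss a b k * ((\<Sum>i<N. \<Sum>j<N. interp (\<lambda>x. cos (2 * pi * k * x)) (int i - int j)) / N))" for N
  proof -
    have "(\<Sum>i<N. \<Sum>j<N. interp F (int i - int j)) = (LINT k|lborel. (\<Sum>i<N. \<Sum>j<N. gauss a b k * interp (\<lambda>x. cos (2 * pi * k * x)) (int i - int j)))"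
      unfolding interp_F using interp_int
      by (simp add: Bochner_Integration.integral_sum Bochner_Integration.integrable_sum)
    note sum_eq = this
    have distrib: "gauss a b k * ((\<Sum>i<N. \<Sum>j<N. interp (\<lambda>x. cos (2 * pi * k * x)) (int i - int j)) / N) =
        (\<Sum>i<N. \<Sum>j<N. gauss a b k * interp (\<lambda>x. cos (2 * pi * k * x)) (int i - int j)) / N" for k
      by (simp add: sum_distrib_left)
    show ?thesis
      unfolding distrib integral_divide_zero sum_eq real_scaleR_def by (simp add: divide_inverse_commute)
  qed
  with integral_gauss_cesaro_limit[OF a, of b]
  have "(\<lambda>N. (\<Sum>i<N. \<Sum>j<N. interp F (int i - int j)) /\<^sub>R real N) \<longlonglongrightarrow> 1 / c * bragg_sum a b (1 / 2)"
    by simp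
  moreover have "(\<lambda>N. (\<Sum>i<N. \<Sum>j<N. interp F (int i - int j)) /\<^sub>R real N) \<longlonglongrightarrow> c * (LINT k|\<mu>. gauss a b k)"
    using cesaro_differences[of "interp F"] hbi by (simp add: has_bochner_integral_iff)
  ultimately have "c * (LINT k|\<mu>. gauss a b k) = 1 / c * bragg_sum a b (1 / 2)"
    using LIMSEQ_unique by blast
  also have "\<dots> = c * (LINT x|count_space UNIV. gauss a b (kappa x) * weight x)"
    using c_pos by (simp add: bragg_sum_kappa power2_eq_square)
  finally show "(LINT k|\<mu>. gauss a b k) = (LINT x|count_space UNIV. gauss a b (kappa x) * weight x)"
    using c_pos by simp
qed

text \<open>The functions \<open>exp (- n * (k - b)^2)\<close> decrease to the indicator of the
  point \<open>b\<close>, and the first of them dominates on both sides of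
  \<open>integral_gauss_diffraction\<close>.\<close>

lemma emeasure_atom:
  assumes \<gamma>: "is_autocorrelation (left_endpoints T) \<gamma>" and \<mu>: "is_fourier_transform \<gamma> \<mu>"
  shows "emeasure \<mu> {kappa x0} = ennreal (weight x0)"
proof -
  have sets [measurable_cong]: "sets \<mu> = sets borel"
    and finite: "emeasure \<mu> {kappa x0} < \<infinity>"
    using \<mu> by (auto simp: is_fourier_transform_def radon_measure_def)
  have mono: "gauss (real (Suc n)) b k \<le> gauss 1 b k" for n b k
  proof -
    have "1 * (k - b)\<^sup>2 \<le> real (Suc n) * (k - b)\<^sup>2"
      by (intro mult_right_mono) auto
    then show ?thesis
      unfolding gauss_def by (simp only: exp_le_cancel_iff mult_minus_left neg_le_iff_le)
  qed
  have lim: "(\<lambda>n. gauss (real (Suc n)) b k) \<longlonglongrightarrow> indicator {b} k" for b k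
  proof (cases "k = b")
    case True
    then show ?thesis
      by (simp add: gauss_def)
  next
    case False
    then have "exp (- (k - b)\<^sup>2) < 1"
      by simp
    then have "(\<lambda>n. exp (- (k - b)\<^sup>2) ^ n) \<longlonglongrightarrow> 0"
      by (intro LIMSEQ_realpow_zero) auto
    then have "(\<lambda>n. exp (- (k - b)\<^sup>2) ^ Suc n) \<longlonglongrightarrow> 0"
      by (rule LIMSEQ_Suc)
    moreover have "exp (- (k - b)\<^sup>2) ^ n = gauss (real n) b k" for n
      by (simp add: gauss_def flip: exp_of_nat_mult)
    ultimately show ?thesis
      using False by (simp del: power_Suc of_nat_Suc)
  qed
  let ?b = "kappa x0"
  have "(\<lambda>n. LINT k|\<mu>. gauss (real (Suc n)) ?b k) \<longlonglongrightarrow> (LINT k|\<mu>. indicator {?b} k)"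
  proof (rule integral_dominated_convergence[where w = "gauss 1 ?b"])
    show "integrable \<mu> (gauss 1 ?b)"
      by (rule integral_gauss_diffraction(1)[OF \<gamma> \<mu>]) simp
  qed (use mono lim in \<open>auto simp: less_imp_le[OF gauss_pos] simp del: of_nat_Suc\<close>)
  moreover have "(\<lambda>n. LINT x|count_space UNIV. gauss (real (Suc n)) ?b (kappa x) * weight x) \<longlonglongrightarrow>
      (LINT x|count_space UNIV. indicator {x0} x * weight x)"
  proof (rule integral_dominated_convergence[where w = "\<lambda>x. gauss 1 ?b (kappa x) * weight x"])
    show "integrable (count_space UNIV) (\<lambda>x. gauss 1 ?b (kappa x) * weight x)"
      by (rule integrable_gauss_weight) simp
    show "AE x in count_space UNIV. (\<lambda>n. gauss (real (Suc n)) ?b (kappa x) * weight x) \<longlonglongrightarrow> indicator {x0} x * weight x"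
    proof (rule AE_I2)
      fix x
      have "indicator {?b} (kappa x) = (indicator {x0} x :: real)"
        using inj_kappa by (auto simp: indicator_def inj_eq)
      with lim[of ?b "kappa x"] show "(\<lambda>n. gauss (real (Suc n)) ?b (kappa x) * weight x) \<longlonglongrightarrow> indicator {x0} x * weight x"
        by (intro tendsto_mult) auto
    qed
  qed (use mono in \<open>auto simp: abs_mult less_imp_le[OF gauss_pos] weight_nonneg intro!: mult_right_mono simp del: of_nat_Suc\<close>)
  ultimately have "(LINT k|\<mu>. indicator {?b} k) = (LINT x|count_space UNIV. indicator {x0} x * weight x)"
    using integral_gauss_diffraction(2)[OF \<gamma> \<mu>] LIMSEQ_unique by (simp del: of_nat_Suc)
  also have "\<dots> = weight x0"
    by (subst integral_count_space_support[of "{x0}"]) auto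
  finally have "measure \<mu> {?b} = weight x0"
    by simp
  then show ?thesis
    using finite by (simp add: emeasure_eq_ennreal_measure less_top)
qed

lemma nn_integral_atoms:
  assumes \<gamma>: "is_autocorrelation (left_endpoints T) \<gamma>" and \<mu>: "is_fourier_transform \<gamma> \<mu>"
    and f: "f \<in> borel_measurable borel"
  shows "(\<integral>\<^sup>+k. f k * indicator (range kappa) k \<partial>\<mu>) = (\<integral>\<^sup>+x. f (kappa x) * ennreal (weight x) \<partial>count_space UNIV)"
proof -
  have sets [measurable_cong]: "sets \<mu> = sets borel"
    using \<mu> by (auto simp: is_fourier_transform_def radon_measure_def)
  note f [measurable]
  have "indicator (range kappa) k = (\<integral>\<^sup>+x. indicator {kappa x} k \<partial>count_space UNIV)" for k :: real
  proof (cases "k \<in> range kappa")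
    case True
    then obtain x0 where x0: "k = kappa x0"
      by blast
    have "(\<integral>\<^sup>+x. indicator {kappa x} k \<partial>count_space UNIV) = (\<integral>\<^sup>+x. indicator {x0} x \<partial>count_space UNIV)"
      unfolding x0 using inj_kappa by (intro nn_integral_cong) (auto simp: indicator_def inj_eq)
    then show ?thesis
      using True by simp
  next
    case False
    then have "(\<integral>\<^sup>+x. indicator {kappa x} k \<partial>count_space UNIV) = (\<integral>\<^sup>+x. 0 \<partial>count_space (UNIV :: (int \<times> int) set))"
      by (intro nn_integral_cong) (auto simp: indicator_def)
    then show ?thesis
      using False by simp
  qed
  then have "(\<integral>\<^sup>+k. f k * indicator (range kappa) k \<partial>\<mu>) = (\<integral>\<^sup>+k. \<integral>\<^sup>+x. f k * indicator {kappa x} k \<partial>count_space UNIV \<partial>\<mu>)"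
    by (simp add: nn_integral_cmult)
  also have "\<dots> = (\<integral>\<^sup>+x. \<integral>\<^sup>+k. f k * indicator {kappa x} k \<partial>\<mu> \<partial>count_space UNIV)"
    by (rule nn_integral_count_space_nn_integral) auto
  also have "\<dots> = (\<integral>\<^sup>+x. f (kappa x) * ennreal (weight x) \<partial>count_space UNIV)"
  proof (rule nn_integral_cong)
    fix x
    have "(\<integral>\<^sup>+k. f k * indicator {kappa x} k \<partial>\<mu>) = (\<integral>\<^sup>+k. f (kappa x) * indicator {kappa x} k \<partial>\<mu>)"
      by (intro nn_integral_cong) (auto simp: indicator_def)
    then show "(\<integral>\<^sup>+k. f k * indicator {kappa x} k \<partial>\<mu>) = f (kappa x) * ennreal (weight x)"
      by (simp add: nn_integral_cmult_indicator emeasure_atom[OF \<gamma> \<mu>])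
  qed
  finally show ?thesis .
qed

text \<open>The atoms already account for the whole, finite integral of a Gaussian. As the Gaussian
  is strictly positive, nothing remains outside them.\<close>

lemma AE_range_kappa:
  assumes \<gamma>: "is_autocorrelation (left_endpoints T) \<gamma>" and \<mu>: "is_fourier_transform \<gamma> \<mu>"
  shows "AE k in \<mu>. k \<in> range kappa"
proof -
  have sets [measurable_cong]: "sets \<mu> = sets borel"
    using \<mu> by (auto simp: is_fourier_transform_def radon_measure_def)
  have [measurable]: "range kappa \<in> sets borel"
    by (rule sets.countable) auto
  let ?g = "\<lambda>k. ennreal (gauss 1 0 k)"
  have total: "(\<integral>\<^sup>+k. ?g k \<partial>\<mu>) = ennreal (LINT k|\<mu>. gauss 1 0 k)"
    using integral_gauss_diffraction(1)[OF \<gamma> \<mu>, of 1 0]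
    by (intro nn_integral_eq_integral) (auto simp: less_imp_le[OF gauss_pos])
  have "(\<integral>\<^sup>+k. ?g k * indicator (range kappa) k \<partial>\<mu>) = (\<integral>\<^sup>+x. ennreal (gauss 1 0 (kappa x) * weight x) \<partial>count_space UNIV)"
    by (subst nn_integral_atoms[OF \<gamma> \<mu>]) (auto simp: ennreal_mult weight_nonneg less_imp_le[OF gauss_pos])
  also have "\<dots> = ennreal (LINT x|count_space UNIV. gauss 1 0 (kappa x) * weight x)"
    using integrable_gauss_weight[of 1 0]
    by (intro nn_integral_eq_integral) (auto simp: weight_nonneg less_imp_le[OF gauss_pos])
  also have "\<dots> = (\<integral>\<^sup>+k. ?g k \<partial>\<mu>)"
    unfolding total by (subst integral_gauss_diffraction(2)[OF \<gamma> \<mu>]) auto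
  finally have eq: "(\<integral>\<^sup>+k. ?g k * indicator (range kappa) k \<partial>\<mu>) = (\<integral>\<^sup>+k. ?g k \<partial>\<mu>)" .
  have "(\<integral>\<^sup>+k. ?g k \<partial>\<mu>) = (\<integral>\<^sup>+k. ?g k * indicator (range kappa) k + ?g k * indicator (- range kappa) k \<partial>\<mu>)"
    by (intro nn_integral_cong) (auto simp: indicator_def)
  also have "\<dots> = (\<integral>\<^sup>+k. ?g k \<partial>\<mu>) + (\<integral>\<^sup>+k. ?g k * indicator (- range kappa) k \<partial>\<mu>)"
    by (subst nn_integral_add) (auto simp: eq)
  finally have "ennreal (LINT k|\<mu>. gauss 1 0 k) + 0 =
      ennreal (LINT k|\<mu>. gauss 1 0 k) + (\<integral>\<^sup>+k. ?g k * indicator (- range kappa) k \<partial>\<mu>)"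
    unfolding total by simp
  then have "(\<integral>\<^sup>+k. ?g k * indicator (- range kappa) k \<partial>\<mu>) = 0"
    unfolding ennreal_add_left_cancel by simp
  then have "AE k in \<mu>. ?g k * indicator (- range kappa) k = 0"
    by (subst (asm) nn_integral_0_iff_AE) auto
  then show ?thesis
    by eventually_elim (auto simp: indicator_def gauss_def split: if_splits)
qed

lemma emeasure_diffraction:
  assumes \<gamma>: "is_autocorrelation (left_endpoints T) \<gamma>" and \<mu>: "is_fourier_transform \<gamma> \<mu>"
    and A: "A \<in> sets borel"
  shows "emeasure \<mu> A = (\<integral>\<^sup>+x. indicator A (kappa x) * ennreal (weight x) \<partial>count_space UNIV)"
proof -
  have sets [measurable_cong]: "sets \<mu> = sets borel"
    using \<mu> by (auto simp: is_fourier_transform_def radon_measure_def)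
  have "emeasure \<mu> A = (\<integral>\<^sup>+k. indicator A k \<partial>\<mu>)"
    using A by (simp add: sets)
  also have "\<dots> = (\<integral>\<^sup>+k. indicator A k * indicator (range kappa) k \<partial>\<mu>)"
    using AE_range_kappa[OF \<gamma> \<mu>] by (intro nn_integral_cong_AE) (auto elim!: eventually_mono)
  also have "\<dots> = (\<integral>\<^sup>+x. indicator A (kappa x) * ennreal (weight x) \<partial>count_space UNIV)"
    using A by (intro nn_integral_atoms[OF \<gamma> \<mu>]) auto
  finally show ?thesis .
qed

end

section \<open>Scaling near the origin\<close>

lemma ex_sinc2_ge: "\<exists>d>0. \<forall>t. \<bar>t\<bar> < d \<longrightarrow> 1 / 2 \<le> sinc2 t"
proof -
  have "isCont sinc2 0"
    using continuous_on_sinc2[of UNIV] by (simp add: continuous_on_eq_continuous_at)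
  then obtain d where d: "d > 0" "\<And>t. \<bar>t\<bar> < d \<Longrightarrow> \<bar>sinc2 t - 1\<bar> < 1 / 2"
    unfolding continuous_at_eps_delta dist_real_def
    by (metis diff_zero half_gt_zero_iff sinc2_0 zero_less_one)
  have "1 / 2 \<le> sinc2 t" if "\<bar>t\<bar> < d" for t
    using d(2)[OF that] by linarith
  then show ?thesis
    using d(1) by blast
qed

lemma sinc2_le_1: "sinc2 t \<le> 1"
proof (cases "t = 0")
  case False
  have "(sin (pi * t))\<^sup>2 \<le> (pi * t)\<^sup>2"
    using abs_sin_x_le_abs_x by (simp add: abs_le_square_iff)
  then show ?thesis
    using False by (simp add: sinc2_eq divide_le_eq)
qed simp

context noble_means
begin

text \<open>The Fourier module and its image under the star map, in coordinates that do not involve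
  a fractional part.\<close>

definition rho :: "int \<times> int \<Rightarrow> real" where
  "rho = (\<lambda>(m, n). (m * lam + n) / (lam\<^sup>2 + 1))"

definition rho_star :: "int \<times> int \<Rightarrow> real" where
  "rho_star = (\<lambda>(m, n). (lam + 1) * (n * lam - m) / (lam\<^sup>2 + 1))"

lemma lam_sq_plus_1_pos: "lam\<^sup>2 + 1 > 0"
  by (simp add: add_nonneg_pos)

text \<open>\<open>rho_star\<close> is the conjugate of \<open>rho\<close> times the window length
  \<open>1 + mu\<close>; this normalisation makes the difference to \<open>rho * de\<close> an
  integer.\<close>

lemma rho_star_eq: "rho_star (m, n) = rho (m, n) * de - (m - n)"
proof -
  have "(lam\<^sup>2 + 1) * rho_star (m, n) = (lam + 1) * (n * lam - m)"
    "(lam\<^sup>2 + 1) * rho (m, n) = m * lam + n"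
    using lam_sq_plus_1_pos by (simp_all add: rho_star_def rho_def)
  then have "(lam\<^sup>2 + 1) * rho_star (m, n) = (lam\<^sup>2 + 1) * (rho (m, n) * de - (m - n))"
    unfolding de_def of_int_diff by algebra
  then show ?thesis
    using lam_sq_plus_1_pos by simp
qed

lemma rho_star_nonzero:
  assumes "rho x > 0"
  shows "rho_star x \<noteq> 0"
proof
  obtain m n where x: "x = (m, n)"
    by (cases x)
  assume "rho_star x = 0"
  then have "of_int n * lam + of_int (- m) = 0"
    using lam_pos lam_sq_plus_1_pos by (auto simp: x rho_star_def)
  from lam_linear_independent[OF this] assms show False
    by (simp add: x rho_def)
qed

text \<open>Multiplication by the unit \<open>1 / lam = lam - p\<close>, in coordinates with respect
  to \<open>lam\<close> and 1.\<close>

definition rescale :: "int \<times> int \<Rightarrow> int \<times> int" where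
  "rescale = (\<lambda>(m, n). (n, m - int p * n))"

lemma bij_rescale: "bij rescale"
  by (rule o_bij[of "\<lambda>(m, n). (int p * m + n, m)"]) (auto simp: rescale_def fun_eq_iff)

lemma rho_rescale: "rho (rescale x) = rho x / lam"
proof -
  obtain m n where x: "x = (m, n)"
    by (cases x)
  have eq: "m * lam + n = lam * (n * lam + (m - p * n))"
    using lam_sq unfolding of_int_diff of_int_mult of_int_of_nat_eq by algebra
  show ?thesis
    unfolding x rho_def rescale_def prod.case eq using lam_pos by simp
qed

lemma rho_star_rescale: "rho_star (rescale x) = - lam * rho_star x"
proof -
  obtain m n where x: "x = (m, n)"
    by (cases x)
  have eq: "(m - p * n) * lam - n = - lam * (n * lam - m)"
    using lam_sq unfolding of_int_diff of_int_mult of_int_of_nat_eq by algebra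
  show ?thesis
    unfolding x rho_star_def rescale_def prod.case eq by simp
qed

text \<open>Up to the factor \<open>de\<^sup>2 / c\<^sup>2\<close>, the mass of the diffraction
  measure on the interval with every sine linearised.\<close>

definition scaling_sum :: "real \<Rightarrow> ennreal" where
  "scaling_sum k = (\<integral>\<^sup>+x. indicator {0<..k} (rho x) * ennreal ((rho x / rho_star x)\<^sup>2) \<partial>count_space UNIV)"

lemma scaling_sum_mono: "k \<le> l \<Longrightarrow> scaling_sum k \<le> scaling_sum l"
  unfolding scaling_sum_def by (intro nn_integral_mono mult_right_mono) (auto simp: indicator_def)

lemma scaling_sum_rescale: "scaling_sum (k / lam) = ennreal (1 / lam ^ 4) * scaling_sum k"
proof -
  have "scaling_sum (k / lam) =
      (\<integral>\<^sup>+x. indicator {0<..k / lam} (rho (rescale x)) * ennreal ((rho (rescale x) / rho_star (rescale x))\<^sup>2) \<partial>count_space UNIV)"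
    unfolding scaling_sum_def by (rule nn_integral_bij_count_space[symmetric]) (rule bij_rescale)
  also have "\<dots> = (\<integral>\<^sup>+x. ennreal (1 / lam ^ 4) * (indicator {0<..k} (rho x) * ennreal ((rho x / rho_star x)\<^sup>2)) \<partial>count_space UNIV)"
  proof (rule nn_integral_cong)
    fix x
    have "indicator {0<..k / lam} (rho (rescale x)) = (indicator {0<..k} (rho x) :: ennreal)"
      using lam_pos by (auto simp: rho_rescale indicator_def field_simps)
    moreover have "(rho (rescale x) / rho_star (rescale x))\<^sup>2 = 1 / lam ^ 4 * (rho x / rho_star x)\<^sup>2"
      using lam_pos by (simp add: rho_rescale rho_star_rescale power_divide power_mult_distrib power2_eq_square power4_eq_xxxx)
    ultimately show "indicator {0<..k / lam} (rho (rescale x)) * ennreal ((rho (rescale x) / rho_star (rescale x))\<^sup>2) =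
        ennreal (1 / lam ^ 4) * (indicator {0<..k} (rho x) * ennreal ((rho x / rho_star x)\<^sup>2))"
      using lam_pos by (simp only: ennreal_mult zero_le_power2 zero_le_divide_1_iff zero_le_power less_imp_le mult_ac)
  qed
  also have "\<dots> = ennreal (1 / lam ^ 4) * scaling_sum k"
    unfolding scaling_sum_def by (rule nn_integral_cmult) simp
  finally show ?thesis .
qed

lemma scaling_sum_rescale_power: "scaling_sum (k / lam ^ n) = ennreal (1 / lam ^ (4 * n)) * scaling_sum k"
proof (induction n)
  case (Suc n)
  have "scaling_sum (k / lam ^ Suc n) = ennreal (1 / lam ^ 4) * scaling_sum (k / lam ^ n)"
    using scaling_sum_rescale[of "k / lam ^ n"] by (simp add: mult.commute)
  also have "\<dots> = ennreal (1 / lam ^ 4 * (1 / lam ^ (4 * n))) * scaling_sum k"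
    unfolding Suc.IH using lam_pos by (subst ennreal_mult) (simp_all only: mult.assoc, simp_all)
  also have "1 / lam ^ 4 * (1 / lam ^ (4 * n)) = 1 / lam ^ (4 * Suc n)"
    by (simp add: power_add[symmetric] add.commute)
  finally show ?case .
qed simp

lemma ex_lam_power_bracket:
  assumes "0 < k" "k \<le> k0"
  shows "\<exists>n. k0 / lam ^ Suc n \<le> k \<and> k \<le> k0 / lam ^ n"
proof -
  obtain n where n: "k0 / k < lam ^ n"
    using real_arch_pow[OF lam_gt_1] by blast
  define N where "N = (LEAST n. k0 / k < lam ^ n)"
  have N: "k0 / k < lam ^ N"
    unfolding N_def by (rule LeastI[of _ n]) (rule n)
  have "N \<noteq> 0"
  proof
    assume "N = 0"
    then show False
      using N assms by (simp add: divide_less_eq)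
  qed
  then obtain M where M: "N = Suc M"
    by (cases N) auto
  have "\<not> k0 / k < lam ^ M"
    using not_less_Least[of M "\<lambda>n. k0 / k < lam ^ n"] M by (simp add: N_def)
  then have "k \<le> k0 / lam ^ M"
    using assms lam_pos by (simp add: field_simps)
  moreover have "k0 / lam ^ Suc M \<le> k"
    using N assms lam_pos by (simp add: M field_simps)
  ultimately show ?thesis
    by blast
qed

text \<open>One term suffices: repeated rescaling moves the module element with coordinates
  \<open>(1, 0)\<close> into the interval.\<close>

lemma scaling_sum_pos:
  assumes "k > 0"
  shows "scaling_sum k > 0"
proof -
  have x0: "rho (1, 0) > 0"
    using lam_pos lam_sq_plus_1_pos by (simp add: rho_def)
  obtain n where "rho (1, 0) / k < lam ^ n"
    using real_arch_pow[OF lam_gt_1] by blast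
  then have small: "rho (1, 0) / lam ^ n \<le> k"
    using assms lam_pos by (simp add: field_simps)
  define x where "x = (rescale ^^ n) (1, 0)"
  have "rho x = rho (1, 0) / lam ^ n"
    unfolding x_def by (induction n) (simp_all add: rho_rescale mult.commute)
  then have x: "0 < rho x" "rho x \<le> k"
    using x0 small lam_pos by auto
  have "0 < ennreal ((rho x / rho_star x)\<^sup>2)"
    using x rho_star_nonzero by simp
  also have "\<dots> = indicator {0<..k} (rho x) * ennreal ((rho x / rho_star x)\<^sup>2)"
    using x by simp
  also have "\<dots> \<le> scaling_sum k"
    unfolding scaling_sum_def by (rule nn_integral_ge_point) simp
  finally show ?thesis .
qed

text \<open>At the points \<open>k0 / lam ^ n\<close> the sum is exactly proportional to the fourth
  power. Between two neighbouring ones monotonicity costs at most the factor \<open>lam ^ 4\<close>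
  in either direction.\<close>

lemma scaling_sum_asymptotics:
  assumes k0: "k0 > 0" and finite: "scaling_sum k0 < \<infinity>"
  obtains c1 c2 where "c1 > 0" "c2 > 0"
    "\<And>k. 0 < k \<Longrightarrow> k \<le> k0 \<Longrightarrow> ennreal (c1 * k ^ 4) \<le> scaling_sum k"
    "\<And>k. 0 < k \<Longrightarrow> k \<le> k0 \<Longrightarrow> scaling_sum k \<le> ennreal (c2 * k ^ 4)"
proof -
  obtain v where v: "scaling_sum k0 = ennreal v" "v \<ge> 0"
    using finite by (cases "scaling_sum k0") auto
  have "v > 0"
    using scaling_sum_pos[OF k0] by (simp add: v)
  have eq: "scaling_sum (k0 / lam ^ n) = ennreal (v / k0 ^ 4 * (k0 / lam ^ n) ^ 4)" for n
    using k0 lam_pos \<open>v > 0\<close>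
    by (simp add: scaling_sum_rescale_power v ennreal_mult[symmetric] power_divide power_mult[symmetric] mult.commute)
  have lower: "ennreal (v / k0 ^ 4 / lam ^ 4 * k ^ 4) \<le> scaling_sum k"
    and upper: "scaling_sum k \<le> ennreal (v / k0 ^ 4 * lam ^ 4 * k ^ 4)" if k: "0 < k" "k \<le> k0" for k
  proof -
    obtain n where n: "k0 / lam ^ Suc n \<le> k" "k \<le> k0 / lam ^ n"
      using ex_lam_power_bracket[OF k] by blast
    have Suc_n: "k0 / lam ^ Suc n = k0 / lam ^ n / lam"
      by (simp add: mult.commute)
    have "v / k0 ^ 4 / lam ^ 4 * k ^ 4 = v / k0 ^ 4 * (k / lam) ^ 4"
      by (simp add: power_divide)
    also have "\<dots> \<le> v / k0 ^ 4 * (k0 / lam ^ Suc n) ^ 4"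
      unfolding Suc_n using n that k0 \<open>v > 0\<close> lam_pos
      by (intro mult_left_mono power_mono divide_right_mono) auto
    finally have "ennreal (v / k0 ^ 4 / lam ^ 4 * k ^ 4) \<le> scaling_sum (k0 / lam ^ Suc n)"
      unfolding eq by (rule ennreal_leI)
    also have "\<dots> \<le> scaling_sum k"
      using n by (intro scaling_sum_mono)
    finally show "ennreal (v / k0 ^ 4 / lam ^ 4 * k ^ 4) \<le> scaling_sum k" .
    have "k0 / lam ^ n \<le> lam * k"
      using n(1) lam_pos unfolding Suc_n by (simp add: divide_le_eq mult.commute)
    then have "v / k0 ^ 4 * (k0 / lam ^ n) ^ 4 \<le> v / k0 ^ 4 * (lam * k) ^ 4"
      using k0 \<open>v > 0\<close> lam_pos by (intro mult_left_mono power_mono) auto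
    also have "\<dots> = v / k0 ^ 4 * lam ^ 4 * k ^ 4"
      by (simp add: power_mult_distrib)
    finally have "scaling_sum (k0 / lam ^ n) \<le> ennreal (v / k0 ^ 4 * lam ^ 4 * k ^ 4)"
      unfolding eq by (rule ennreal_leI)
    with scaling_sum_mono[OF n(2)] show "scaling_sum k \<le> ennreal (v / k0 ^ 4 * lam ^ 4 * k ^ 4)"
      by (rule order_trans)
  qed
  show thesis
    by (rule that[OF _ _ lower upper]) (use \<open>v > 0\<close> k0 lam_pos in auto)
qed

text \<open>Undoes the fractional part: with \<open>n = r - \<lfloor>q * al\<rfloor>\<close> the
  position \<open>(q * al + n) / c\<close> equals
  \<open>((q + n) * lam + n) / (lam\<^sup>2 + 1)\<close>.\<close>

definition module_coordinates :: "int \<times> int \<Rightarrow> int \<times> int" where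
  "module_coordinates = (\<lambda>(q, r). (q + (r - \<lfloor>q * al\<rfloor>), r - \<lfloor>q * al\<rfloor>))"

lemma bij_module_coordinates: "bij module_coordinates"
  by (rule o_bij[of "\<lambda>(m, n). (m - n, n + \<lfloor>of_int (m - n) * al\<rfloor>)"])
     (auto simp: module_coordinates_def fun_eq_iff)

lemma rho_module_coordinates: "rho (module_coordinates x) = kappa x"
proof -
  obtain q r where x: "x = (q, r)"
    by (cases x)
  define n where "n = r - \<lfloor>q * al\<rfloor>"
  have "kappa x = (q * al + n) / c"
    by (simp add: x kappa_def n_def frac_def)
  also have "\<dots> = ((q * al + n) * (lam + 1)) / (lam\<^sup>2 + 1)"
    by (simp add: c_eq)
  also have "(q * al + n) * (lam + 1) = of_int (q + n) * lam + n"
    using lam_pos by (simp add: al_def field_simps)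
  also have "\<dots> / (lam\<^sup>2 + 1) = rho (module_coordinates x)"
    by (simp add: x rho_def module_coordinates_def n_def)
  finally show ?thesis ..
qed

lemma weight_eq: "weight x = sinc2 (rho_star (module_coordinates x)) / c\<^sup>2"
proof -
  obtain q r where x: "x = (q, r)"
    by (cases x)
  have "rho_star (module_coordinates x) = kappa x * de - q"
    unfolding rho_module_coordinates[symmetric] by (simp add: x module_coordinates_def rho_star_eq)
  then show ?thesis
    by (simp add: weight_def x)
qed

text \<open>The sine in the intensity only depends on \<open>rho x * de\<close> because the latter differs from
  \<open>rho_star x\<close> by an integer; hence it contributes a factor of order \<open>rho x\<close> near the origin.\<close>

lemma sinc2_rho_star:
  assumes "rho x > 0"
  shows "sinc2 (rho_star x) = sinc2 (rho x * de) * (de\<^sup>2 * (rho x / rho_star x)\<^sup>2)"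
proof -
  obtain m n where x: "x = (m, n)"
    by (cases x)
  have "rho x * de - rho_star x = of_int (m - n)"
    by (simp add: x rho_star_eq)
  have sin_int: "sin (pi * of_int j) = 0" for j :: int
    by (simp add: sin_zero_iff_int2 mult.commute)
  have "pi * (rho x * de) = pi * rho_star x + pi * of_int (m - n)"
    unfolding distrib_left[symmetric] using \<open>rho x * de - rho_star x = of_int (m - n)\<close> by simp
  then have "sin (pi * (rho x * de)) = sin (pi * rho_star x) * cos (pi * of_int (m - n))"
    by (simp only: sin_add sin_int mult_zero_right add_0_right)
  moreover have "(cos (pi * of_int (m - n)))\<^sup>2 = 1"
    using sin_cos_squared_add[of "pi * of_int (m - n)"] by (simp only: sin_int zero_power2 add_0)
  ultimately have "(sin (pi * (rho x * de)))\<^sup>2 = (sin (pi * rho_star x))\<^sup>2"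
    by (simp add: power_mult_distrib)
  then show ?thesis
    using assms rho_star_nonzero[OF assms] de_pos
    by (simp add: sinc2_eq power_mult_distrib power_divide)
qed

end

section \<open>Comparison of the diffraction measure with the scaling sum\<close>

context noble_means_tiling_locale
begin

lemma emeasure_diffraction_Ioc:
  assumes \<gamma>: "is_autocorrelation (left_endpoints T) \<gamma>" and \<mu>: "is_fourier_transform \<gamma> \<mu>"
  shows "emeasure \<mu> {0<..k} =
    (\<integral>\<^sup>+x. indicator {0<..k} (rho x) * ennreal (sinc2 (rho_star x) / c\<^sup>2) \<partial>count_space UNIV)"
proof -
  have "emeasure \<mu> {0<..k} = (\<integral>\<^sup>+x. indicator {0<..k} (rho (module_coordinates x)) *
      ennreal (sinc2 (rho_star (module_coordinates x)) / c\<^sup>2) \<partial>count_space UNIV)"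
    by (subst emeasure_diffraction[OF \<gamma> \<mu>]) (simp_all add: rho_module_coordinates weight_eq)
  also have "\<dots> = (\<integral>\<^sup>+x. indicator {0<..k} (rho x) * ennreal (sinc2 (rho_star x) / c\<^sup>2) \<partial>count_space UNIV)"
    by (rule nn_integral_bij_count_space[OF bij_module_coordinates])
  finally show ?thesis .
qed

text \<open>By \<open>sinc2_rho_star\<close> each intensity is its linearised form times
  \<open>sinc2 (rho x * de)\<close>, a factor between 1/2 and 1 as long as \<open>rho x * de\<close>
  stays below \<open>d\<close>.\<close>

lemma emeasure_diffraction_bounds:
  assumes \<gamma>: "is_autocorrelation (left_endpoints T) \<gamma>" and \<mu>: "is_fourier_transform \<gamma> \<mu>"
    and d: "\<And>t. \<bar>t\<bar> < d \<Longrightarrow> 1 / 2 \<le> sinc2 t" and k: "k * de < d"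
  shows "ennreal (de\<^sup>2 / (2 * c\<^sup>2)) * scaling_sum k \<le> emeasure \<mu> {0<..k}"
    and "emeasure \<mu> {0<..k} \<le> ennreal (de\<^sup>2 / c\<^sup>2) * scaling_sum k"
proof -
  let ?w = "\<lambda>x. (rho x / rho_star x)\<^sup>2"
  have bounds: "1 / 2 * (de\<^sup>2 * ?w x) \<le> sinc2 (rho_star x)" "sinc2 (rho_star x) \<le> 1 * (de\<^sup>2 * ?w x)"
    if x: "rho x \<in> {0<..k}" for x
  proof -
    have "rho x * de \<le> k * de"
      using x de_pos by (intro mult_right_mono) auto
    moreover have "rho x * de > 0"
      using x de_pos by simp
    ultimately have "1 / 2 \<le> sinc2 (rho x * de)"
      using k by (intro d) linarith
    then show "1 / 2 * (de\<^sup>2 * ?w x) \<le> sinc2 (rho_star x)" "sinc2 (rho_star x) \<le> 1 * (de\<^sup>2 * ?w x)"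
      using x sinc2_le_1[of "rho x * de"] by (simp_all only: sinc2_rho_star greaterThanAtMost_iff) (intro mult_right_mono; simp)+
  qed
  have scaled: "ennreal K * scaling_sum k = (\<integral>\<^sup>+x. indicator {0<..k} (rho x) * ennreal (K * ?w x) \<partial>count_space UNIV)"
    if "K \<ge> 0" for K
    unfolding scaling_sum_def
    by (subst nn_integral_cmult[symmetric]) (simp_all add: ennreal_mult[OF that] mult_ac)
  have "ennreal (de\<^sup>2 / (2 * c\<^sup>2)) * scaling_sum k =
      (\<integral>\<^sup>+x. indicator {0<..k} (rho x) * ennreal (de\<^sup>2 / (2 * c\<^sup>2) * ?w x) \<partial>count_space UNIV)"
    by (rule scaled) simp
  also have "\<dots> \<le> emeasure \<mu> {0<..k}"
    unfolding emeasure_diffraction_Ioc[OF \<gamma> \<mu>]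
  proof (rule nn_integral_mono)
    fix x
    have "de\<^sup>2 / (2 * c\<^sup>2) * ?w x \<le> sinc2 (rho_star x) / c\<^sup>2" if "rho x \<in> {0<..k}"
      using divide_right_mono[OF bounds(1)[OF that], of "c\<^sup>2"] by simp
    then show "indicator {0<..k} (rho x) * ennreal (de\<^sup>2 / (2 * c\<^sup>2) * ?w x) \<le>
        indicator {0<..k} (rho x) * ennreal (sinc2 (rho_star x) / c\<^sup>2)"
      by (auto simp: indicator_def intro!: ennreal_leI)
  qed
  finally show "ennreal (de\<^sup>2 / (2 * c\<^sup>2)) * scaling_sum k \<le> emeasure \<mu> {0<..k}" .
  have "emeasure \<mu> {0<..k} \<le> (\<integral>\<^sup>+x. indicator {0<..k} (rho x) * ennreal (de\<^sup>2 / c\<^sup>2 * ?w x) \<partial>count_space UNIV)"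
    unfolding emeasure_diffraction_Ioc[OF \<gamma> \<mu>]
  proof (rule nn_integral_mono)
    fix x
    have "sinc2 (rho_star x) / c\<^sup>2 \<le> de\<^sup>2 / c\<^sup>2 * ?w x" if "rho x \<in> {0<..k}"
      using divide_right_mono[OF bounds(2)[OF that], of "c\<^sup>2"] by simp
    then show "indicator {0<..k} (rho x) * ennreal (sinc2 (rho_star x) / c\<^sup>2) \<le>
        indicator {0<..k} (rho x) * ennreal (de\<^sup>2 / c\<^sup>2 * ?w x)"
      by (auto simp: indicator_def intro!: ennreal_leI)
  qed
  also have "\<dots> = ennreal (de\<^sup>2 / c\<^sup>2) * scaling_sum k"
    by (rule scaled[symmetric]) simp
  finally show "emeasure \<mu> {0<..k} \<le> ennreal (de\<^sup>2 / c\<^sup>2) * scaling_sum k" .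
qed

lemma Z_bounds:
  assumes "is_diffraction_measure (left_endpoints T) \<mu>"
  shows "\<exists>c1 c2 k0. c1 > 0 \<and> c2 > 0 \<and> k0 > 0 \<and>
    (\<forall>k. 0 < k \<and> k \<le> k0 \<longrightarrow> c1 * k ^ 4 \<le> Z \<mu> k \<and> Z \<mu> k \<le> c2 * k ^ 4)"
proof -
  obtain \<gamma> where \<gamma>: "is_autocorrelation (left_endpoints T) \<gamma>" and \<mu>: "is_fourier_transform \<gamma> \<mu>"
    using assms by (auto simp: is_diffraction_measure_def)
  obtain d where d: "d > 0" "\<And>t. \<bar>t\<bar> < d \<Longrightarrow> 1 / 2 \<le> sinc2 t"
    using ex_sinc2_ge by blast
  define k0 where "k0 = d / (2 * de)"
  have k0: "k0 > 0" "k0 * de < d"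
    using d(1) de_pos by (auto simp: k0_def)
  have small: "k * de < d" if "k \<le> k0" for k
    using mult_right_mono[OF that, of de] k0(2) de_pos by linarith
  note bounds = emeasure_diffraction_bounds[OF \<gamma> \<mu> d(2) small]
  have sets: "sets \<mu> = sets borel" and radon: "\<And>K. compact K \<Longrightarrow> emeasure \<mu> K < \<infinity>"
    using \<mu> by (auto simp: is_fourier_transform_def radon_measure_def)
  have fin: "emeasure \<mu> {0<..k} < \<infinity>" for k
  proof -
    have "{0<..k} \<subseteq> {0..k}"
      by auto
    then have "emeasure \<mu> {0<..k} \<le> emeasure \<mu> {0..k}"
      by (rule emeasure_mono) (simp add: sets)
    also have "\<dots> < \<infinity>"
      by (rule radon) simp
    finally show ?thesis .
  qed
  have Z: "emeasure \<mu> {0<..k} = ennreal (Z \<mu> k)" for k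
    unfolding Z_def using fin[of k] by (intro emeasure_eq_ennreal_measure) auto
  \<comment> \<open>Finiteness of the comparison sum at \<open>k0\<close> is read off from the lower
    bound, because the diffraction measure is finite on bounded intervals.\<close>
  have "ennreal (de\<^sup>2 / (2 * c\<^sup>2)) * scaling_sum k0 < \<infinity>"
    using bounds(1)[of k0] fin[of k0] by (auto intro: order_le_less_trans)
  then have "scaling_sum k0 < \<infinity>"
    using de_pos c_pos by (auto simp: ennreal_mult_less_top)
  from scaling_sum_asymptotics[OF k0(1) this] obtain c1 c2 where c12: "c1 > 0" "c2 > 0"
    "\<And>k. 0 < k \<Longrightarrow> k \<le> k0 \<Longrightarrow> ennreal (c1 * k ^ 4) \<le> scaling_sum k"
    "\<And>k. 0 < k \<Longrightarrow> k \<le> k0 \<Longrightarrow> scaling_sum k \<le> ennreal (c2 * k ^ 4)"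
    by metis
  show ?thesis
  proof (intro exI conjI allI impI)
    show "de\<^sup>2 / (2 * c\<^sup>2) * c1 > 0" "de\<^sup>2 / c\<^sup>2 * c2 > 0" "k0 > 0"
      using c12 de_pos c_pos k0 by auto
    fix k assume k: "0 < k \<and> k \<le> k0"
    have "ennreal (de\<^sup>2 / (2 * c\<^sup>2) * c1 * k ^ 4) = ennreal (de\<^sup>2 / (2 * c\<^sup>2)) * ennreal (c1 * k ^ 4)"
      using c12 k by (simp add: ennreal_mult[symmetric] mult_ac)
    also have "\<dots> \<le> ennreal (de\<^sup>2 / (2 * c\<^sup>2)) * scaling_sum k"
      using c12(3) k by (intro mult_left_mono) auto
    also have "\<dots> \<le> ennreal (Z \<mu> k)"
      using bounds(1)[of k] k by (simp add: Z)
    finally show "de\<^sup>2 / (2 * c\<^sup>2) * c1 * k ^ 4 \<le> Z \<mu> k"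
      by (simp add: Z_def)
    have "ennreal (Z \<mu> k) \<le> ennreal (de\<^sup>2 / c\<^sup>2) * scaling_sum k"
      using bounds(2)[of k] k by (simp add: Z)
    also have "\<dots> \<le> ennreal (de\<^sup>2 / c\<^sup>2) * ennreal (c2 * k ^ 4)"
      using c12(4) k by (intro mult_left_mono) auto
    also have "\<dots> = ennreal (de\<^sup>2 / c\<^sup>2 * c2 * k ^ 4)"
      using c12 k by (simp add: ennreal_mult[symmetric] mult_ac)
    finally show "Z \<mu> k \<le> de\<^sup>2 / c\<^sup>2 * c2 * k ^ 4"
      using c12 k by (simp add: ennreal_le_iff)
  qed
qed

end

theorem corollary3p5:
  fixes p :: nat and T :: "tile set" and \<mu> :: "real measure"
  assumes "p \<ge> 1"
    and "noble_means_tiling p T"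
    and "is_diffraction_measure (left_endpoints T) \<mu>"
  shows "(\<exists>c1 c2 k0. c1 > 0 \<and> c2 > 0 \<and> k0 > 0 \<and>
            (\<forall>k. 0 < k \<and> k \<le> k0 \<longrightarrow> c1 * k ^ 4 \<le> Z \<mu> k \<and> Z \<mu> k \<le> c2 * k ^ 4))
         \<and> Z \<mu> \<in> O[at_right 0](\<lambda>k. k ^ 4)"
proof
  interpret noble_means_tiling_locale p T
    using assms by unfold_locales
  show ex: "\<exists>c1 c2 k0. c1 > 0 \<and> c2 > 0 \<and> k0 > 0 \<and>
      (\<forall>k. 0 < k \<and> k \<le> k0 \<longrightarrow> c1 * k ^ 4 \<le> Z \<mu> k \<and> Z \<mu> k \<le> c2 * k ^ 4)"
    by (rule Z_bounds[OF assms(3)])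
  then obtain c2 k0 where "k0 > 0" and Z: "\<And>k. 0 < k \<Longrightarrow> k \<le> k0 \<Longrightarrow> Z \<mu> k \<le> c2 * k ^ 4"
    by metis
  have "eventually (\<lambda>k. k \<in> {0<..<k0}) (at_right 0)"
    using \<open>k0 > 0\<close> by (rule eventually_at_right_real)
  then have "eventually (\<lambda>k. norm (Z \<mu> k) \<le> c2 * norm (k ^ 4)) (at_right 0)"
    by eventually_elim (use Z in \<open>auto simp: Z_def\<close>)
  then show "Z \<mu> \<in> O[at_right 0](\<lambda>k. k ^ 4)"
    by (rule bigoI)
qed

end
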